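(* Let $p$ be a prime and let $(\mathcal{G},\Gamma)$ be a proper finite graph of pro-$p$ groups. Let $G=\Pi_1(\mathcal{G},\Gamma)$, let $T\subset\Gamma$ be a maximal subtree, and let $G_T=\Pi_1(\mathcal{G},T)$ be the fundamental pro-$p$ group of the restriction of $\mathcal{G}$ to $T$. Suppose that: (1) for all $v\in V(\Gamma)$, $\mathcal{R}_p(\mathcal{G}(v))=0$; (2) for all $e\in E(T)$, the restriction maps $\partial_{i,e}^{(1)}:\mathrm{H}^1(\mathcal{G}(d_i(e)),\mathbb{F}_p)\to \mathrm{H}^1(\mathcal{G}(e),\mathbb{F}_p)$ induced by $\partial_{i,e}$ are surjective for $i=0,1$; (3) for all $e\in E(\Gamma)\smallsetminus E(T)$, the square formed by the maps $$\mathrm{H}^1(G_T,\mathbb{F}_p)\to \mathrm{H}^1(\mathcal{G}(d_i(e)),\mathbb{F}_p)\xrightarrow{\ \partial_{i,e}^{(1)}\ }\mathrm{H}^1(\mathcal{G}(e),\mathbb{F}_p),\qquad i=0,1,$$ (the first arrow being induced by the canonical map $\mathcal{G}(d_i(e))\to G_T$) commutes, i.e. the two composites for $i=0$ and $i=1$ are equal, and the induced map $\mathrm{H}^1(G_T,\mathbb{F}_p)\to \mathrm{H}^1(\mathcal{G}(e),\mathbb{F}_p)$ is surjective. Then $\mathcal{R}_p(G)=0$.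
   Context: For a profinite group $G$, $\mathrm{H}^n(G,\mathbb{F}_p)$ is continuous cohomology with trivial coefficients and $\mathcal{R}_p(G)=\{\alpha\in \mathrm{H}^1(G,\mathbb{F}_p) : \alpha\smile\beta=0 \text{ for all }\beta\in \mathrm{H}^1(G,\mathbb{F}_p)\}$. A finite (Serre) graph $\Gamma$ consists of finite sets $V(\Gamma)$, $E(\Gamma)$, a map $E(\Gamma)\to V(\Gamma)\times V(\Gamma)$, $e\mapsto(d_0(e),d_1(e))$, and a map $e\mapsto\bar e$ on $E(\Gamma)$ with $\bar{\bar e}=e$, $\bar e\neq e$, $d_0(e)=d_1(\bar e)$. It is connected if any two vertices are joined by a path; a connected graph is a tree if it has no reduced closed path (a path $e_1\cdots e_n$ starting and ending at the same vertex with $e_{i+1}\neq\bar e_i$ for all $i=1,\dots,n-1$). A finite graph of pro-$p$ groups $(\mathcal{G},\Gamma)$ is a connected finite Serre graph $\Gamma$ together with pro-$p$ groups $\mathcal{G}(m)$ for every vertex and edge $m$ of $\Gamma$, with $\mathcal{G}(e)=\mathcal{G}(\bar e)$, and continuous monomorphisms $\partial_{i,e}:\mathcal{G}(e)\to\mathcal{G}(d_i(e))$ ($i=0,1$) for each edge $e$, with $\partial_{0,e}=\partial_{1,\bar e}$. For a maximal subtree $T$ of $\Gamma$, the fundamental pro-$p$ group is $$\Pi_1(\mathcal{G},\Gamma)=\Big(F\amalg\coprod_{v\in V(\Gamma)}\mathcal{G}(v)\Big)/N,$$ where $\amalg,\coprod$ denote free pro-$p$ products, $F$ is the free pro-$p$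 group with basis $\{t_e: e\in E(\Gamma)\}$, and $N$ is the closed normal subgroup generated by $\{t_e: e\in E(T)\}\cup\{t_{\bar e}t_e: e\in E(\Gamma)\}\cup\{\partial_{0,e}(x)^{-1}t_e\partial_{1,e}(x)t_e^{-1}: x\in\mathcal{G}(e),\ e\in E(\Gamma)\}$; up to isomorphism it is independent of $T$. The graph of pro-$p$ groups is proper if all canonical maps $\mathcal{G}(v)\to\Pi_1(\mathcal{G},\Gamma)$ are injective.
   Formalization: Adds the hypothesis that G(e) is nontrivial for every edge e of Γ outside T; otherwise the claim fails (e.g. one vertex, one loop, all groups trivial gives G = Z_p, whose radical is all of H^1), and it fails whenever such an edge group is trivial. *)

theory Defs
  imports
    "HOL-Analysis.Analysis"
    "HOL-Algebra.Coset"
    "HOL-Algebra.Product_Groups"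
    "HOL-Number_Theory.Residues"
begin

section \<open>Profinite and pro-\<open>p\<close> groups\<close>

record 'a topgroup = "'a monoid" +
  gtop :: "'a topology"

definition topological_group :: "('a, 'm) topgroup_scheme \<Rightarrow> bool" where
  "topological_group G \<longleftrightarrow>
     group G \<and> topspace (gtop G) = carrier G \<and>
     continuous_map (prod_topology (gtop G) (gtop G)) (gtop G) (\<lambda>(x, y). x \<otimes>\<^bsub>G\<^esub> y) \<and>
     continuous_map (gtop G) (gtop G) (\<lambda>x. inv\<^bsub>G\<^esub> x)"

definition totally_disconnected_space :: "'a topology \<Rightarrow> bool" where
  "totally_disconnected_space X \<longleftrightarrow> (\<forall>S. connectedin X S \<longrightarrow> (\<exists>a. S \<subseteq> {a}))"

definition profinite_group :: "('a, 'm) topgroup_scheme \<Rightarrow> bool" where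
  "profinite_group G \<longleftrightarrow>
     topological_group G \<and> compact_space (gtop G) \<and> Hausdorff_space (gtop G) \<and>
     totally_disconnected_space (gtop G)"

definition pro_p_group :: "nat \<Rightarrow> ('a, 'm) topgroup_scheme \<Rightarrow> bool" where
  "pro_p_group p G \<longleftrightarrow>
     profinite_group G \<and>
     (\<forall>N. N \<lhd> G \<and> openin (gtop G) N \<longrightarrow> (\<exists>k. order (G Mod N) = p ^ k))"

definition continuous_hom :: "('a, 'm) topgroup_scheme \<Rightarrow> ('b, 'n) topgroup_scheme \<Rightarrow> ('a \<Rightarrow> 'b) set" where
  "continuous_hom G H = {f \<in> hom G H. continuous_map (gtop G) (gtop H) f}"

definition quotient_group :: "('a, 'm) topgroup_scheme \<Rightarrow> 'a set \<Rightarrow> 'a set topgroup" where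
  "quotient_group G N =
     \<lparr>carrier = carrier (G Mod N), monoid.mult = monoid.mult (G Mod N), one = one (G Mod N),
      gtop = topology (\<lambda>U. U \<subseteq> carrier (G Mod N) \<and>
                            openin (gtop G) {x \<in> carrier G. N #>\<^bsub>G\<^esub> x \<in> U})\<rparr>"

lemma openin_quotient_group:
  "openin (gtop (quotient_group G N)) W \<longleftrightarrow>
     W \<subseteq> carrier (G Mod N) \<and> openin (gtop G) {x \<in> carrier G. N #>\<^bsub>G\<^esub> x \<in> W}"
proof -
  let ?pre = "\<lambda>W. {x \<in> carrier G. N #>\<^bsub>G\<^esub> x \<in> W}"
  have "istopology (\<lambda>W. W \<subseteq> carrier (G Mod N) \<and> openin (gtop G) (?pre W))"
    unfolding istopology_def
  proof (intro conjI allI impI)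
    fix V W assume "V \<subseteq> carrier (G Mod N) \<and> openin (gtop G) (?pre V)"
      and "W \<subseteq> carrier (G Mod N) \<and> openin (gtop G) (?pre W)"
    moreover have "?pre (V \<inter> W) = ?pre V \<inter> ?pre W" by blast
    ultimately show "V \<inter> W \<subseteq> carrier (G Mod N)" "openin (gtop G) (?pre (V \<inter> W))"
      by auto
  next
    fix \<W> assume "\<forall>W\<in>\<W>. W \<subseteq> carrier (G Mod N) \<and> openin (gtop G) (?pre W)"
    moreover have "?pre (\<Union>\<W>) = \<Union>(?pre ` \<W>)" by blast
    ultimately show "\<Union>\<W> \<subseteq> carrier (G Mod N)" "openin (gtop G) (?pre (\<Union>\<W>))"
      by auto
  qed
  then show ?thesis
    by (simp add: quotient_group_def topology_inverse')
qed

definition closed_normal_closure :: "('a, 'm) topgroup_scheme \<Rightarrow> 'a set \<Rightarrow> 'a set" where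
  "closed_normal_closure G S = \<Inter>{N. N \<lhd> G \<and> closedin (gtop G) N \<and> S \<subseteq> N}"


section \<open>Continuous cohomology with coefficients in \<open>F\<^sub>p\<close>\<close>

text \<open>
  Cohomology is computed by inhomogeneous continuous cochains, the coefficients carrying the
  trivial action and the discrete topology.  An element of \<open>G\<^sup>n\<close> is an extensional function on
  \<open>{..<n}\<close>.
\<close>

definition Fp :: "nat \<Rightarrow> int ring" where
  "Fp p = residue_ring (int p)"

definition tuples :: "nat \<Rightarrow> ('a, 'm) topgroup_scheme \<Rightarrow> (nat \<Rightarrow> 'a) set" where
  "tuples n G = {..<n} \<rightarrow>\<^sub>E carrier G"

definition cochains ::
    "nat \<Rightarrow> nat \<Rightarrow> ('a, 'm) topgroup_scheme \<Rightarrow> ((nat \<Rightarrow> 'a) \<Rightarrow> int) monoid" where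
  "cochains p n G =
     \<lparr>carrier = {f \<in> extensional (tuples n G).
        continuous_map (product_topology (\<lambda>_. gtop G) {..<n}) (discrete_topology (carrier (Fp p))) f},
      monoid.mult = (\<lambda>f g. \<lambda>x\<in>tuples n G. f x \<oplus>\<^bsub>Fp p\<^esub> g x),
      one = (\<lambda>x\<in>tuples n G. \<zero>\<^bsub>Fp p\<^esub>)\<rparr>"

definition signed :: "nat \<Rightarrow> nat \<Rightarrow> int \<Rightarrow> int" where
  "signed p j a = (if even j then a else \<ominus>\<^bsub>Fp p\<^esub> a)"

text \<open>
  With entries numbered from 0,
  \<open>(df)(x\<^sub>0,\<dots>,x\<^sub>n) = f(x\<^sub>1,\<dots>,x\<^sub>n) + (\<Sum>j<n. (-1)\<^sup>j\<^sup>+\<^sup>1 f(x\<^sub>0,\<dots>,x\<^sub>j x\<^sub>j\<^sub>+\<^sub>1,\<dots>,x\<^sub>n)) + (-1)\<^sup>n\<^sup>+\<^sup>1 f(x\<^sub>0,\<dots>,x\<^sub>n\<^sub>-\<^sub>1)\<close>.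
\<close>

definition coboundary ::
    "nat \<Rightarrow> nat \<Rightarrow> ('a, 'm) topgroup_scheme \<Rightarrow> ((nat \<Rightarrow> 'a) \<Rightarrow> int) \<Rightarrow> (nat \<Rightarrow> 'a) \<Rightarrow> int" where
  "coboundary p n G f = (\<lambda>x\<in>tuples (Suc n) G.
     f (\<lambda>i\<in>{..<n}. x (Suc i)) \<oplus>\<^bsub>Fp p\<^esub>
     (\<Oplus>\<^bsub>Fp p\<^esub> j\<in>{..<n}. signed p (Suc j)
        (f (\<lambda>i\<in>{..<n}. if i < j then x i else if i = j then x j \<otimes>\<^bsub>G\<^esub> x (Suc j) else x (Suc i)))) \<oplus>\<^bsub>Fp p\<^esub>
     signed p (Suc n) (f (\<lambda>i\<in>{..<n}. x i)))"

definition cocycles :: "nat \<Rightarrow> nat \<Rightarrow> ('a, 'm) topgroup_scheme \<Rightarrow> ((nat \<Rightarrow> 'a) \<Rightarrow> int) set" where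
  "cocycles p n G = kernel (cochains p n G) (cochains p (Suc n) G) (coboundary p n G)"

definition coboundaries :: "nat \<Rightarrow> nat \<Rightarrow> ('a, 'm) topgroup_scheme \<Rightarrow> ((nat \<Rightarrow> 'a) \<Rightarrow> int) set" where
  "coboundaries p n G =
     (case n of 0 \<Rightarrow> {\<one>\<^bsub>cochains p 0 G\<^esub>} | Suc m \<Rightarrow> coboundary p m G ` carrier (cochains p m G))"

definition cohomology ::
    "nat \<Rightarrow> nat \<Rightarrow> ('a, 'm) topgroup_scheme \<Rightarrow> ((nat \<Rightarrow> 'a) \<Rightarrow> int) set monoid" where
  "cohomology p n G = (cochains p n G)\<lparr>carrier := cocycles p n G\<rparr> Mod coboundaries p n G"

definition cup_cochain ::
    "nat \<Rightarrow> nat \<Rightarrow> nat \<Rightarrow> ('a, 'm) topgroup_scheme \<Rightarrow>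
     ((nat \<Rightarrow> 'a) \<Rightarrow> int) \<Rightarrow> ((nat \<Rightarrow> 'a) \<Rightarrow> int) \<Rightarrow> (nat \<Rightarrow> 'a) \<Rightarrow> int" where
  "cup_cochain p m n G f g = (\<lambda>x\<in>tuples (m + n) G.
     f (\<lambda>i\<in>{..<m}. x i) \<otimes>\<^bsub>Fp p\<^esub> g (\<lambda>i\<in>{..<n}. x (m + i)))"

text \<open>
  Operations on cohomology classes: the result does not depend on the representatives, so the
  union over all representatives is a single coset.
\<close>

definition cup ::
    "nat \<Rightarrow> nat \<Rightarrow> nat \<Rightarrow> ('a, 'm) topgroup_scheme \<Rightarrow>
     ((nat \<Rightarrow> 'a) \<Rightarrow> int) set \<Rightarrow> ((nat \<Rightarrow> 'a) \<Rightarrow> int) set \<Rightarrow> ((nat \<Rightarrow> 'a) \<Rightarrow> int) set" where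
  "cup p m n G \<alpha> \<beta> =
     (\<Union>f\<in>\<alpha>. \<Union>g\<in>\<beta>. coboundaries p (m + n) G #>\<^bsub>cochains p (m + n) G\<^esub> cup_cochain p m n G f g)"

definition pullback_cochain ::
    "nat \<Rightarrow> ('a, 'm) topgroup_scheme \<Rightarrow> ('a \<Rightarrow> 'b) \<Rightarrow> ((nat \<Rightarrow> 'b) \<Rightarrow> int) \<Rightarrow> (nat \<Rightarrow> 'a) \<Rightarrow> int" where
  "pullback_cochain n G \<phi> f = (\<lambda>x\<in>tuples n G. f (\<lambda>i\<in>{..<n}. \<phi> (x i)))"

text \<open>The map \<open>H\<^sup>n(H) \<rightarrow> H\<^sup>n(G)\<close> induced by a continuous homomorphism \<open>\<phi> : G \<rightarrow> H\<close>.\<close>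

definition cohomology_map ::
    "nat \<Rightarrow> nat \<Rightarrow> ('a, 'm) topgroup_scheme \<Rightarrow> ('a \<Rightarrow> 'b) \<Rightarrow>
     ((nat \<Rightarrow> 'b) \<Rightarrow> int) set \<Rightarrow> ((nat \<Rightarrow> 'a) \<Rightarrow> int) set" where
  "cohomology_map p n G \<phi> \<alpha> =
     (\<Union>f\<in>\<alpha>. coboundaries p n G #>\<^bsub>cochains p n G\<^esub> pullback_cochain n G \<phi> f)"

definition cup_radical :: "nat \<Rightarrow> ('a, 'm) topgroup_scheme \<Rightarrow> ((nat \<Rightarrow> 'a) \<Rightarrow> int) set set" where
  "cup_radical p G =
     {\<alpha> \<in> carrier (cohomology p 1 G).
        \<forall>\<beta>\<in>carrier (cohomology p 1 G). cup p 1 1 G \<alpha> \<beta> = \<one>\<^bsub>cohomology p 2 G\<^esub>}"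


section \<open>Free pro-\<open>p\<close> groups and free pro-\<open>p\<close> products\<close>

definition finite_p_group :: "nat \<Rightarrow> ('a, 'm) monoid_scheme \<Rightarrow> bool" where
  "finite_p_group p K \<longleftrightarrow> group K \<and> finite (carrier K) \<and> (\<exists>k. order K = p ^ k)"

text \<open>
  The universal pro-\<open>p\<close> group on a set \<open>S\<close> of symbols, subject to a condition \<open>A K h\<close> that says
  which maps \<open>h : S \<rightarrow> K\<close> into finite \<open>p\<close>-groups are admissible: the closed subgroup of the
  product of the groups \<open>K\<close> over all admissible pairs \<open>(K, h)\<close> that is topologically generated by
  the elements \<open>(h s)\<^sub>(\<^sub>K\<^sub>,\<^sub>h\<^sub>)\<close>.  As every finite group is isomorphic to one with elements in
  \<open>nat\<close>, it suffices to consider those.  The specializations below carry no convergence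
  condition on the images of the generators, so they are the usual notions for finite bases and
  finite families, which is how they are used.
\<close>

definition realizations ::
    "nat \<Rightarrow> 's set \<Rightarrow> (nat monoid \<Rightarrow> ('s \<Rightarrow> nat) \<Rightarrow> bool) \<Rightarrow> (nat monoid \<times> ('s \<Rightarrow> nat)) set" where
  "realizations p S A = {(K, h). finite_p_group p K \<and> h \<in> S \<rightarrow>\<^sub>E carrier K \<and> A K h}"

definition universal_gen ::
    "nat \<Rightarrow> 's set \<Rightarrow> (nat monoid \<Rightarrow> ('s \<Rightarrow> nat) \<Rightarrow> bool) \<Rightarrow> 's \<Rightarrow> nat monoid \<times> ('s \<Rightarrow> nat) \<Rightarrow> nat" where
  "universal_gen p S A s = (\<lambda>\<rho>\<in>realizations p S A. snd \<rho> s)"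

definition universal_pro_p_group ::
    "nat \<Rightarrow> 's set \<Rightarrow> (nat monoid \<Rightarrow> ('s \<Rightarrow> nat) \<Rightarrow> bool) \<Rightarrow>
     (nat monoid \<times> ('s \<Rightarrow> nat) \<Rightarrow> nat) topgroup" where
  "universal_pro_p_group p S A =
     (let R = realizations p S A;
          P = product_group R fst;
          X = product_topology (\<lambda>\<rho>. discrete_topology (carrier (fst \<rho>))) R;
          C = X closure_of generate P (universal_gen p S A ` S)
      in \<lparr>carrier = C, monoid.mult = monoid.mult P, one = one P, gtop = subtopology X C\<rparr>)"

definition continuous_hom_to_finite ::
    "('a, 'm) topgroup_scheme \<Rightarrow> ('b, 'n) monoid_scheme \<Rightarrow> ('a \<Rightarrow> 'b) \<Rightarrow> bool" where
  "continuous_hom_to_finite G K h \<longleftrightarrow>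
     h \<in> hom G K \<and> continuous_map (gtop G) (discrete_topology (carrier K)) h"

definition free_pro_p_group :: "nat \<Rightarrow> 'x set \<Rightarrow> (nat monoid \<times> ('x \<Rightarrow> nat) \<Rightarrow> nat) topgroup" where
  "free_pro_p_group p X = universal_pro_p_group p X (\<lambda>K h. True)"

definition free_basis :: "nat \<Rightarrow> 'x set \<Rightarrow> 'x \<Rightarrow> nat monoid \<times> ('x \<Rightarrow> nat) \<Rightarrow> nat" where
  "free_basis p X = universal_gen p X (\<lambda>K h. True)"

definition product_condition ::
    "'i set \<Rightarrow> ('i \<Rightarrow> ('a, 'm) topgroup_scheme) \<Rightarrow> nat monoid \<Rightarrow> ('i \<times> 'a \<Rightarrow> nat) \<Rightarrow> bool" where
  "product_condition I G K h \<longleftrightarrow> (\<forall>i\<in>I. continuous_hom_to_finite (G i) K (\<lambda>x. h (i, x)))"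

definition free_pro_p_product ::
    "nat \<Rightarrow> 'i set \<Rightarrow> ('i \<Rightarrow> ('a, 'm) topgroup_scheme) \<Rightarrow>
     (nat monoid \<times> ('i \<times> 'a \<Rightarrow> nat) \<Rightarrow> nat) topgroup" where
  "free_pro_p_product p I G =
     universal_pro_p_group p (SIGMA i:I. carrier (G i)) (product_condition I G)"

definition free_product_incl ::
    "nat \<Rightarrow> 'i set \<Rightarrow> ('i \<Rightarrow> ('a, 'm) topgroup_scheme) \<Rightarrow> 'i \<Rightarrow> 'a \<Rightarrow>
     nat monoid \<times> ('i \<times> 'a \<Rightarrow> nat) \<Rightarrow> nat" where
  "free_product_incl p I G i x =
     universal_gen p (SIGMA i:I. carrier (G i)) (product_condition I G) (i, x)"

text \<open>The free pro-\<open>p\<close> product of two groups, which may have elements of different types.\<close>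

definition product2_condition ::
    "('a, 'm) topgroup_scheme \<Rightarrow> ('b, 'n) topgroup_scheme \<Rightarrow> nat monoid \<Rightarrow> ('a + 'b \<Rightarrow> nat) \<Rightarrow> bool" where
  "product2_condition G H K h \<longleftrightarrow>
     continuous_hom_to_finite G K (\<lambda>x. h (Inl x)) \<and> continuous_hom_to_finite H K (\<lambda>y. h (Inr y))"

definition free_pro_p_product2 ::
    "nat \<Rightarrow> ('a, 'm) topgroup_scheme \<Rightarrow> ('b, 'n) topgroup_scheme \<Rightarrow>
     (nat monoid \<times> ('a + 'b \<Rightarrow> nat) \<Rightarrow> nat) topgroup" where
  "free_pro_p_product2 p G H =
     universal_pro_p_group p (carrier G <+> carrier H) (product2_condition G H)"

definition free_product2_inl ::
    "nat \<Rightarrow> ('a, 'm) topgroup_scheme \<Rightarrow> ('b, 'n) topgroup_scheme \<Rightarrow> 'a \<Rightarrow>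
     nat monoid \<times> ('a + 'b \<Rightarrow> nat) \<Rightarrow> nat" where
  "free_product2_inl p G H x =
     universal_gen p (carrier G <+> carrier H) (product2_condition G H) (Inl x)"

definition free_product2_inr ::
    "nat \<Rightarrow> ('a, 'm) topgroup_scheme \<Rightarrow> ('b, 'n) topgroup_scheme \<Rightarrow> 'b \<Rightarrow>
     nat monoid \<times> ('a + 'b \<Rightarrow> nat) \<Rightarrow> nat" where
  "free_product2_inr p G H y =
     universal_gen p (carrier G <+> carrier H) (product2_condition G H) (Inr y)"

subsection \<open>Basic properties of the construction\<close>

lemma finite_p_group_on_nat:
  assumes "finite_p_group p Q"
  obtains K :: "nat monoid" and b c
  where "finite_p_group p K" "b \<in> hom Q K" "c \<in> hom K Q" "\<forall>x\<in>carrier Q. c (b x) = x"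
proof -
  interpret Q: group Q using assms by (simp add: finite_p_group_def)
  have fin: "finite (carrier Q)" using assms by (simp add: finite_p_group_def)
  obtain b :: "'a \<Rightarrow> nat" where b: "inj_on b (carrier Q)"
    using finite_imp_inj_to_nat_seg[OF fin] by blast
  define c where "c = inv_into (carrier Q) b"
  have cb [simp]: "c (b x) = x" if "x \<in> carrier Q" for x
    using b that by (simp add: c_def)
  define K where "K = \<lparr>carrier = b ` carrier Q, monoid.mult = (\<lambda>x y. b (c x \<otimes>\<^bsub>Q\<^esub> c y)), one = b \<one>\<^bsub>Q\<^esub>\<rparr>"
  have "group K"
  proof (rule groupI)
    show "\<exists>y\<in>carrier K. y \<otimes>\<^bsub>K\<^esub> x = \<one>\<^bsub>K\<^esub>" if x: "x \<in> carrier K" for x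
    proof -
      obtain x' where "x' \<in> carrier Q" "x = b x'" using x by (auto simp: K_def)
      then show ?thesis by (intro bexI[of _ "b (inv\<^bsub>Q\<^esub> x')"]) (simp_all add: K_def)
    qed
  qed (auto simp: K_def Q.m_assoc)
  moreover have "order K = order Q"
    using b by (simp add: K_def order_def card_image)
  ultimately have "finite_p_group p K"
    using assms by (simp add: finite_p_group_def K_def)
  moreover have "b \<in> hom Q K" "c \<in> hom K Q"
    by (auto simp: hom_def K_def)
  ultimately show ?thesis using that cb by blast
qed

lemma continuous_hom_to_finite_compose:
  assumes "continuous_hom_to_finite G K f" "k \<in> hom K L"
  shows "continuous_hom_to_finite G L (\<lambda>x. k (f x))"
proof -
  have "continuous_map (discrete_topology (carrier K)) (discrete_topology (carrier L)) k"
    using assms(2) by (auto simp: hom_def)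
  then show ?thesis
    using assms continuous_map_compose[of "gtop G" "discrete_topology (carrier K)" f _ k]
    by (auto simp: continuous_hom_to_finite_def hom_def o_def Pi_iff)
qed

lemma continuous_hom_to_finite_cong:
  assumes "group G" "topspace (gtop G) = carrier G" "\<And>x. x \<in> carrier G \<Longrightarrow> f x = g x"
  shows "continuous_hom_to_finite G K f \<longleftrightarrow> continuous_hom_to_finite G K g"
proof -
  have "f \<in> hom G K \<longleftrightarrow> g \<in> hom G K"
    using assms(3) group.is_monoid[OF assms(1)] by (auto simp: hom_def Pi_iff monoid.m_closed)
  moreover have "continuous_map (gtop G) (discrete_topology (carrier K)) f \<longleftrightarrow>
      continuous_map (gtop G) (discrete_topology (carrier K)) g"
    using assms(2,3) continuous_map_eq[of "gtop G" _ f g] continuous_map_eq[of "gtop G" _ g f] by auto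
  ultimately show ?thesis by (simp add: continuous_hom_to_finite_def)
qed

locale universal_construction =
  fixes p :: nat and S :: "'s set" and A :: "nat monoid \<Rightarrow> ('s \<Rightarrow> nat) \<Rightarrow> bool"
begin

abbreviation "R \<equiv> realizations p S A"
abbreviation "P \<equiv> product_group R fst"
abbreviation "X \<equiv> product_topology (\<lambda>\<rho>. discrete_topology (carrier (fst \<rho>))) R"
abbreviation "\<gamma> \<equiv> universal_gen p S A"
abbreviation "C \<equiv> X closure_of generate P (\<gamma> ` S)"
abbreviation "U \<equiv> universal_pro_p_group p S A"

lemma carrier_U [simp]: "carrier U = C"
  and mult_U [simp]: "monoid.mult U = monoid.mult P"
  and one_U [simp]: "one U = one P"
  and gtop_U [simp]: "gtop U = subtopology X C"
  by (simp_all add: universal_pro_p_group_def Let_def)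

lemma realization_group: "\<rho> \<in> R \<Longrightarrow> group (fst \<rho>)"
  and realization_finite: "\<rho> \<in> R \<Longrightarrow> finite (carrier (fst \<rho>))"
  and realization_order: "\<rho> \<in> R \<Longrightarrow> \<exists>k. order (fst \<rho>) = p ^ k"
  by (auto simp: realizations_def finite_p_group_def)

lemma group_P: "group P"
  by (simp add: realization_group)

lemma gen_in_P: "\<gamma> ` S \<subseteq> carrier P"
  by (rule image_subsetI) (auto simp: universal_gen_def realizations_def)

lemma gen_in_C: "s \<in> S \<Longrightarrow> \<gamma> s \<in> C"
proof -
  assume s: "s \<in> S"
  have "generate P (\<gamma> ` S) \<subseteq> topspace X"
    using group.generate_incl[OF group_P gen_in_P] by simp
  then have "generate P (\<gamma> ` S) \<subseteq> C"
    by (rule closure_of_subset)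
  then show ?thesis
    using s generate.incl[of "\<gamma> s" "\<gamma> ` S" P] by auto
qed

lemma topspace_X: "topspace X = carrier P"
  by simp

lemma C_subset: "C \<subseteq> carrier P"
  using closure_of_subset_topspace[of X] by simp

lemma open_box:
  assumes F: "finite F" "F \<subseteq> R" and x: "x \<in> carrier P"
  shows "openin X {y \<in> carrier P. \<forall>\<rho>\<in>F. y \<rho> = x \<rho>}"
proof -
  have eq: "{y \<in> carrier P. \<forall>\<rho>\<in>F. y \<rho> = x \<rho>} =
      topspace X \<inter> (\<Inter>\<rho>\<in>F. {y \<in> topspace X. y \<rho> \<in> {x \<rho>}})"
    unfolding topspace_X by auto
  have "openin X {y \<in> topspace X. y \<rho> \<in> {x \<rho>}}" if "\<rho> \<in> F" for \<rho>
  proof (rule openin_continuous_map_preimage)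
    show "continuous_map X (discrete_topology (carrier (fst \<rho>))) (\<lambda>y. y \<rho>)"
      by (rule continuous_map_product_projection) (use F that in blast)
    have "\<rho> \<in> R" using F that by blast
    then have "x \<rho> \<in> carrier (fst \<rho>)"
      using x unfolding carrier_product_group by (rule PiE_mem[rotated])
    then show "openin (discrete_topology (carrier (fst \<rho>))) {x \<rho>}" by simp
  qed
  then have "openin X (topspace X \<inter> \<Inter>((\<lambda>\<rho>. {y \<in> topspace X. y \<rho> \<in> {x \<rho>}}) ` F))"
    using F(1) by (intro openin_Int_Inter) blast+
  then show ?thesis
    unfolding eq .
qed

lemma box_in_open:
  assumes "openin X V" "x \<in> V"
  obtains F where "finite F" "F \<subseteq> R" "{y \<in> carrier P. \<forall>\<rho>\<in>F. y \<rho> = x \<rho>} \<subseteq> V"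
proof -
  obtain W where W: "finite {\<rho> \<in> R. W \<rho> \<noteq> topspace (discrete_topology (carrier (fst \<rho>)))}"
      "x \<in> Pi\<^sub>E R W" "Pi\<^sub>E R W \<subseteq> V"
    using assms unfolding openin_product_topology_alt by blast
  define F where "F = {\<rho> \<in> R. W \<rho> \<noteq> carrier (fst \<rho>)}"
  show ?thesis
  proof (rule that)
    show "finite F" using W(1) by (simp add: F_def)
    show "F \<subseteq> R" by (auto simp: F_def)
    show "{y \<in> carrier P. \<forall>\<rho>\<in>F. y \<rho> = x \<rho>} \<subseteq> V"
    proof
      fix y assume y: "y \<in> {y \<in> carrier P. \<forall>\<rho>\<in>F. y \<rho> = x \<rho>}"
      then have yP: "y \<in> (\<Pi>\<^sub>E \<rho>\<in>R. carrier (fst \<rho>))" by simp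
      have "y \<in> Pi\<^sub>E R W"
      proof (rule PiE_I)
        fix \<rho> assume \<rho>: "\<rho> \<in> R"
        show "y \<rho> \<in> W \<rho>"
        proof (cases "\<rho> \<in> F")
          case True
          then have "y \<rho> = x \<rho>" using y by blast
          then show ?thesis using PiE_mem[OF W(2) \<rho>] by simp
        next
          case False
          then have "W \<rho> = carrier (fst \<rho>)" using \<rho> by (simp add: F_def)
          then show ?thesis using PiE_mem[OF yP \<rho>] by simp
        qed
      next
        show "y \<rho> = undefined" if "\<rho> \<notin> R" for \<rho> using PiE_arb[OF yP that] .
      qed
      then show "y \<in> V" using W(3) by blast
    qed
  qed
qed

lemma in_C_D1: "x \<in> C \<Longrightarrow> x \<in> carrier P"
  using C_subset by (rule subsetD)

lemma in_C_D2:
  assumes x: "x \<in> C" and F: "finite F" "F \<subseteq> R"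
  shows "\<exists>g\<in>generate P (\<gamma> ` S). \<forall>\<rho>\<in>F. g \<rho> = x \<rho>"
proof -
  let ?B = "{y \<in> carrier P. \<forall>\<rho>\<in>F. y \<rho> = x \<rho>}"
  have "\<forall>T. x \<in> T \<and> openin X T \<longrightarrow> (\<exists>y. y \<in> generate P (\<gamma> ` S) \<and> y \<in> T)"
    using x unfolding in_closure_of by (rule conjunct2)
  moreover have "x \<in> ?B" using in_C_D1[OF x] by (intro CollectI conjI ballI refl)
  ultimately obtain g where "g \<in> generate P (\<gamma> ` S)" "g \<in> ?B"
    using open_box[OF F in_C_D1[OF x]] by meson
  then show ?thesis by (intro bexI[of _ g]) (auto simp only: mem_Collect_eq)
qed

lemma in_C_I:
  assumes x: "x \<in> carrier P"
    and ap: "\<And>F. finite F \<Longrightarrow> F \<subseteq> R \<Longrightarrow> \<exists>g\<in>generate P (\<gamma> ` S). \<forall>\<rho>\<in>F. g \<rho> = x \<rho>"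
  shows "x \<in> C"
  unfolding in_closure_of topspace_X
proof (intro conjI allI impI)
  show "x \<in> carrier P" by (rule x)
  fix V assume V: "x \<in> V \<and> openin X V"
  obtain F where F: "finite F" "F \<subseteq> R" "{y \<in> carrier P. \<forall>\<rho>\<in>F. y \<rho> = x \<rho>} \<subseteq> V"
    using box_in_open[OF conjunct2[OF V] conjunct1[OF V]] .
  obtain g where g: "g \<in> generate P (\<gamma> ` S)" "\<forall>\<rho>\<in>F. g \<rho> = x \<rho>"
    using ap[OF F(1,2)] ..
  have "g \<in> V"
    using F(3) by (rule subsetD)
      (intro CollectI conjI group.generate_in_carrier[OF group_P gen_in_P g(1)] g(2))
  then show "\<exists>y. y \<in> generate P (\<gamma> ` S) \<and> y \<in> V"
    using g(1) by (intro exI[of _ g] conjI)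
qed

lemma subgroup_C: "subgroup C P"
proof -
  interpret P: group P by (rule group_P)
  have gen: "subgroup (generate P (\<gamma> ` S)) P"
    by (rule P.generate_is_subgroup[OF gen_in_P])
  show ?thesis
  proof (rule P.subgroupI)
    show "C \<subseteq> carrier P" by (rule C_subset)
    have "\<one>\<^bsub>P\<^esub> \<in> C"
      by (rule in_C_I[OF P.one_closed]) (use subgroup.one_closed[OF gen] in blast)
    then show "C \<noteq> {}" by blast
    show "inv\<^bsub>P\<^esub> x \<in> C" if x: "x \<in> C" for x
    proof -
      have xP: "x \<in> carrier P" by (rule in_C_D1[OF x])
      have "\<exists>g\<in>generate P (\<gamma> ` S). \<forall>\<rho>\<in>F. g \<rho> = (inv\<^bsub>P\<^esub> x) \<rho>" if F: "finite F" "F \<subseteq> R" for F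
      proof -
        obtain g where g: "g \<in> generate P (\<gamma> ` S)" "\<forall>\<rho>\<in>F. g \<rho> = x \<rho>"
          using in_C_D2[OF x F] ..
        have gP: "g \<in> carrier P" using g(1) subgroup.subset[OF gen] by blast
        have "\<forall>\<rho>\<in>F. (inv\<^bsub>P\<^esub> g) \<rho> = (inv\<^bsub>P\<^esub> x) \<rho>"
          using g(2) F(2) xP gP by (auto simp: realization_group)
        then show ?thesis using subgroup.m_inv_closed[OF gen g(1)] by blast
      qed
      then show ?thesis by (rule in_C_I[OF P.inv_closed[OF xP]])
    qed
    show "x \<otimes>\<^bsub>P\<^esub> y \<in> C" if x: "x \<in> C" and y: "y \<in> C" for x y
    proof -
      have xy: "x \<in> carrier P" "y \<in> carrier P" by (rule in_C_D1[OF x], rule in_C_D1[OF y])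
      have "\<exists>g\<in>generate P (\<gamma> ` S). \<forall>\<rho>\<in>F. g \<rho> = (x \<otimes>\<^bsub>P\<^esub> y) \<rho>" if F: "finite F" "F \<subseteq> R" for F
      proof -
        obtain g where g: "g \<in> generate P (\<gamma> ` S)" "\<forall>\<rho>\<in>F. g \<rho> = x \<rho>"
          using in_C_D2[OF x F] ..
        obtain h where h: "h \<in> generate P (\<gamma> ` S)" "\<forall>\<rho>\<in>F. h \<rho> = y \<rho>"
          using in_C_D2[OF y F] ..
        have "\<forall>\<rho>\<in>F. (g \<otimes>\<^bsub>P\<^esub> h) \<rho> = (x \<otimes>\<^bsub>P\<^esub> y) \<rho>"
          using g(2) h(2) F(2) by auto
        then show ?thesis using subgroup.m_closed[OF gen g(1) h(1)] by blast
      qed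
      then show ?thesis by (rule in_C_I[OF P.m_closed[OF xy]])
    qed
  qed
qed

lemma U_eq: "monoid.truncate U = P\<lparr>carrier := C\<rparr>"
  by (simp add: monoid.truncate_def product_group_def)

lemma group_U: "group U"
proof -
  have "group (P\<lparr>carrier := C\<rparr>)"
    by (rule subgroup.subgroup_is_group[OF subgroup_C group_P])
  then show ?thesis
    by (simp add: group_def group_axioms_def monoid_def Units_def)
qed

lemma inv_U: "x \<in> C \<Longrightarrow> inv\<^bsub>U\<^esub> x = inv\<^bsub>P\<^esub> x"
proof -
  assume x: "x \<in> C"
  interpret U: group U by (rule group_U)
  have "inv\<^bsub>P\<^esub> x \<otimes>\<^bsub>U\<^esub> x = \<one>\<^bsub>U\<^esub>"
    using x C_subset group.l_inv[OF group_P, of x] by (auto simp del: inv_product_group)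
  then show ?thesis
    using x subgroup.m_inv_closed[OF subgroup_C x] by (intro U.inv_equality) auto
qed

lemma proj_hom: "\<rho> \<in> R \<Longrightarrow> (\<lambda>x. x \<rho>) \<in> hom U (fst \<rho>)"
  using C_subset by (auto simp: hom_def PiE_iff)

lemma proj_continuous:
  "\<rho> \<in> R \<Longrightarrow> continuous_map (gtop U) (discrete_topology (carrier (fst \<rho>))) (\<lambda>x. x \<rho>)"
  using continuous_map_from_subtopology[OF continuous_map_product_projection] by fastforce

lemma proj_continuous_hom: "\<rho> \<in> R \<Longrightarrow> continuous_hom_to_finite U (fst \<rho>) (\<lambda>x. x \<rho>)"
  using proj_hom proj_continuous by (simp add: continuous_hom_to_finite_def)

lemma proj_gen: "\<rho> \<in> R \<Longrightarrow> \<gamma> s \<rho> = snd \<rho> s"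
  by (simp add: universal_gen_def)

lemma continuous_map_into_U:
  assumes "\<And>\<rho>. \<rho> \<in> R \<Longrightarrow> continuous_map Y (discrete_topology (carrier (fst \<rho>))) (\<lambda>y. f y \<rho>)"
    and "f \<in> topspace Y \<rightarrow> C"
  shows "continuous_map Y (gtop U) f"
proof -
  have "f ` topspace Y \<subseteq> extensional R"
    using assms(2) C_subset by (fastforce simp: PiE_iff)
  then have "continuous_map Y X f"
    using assms(1) by (auto simp: continuous_map_componentwise)
  then show ?thesis
    using assms(2) by (simp add: continuous_map_into_subtopology)
qed

lemma topspace_U: "topspace (gtop U) = C"
  using C_subset by auto

lemma topological_group_U: "topological_group U"
  unfolding topological_group_def
proof (intro conjI)
  interpret U: group U by (rule group_U)
  show "group U" by (rule group_U)
  show "topspace (gtop U) = carrier U" using topspace_U by simp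
  show "continuous_map (prod_topology (gtop U) (gtop U)) (gtop U) (\<lambda>(x, y). x \<otimes>\<^bsub>U\<^esub> y)"
  proof (rule continuous_map_into_U)
    fix \<rho> assume \<rho>: "\<rho> \<in> R"
    interpret K: group "fst \<rho>" by (rule realization_group[OF \<rho>])
    let ?D = "discrete_topology (carrier (fst \<rho>))"
    have "continuous_map (prod_topology (gtop U) (gtop U)) (prod_topology ?D ?D)
            (\<lambda>z. (fst z \<rho>, snd z \<rho>))"
      using continuous_map_compose[OF continuous_map_fst proj_continuous[OF \<rho>]]
        continuous_map_compose[OF continuous_map_snd proj_continuous[OF \<rho>]]
      by (intro continuous_map_pairedI) (auto simp: o_def)
    moreover have "continuous_map (prod_topology ?D ?D) ?D (\<lambda>z. fst z \<otimes>\<^bsub>fst \<rho>\<^esub> snd z)"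
      by (auto simp: prod_topology_discrete_topology[symmetric])
    ultimately have "continuous_map (prod_topology (gtop U) (gtop U)) ?D
            ((\<lambda>z. fst z \<otimes>\<^bsub>fst \<rho>\<^esub> snd z) \<circ> (\<lambda>z. (fst z \<rho>, snd z \<rho>)))"
      by (rule continuous_map_compose)
    then show "continuous_map (prod_topology (gtop U) (gtop U)) ?D
        (\<lambda>z. (case z of (x, y) \<Rightarrow> x \<otimes>\<^bsub>U\<^esub> y) \<rho>)"
      using \<rho> by (simp add: o_def case_prod_unfold)
  next
    show "(\<lambda>(x, y). x \<otimes>\<^bsub>U\<^esub> y) \<in> topspace (prod_topology (gtop U) (gtop U)) \<rightarrow> C"
      unfolding topspace_prod_topology topspace_U
      using U.m_closed unfolding carrier_U by (auto simp del: mult_U)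
  qed
  show "continuous_map (gtop U) (gtop U) (\<lambda>x. inv\<^bsub>U\<^esub> x)"
  proof (rule continuous_map_into_U)
    fix \<rho> assume \<rho>: "\<rho> \<in> R"
    interpret K: group "fst \<rho>" by (rule realization_group[OF \<rho>])
    let ?D = "discrete_topology (carrier (fst \<rho>))"
    have "continuous_map ?D ?D (\<lambda>z. inv\<^bsub>fst \<rho>\<^esub> z)"
      by auto
    then have "continuous_map (gtop U) ?D ((\<lambda>z. inv\<^bsub>fst \<rho>\<^esub> z) \<circ> (\<lambda>x. x \<rho>))"
      using proj_continuous[OF \<rho>] by (rule continuous_map_compose[rotated])
    then show "continuous_map (gtop U) ?D (\<lambda>x. (inv\<^bsub>U\<^esub> x) \<rho>)"
    proof (rule continuous_map_eq)
      fix x assume "x \<in> topspace (gtop U)"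
      then have x: "x \<in> C" using topspace_U by simp
      then have "x \<in> carrier P" using in_C_D1 by blast
      then show "((\<lambda>z. inv\<^bsub>fst \<rho>\<^esub> z) \<circ> (\<lambda>x. x \<rho>)) x = (inv\<^bsub>U\<^esub> x) \<rho>"
        using \<rho> inv_U[OF x] by (simp add: realization_group)
    qed
  next
    show "(\<lambda>x. inv\<^bsub>U\<^esub> x) \<in> topspace (gtop U) \<rightarrow> C"
      unfolding topspace_U using U.inv_closed unfolding carrier_U by (rule funcsetI)
  qed
qed

lemma profinite_group_U: "profinite_group U"
  unfolding profinite_group_def
proof (intro conjI)
  show "topological_group U" by (rule topological_group_U)
  have "compact_space X"
    by (simp add: compact_space_product_topology compact_space_discrete_topology realization_finite)
  then show "compact_space (gtop U)"
    by (simp add: closedin_compact_space compact_space_subtopology)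
  have "Hausdorff_space X"
    by (simp add: Hausdorff_space_product_topology)
  then show "Hausdorff_space (gtop U)"
    by (simp add: Hausdorff_space_subtopology)
  show "totally_disconnected_space (gtop U)"
    unfolding totally_disconnected_space_def
  proof (intro allI impI)
    fix Z assume Z: "connectedin (gtop U) Z"
    have sub: "Z \<subseteq> carrier P"
      using connectedin_subset_topspace[OF Z] C_subset unfolding topspace_U by (rule subset_trans)
    have "x = y" if "x \<in> Z" "y \<in> Z" for x y
    proof (rule PiE_ext[of _ R "\<lambda>\<rho>. carrier (fst \<rho>)"])
      show "x \<in> (\<Pi>\<^sub>E \<rho>\<in>R. carrier (fst \<rho>))" "y \<in> (\<Pi>\<^sub>E \<rho>\<in>R. carrier (fst \<rho>))"
        using that sub unfolding carrier_product_group by blast+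
      fix \<rho> assume \<rho>: "\<rho> \<in> R"
      have "connectedin (discrete_topology (carrier (fst \<rho>))) ((\<lambda>x. x \<rho>) ` Z)"
        by (rule connectedin_continuous_map_image[OF proj_continuous[OF \<rho>] Z])
      then obtain a where "(\<lambda>x. x \<rho>) ` Z \<subseteq> {a}"
        unfolding connectedin_discrete_topology by blast
      then have "x \<rho> \<in> {a}" "y \<rho> \<in> {a}"
        using that by blast+
      then show "x \<rho> = y \<rho>" by simp
    qed
    then show "\<exists>a. Z \<subseteq> {a}" by blast
  qed
qed

lemma order_finite_product:
  assumes "finite F" "F \<subseteq> R"
  shows "\<exists>k. order (product_group F fst) = p ^ k"
  using assms
proof (induction F rule: finite_induct)
  case empty
  have "order (product_group ({} :: (nat monoid \<times> ('s \<Rightarrow> nat)) set) fst) = p ^ 0"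
    by (simp add: order_def)
  then show ?case by blast
next
  case (insert \<rho> F)
  then obtain k l where "order (product_group F fst) = p ^ k" "order (fst \<rho>) = p ^ l"
    using realization_order by blast
  then have "order (product_group (insert \<rho> F) fst) = p ^ (l + k)"
    using insert.hyps by (simp add: order_def card_PiE power_add)
  then show ?case by blast
qed

theorem pro_p_group_U:
  assumes "prime p"
  shows "pro_p_group p U"
  unfolding pro_p_group_def
proof (intro conjI allI impI)
  show "profinite_group U" by (rule profinite_group_U)
  fix N assume N: "N \<lhd> U \<and> openin (gtop U) N"
  interpret U: group U by (rule group_U)
  interpret N: normal N U using N by blast
  interpret Q: group "U Mod N" by (rule N.factorgroup_is_group)
  obtain V where V: "openin X V" "N = V \<inter> C"
    using N by (auto simp: openin_subtopology)
  have oneV: "\<one>\<^bsub>P\<^esub> \<in> V" using N.one_closed V by simp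
  obtain F where F: "finite F" "F \<subseteq> R" "{y \<in> carrier P. \<forall>\<rho>\<in>F. y \<rho> = \<one>\<^bsub>P\<^esub> \<rho>} \<subseteq> V"
    using box_in_open[OF V(1) oneV] by blast
  let ?PF = "product_group F fst"
  have PF: "group ?PF" by (rule product_group) (use F(2) realization_group in blast)
  interpret PF: group ?PF by (rule PF)
  let ?\<phi> = "\<lambda>x. restrict x F"
  have \<phi>: "?\<phi> \<in> hom U ?PF"
  proof (rule homI)
    show "?\<phi> x \<in> carrier ?PF" if "x \<in> carrier U" for x
    proof -
      have xP: "x \<in> (\<Pi>\<^sub>E \<rho>\<in>R. carrier (fst \<rho>))"
        using that in_C_D1 unfolding carrier_U carrier_product_group by blast
      have "x \<rho> \<in> carrier (fst \<rho>)" if "\<rho> \<in> F" for \<rho>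
        using PiE_mem[OF xP] F(2) that by blast
      then show ?thesis by simp
    qed
    show "?\<phi> (x \<otimes>\<^bsub>U\<^esub> y) = ?\<phi> x \<otimes>\<^bsub>?PF\<^esub> ?\<phi> y" if "x \<in> carrier U" "y \<in> carrier U" for x y
      using F(2) by (auto simp: fun_eq_iff)
  qed
  interpret \<phi>: group_hom U ?PF ?\<phi>
    using \<phi> by (simp add: group_hom_def group_hom_axioms_def U.group_axioms PF)
  have ker: "x \<in> N" if "x \<in> C" "?\<phi> x = \<one>\<^bsub>?PF\<^esub>" for x
  proof -
    have "x \<rho> = \<one>\<^bsub>P\<^esub> \<rho>" if \<rho>: "\<rho> \<in> F" for \<rho>
    proof -
      have "\<rho> \<in> R" using \<rho> F(2) by blast
      then show ?thesis using fun_cong[OF \<open>?\<phi> x = \<one>\<^bsub>?PF\<^esub>\<close>, of \<rho>] \<rho> by simp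
    qed
    then have "x \<in> V"
      using F(3) in_C_D1[OF that(1)] by (intro subsetD[OF F(3)] CollectI conjI ballI) assumption+
    then show ?thesis unfolding V(2) using that(1) by (rule IntI)
  qed
  have same: "N #>\<^bsub>U\<^esub> x = N #>\<^bsub>U\<^esub> y" if "x \<in> C" "y \<in> C" "?\<phi> x = ?\<phi> y" for x y
  proof -
    have "?\<phi> (x \<otimes>\<^bsub>U\<^esub> inv\<^bsub>U\<^esub> y) = \<one>\<^bsub>?PF\<^esub>"
      using that \<phi>.hom_mult[of x "inv\<^bsub>U\<^esub> y"] \<phi>.hom_inv[of y] PF.r_inv[of "?\<phi> y"]
        \<phi>.hom_closed[of y] U.inv_closed[of y] by (simp del: mult_U one_product_group mult_product_group carrier_product_group)
    then have "x \<otimes>\<^bsub>U\<^esub> inv\<^bsub>U\<^esub> y \<in> N"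
      using ker that U.m_closed[of x "inv\<^bsub>U\<^esub> y"] U.inv_closed[of y] by simp
    then have "x \<in> N #>\<^bsub>U\<^esub> y"
      using N.rcos_module_rev[OF U.group_axioms, of y x] that by simp
    then show ?thesis
      using U.repr_independence[OF _ _ N.subgroup_axioms, of x y] that by simp
  qed
  let ?I = "?PF\<lparr>carrier := ?\<phi> ` C\<rparr>"
  have subI: "subgroup (?\<phi> ` C) ?PF"
    using \<phi>.img_is_subgroup by simp
  define g where "g = (\<lambda>y. N #>\<^bsub>U\<^esub> (SOME x. x \<in> C \<and> ?\<phi> x = y))"
  have g: "g (?\<phi> x) = N #>\<^bsub>U\<^esub> x" if "x \<in> C" for x
  proof -
    have "(SOME x'. x' \<in> C \<and> ?\<phi> x' = ?\<phi> x) \<in> C \<and> ?\<phi> (SOME x'. x' \<in> C \<and> ?\<phi> x' = ?\<phi> x) = ?\<phi> x"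
      by (rule someI[of "\<lambda>x'. x' \<in> C \<and> ?\<phi> x' = ?\<phi> x" x]) (use that in simp)
    then show ?thesis unfolding g_def using same that by blast
  qed
  have "g \<in> hom ?I (U Mod N)"
  proof (rule homI)
    show "g y \<in> carrier (U Mod N)" if "y \<in> carrier ?I" for y
      using that g by (auto simp: carrier_FactGroup)
    show "g (y \<otimes>\<^bsub>?I\<^esub> z) = g y \<otimes>\<^bsub>U Mod N\<^esub> g z" if yz: "y \<in> carrier ?I" "z \<in> carrier ?I" for y z
    proof -
      obtain x x' where x: "x \<in> C" "x' \<in> C" "y = ?\<phi> x" "z = ?\<phi> x'"
        using yz by auto
      have "y \<otimes>\<^bsub>?I\<^esub> z = ?\<phi> (x \<otimes>\<^bsub>U\<^esub> x')"
        using \<phi>.hom_mult[of x x'] x by simp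
      then show ?thesis
        using g[of "x \<otimes>\<^bsub>U\<^esub> x'"] g[OF x(1)] g[OF x(2)] x N.rcos_sum[of x x'] U.m_closed[of x x']
        by (simp del: mult_U)
    qed
  qed
  then interpret g: group_hom ?I "U Mod N" g
    using subgroup.subgroup_is_group[OF subI PF] Q.group_axioms
    by (simp add: group_hom_def group_hom_axioms_def)
  have surj: "g ` carrier ?I = carrier (U Mod N)"
    using g by (force simp: carrier_FactGroup image_iff)
  have "order (U Mod N) = order (?I Mod kernel ?I (U Mod N) g)"
    using g.FactGroup_iso_set[OF surj] by (rule iso_same_order[symmetric])
  also have "\<dots> = card (rcosets\<^bsub>?I\<^esub> kernel ?I (U Mod N) g)"
    by (simp only: order_def FactGroup_def partial_object.select_convs)
  finally have d1: "order (U Mod N) dvd order ?I"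
    using g.G.lagrange[OF g.subgroup_kernel] dvd_triv_left by metis
  have "order ?I = card (?\<phi> ` C)"
    by (simp add: order_def)
  then have d2: "order ?I dvd order ?PF"
    using PF.lagrange[OF subI] dvd_triv_right by metis
  obtain k where k: "order ?PF = p ^ k"
    using order_finite_product[OF F(1,2)] ..
  have "order (U Mod N) dvd p ^ k"
    using dvd_trans[OF d1 d2] unfolding k .
  then show "\<exists>k. order (U Mod N) = p ^ k"
    using divides_primepow_nat[OF \<open>prime p\<close>] by blast
qed

lemma continuous_hom_unique:
  assumes K: "group K" and f: "continuous_hom_to_finite U K f" and g: "continuous_hom_to_finite U K g"
    and eq: "\<And>s. s \<in> S \<Longrightarrow> f (\<gamma> s) = g (\<gamma> s)" and x: "x \<in> C"
  shows "f x = g x"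
proof -
  interpret f: group_hom U K f
    using f K by (simp only: group_hom_def group_hom_axioms_def continuous_hom_to_finite_def group_U)
  interpret g: group_hom U K g
    using g K by (simp only: group_hom_def group_hom_axioms_def continuous_hom_to_finite_def group_U)
  have on_gen: "z \<in> C \<and> f z = g z" if "z \<in> generate P (\<gamma> ` S)" for z
    using that
  proof (induction rule: generate.induct)
    case one
    show ?case
      using f.hom_one g.hom_one subgroup.one_closed[OF subgroup_C] unfolding one_U by metis
  next
    case (incl h)
    then obtain s where "s \<in> S" "h = \<gamma> s" by blast
    then show ?case using eq[of s] gen_in_C[of s] by blast
  next
    case (inv h)
    then obtain s where s: "s \<in> S" "h = \<gamma> s" by blast
    then have h: "h \<in> C" "f h = g h" using eq[of s] gen_in_C[of s] by blast+
    have "f (inv\<^bsub>U\<^esub> h) = g (inv\<^bsub>U\<^esub> h)"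
      using f.hom_inv[of h] g.hom_inv[of h] h by simp
    then show ?case
      using subgroup.m_inv_closed[OF subgroup_C h(1)] unfolding inv_U[OF h(1)] by blast
  next
    case (eng h1 h2)
    then have h: "h1 \<in> C" "h2 \<in> C" "f h1 = g h1" "f h2 = g h2" by blast+
    have "f (h1 \<otimes>\<^bsub>U\<^esub> h2) = g (h1 \<otimes>\<^bsub>U\<^esub> h2)"
      using f.hom_mult[of h1 h2] g.hom_mult[of h1 h2] h by (simp del: mult_U)
    then show ?case
      using subgroup.m_closed[OF subgroup_C h(1,2)] unfolding mult_U by blast
  qed
  let ?D = "discrete_topology (carrier K)"
  have pre: "openin (gtop U) {z \<in> topspace (gtop U). h z \<in> {h x}}"
    if "continuous_hom_to_finite U K h" for h
  proof (rule openin_continuous_map_preimage)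
    show "continuous_map (gtop U) ?D h" using that by (simp only: continuous_hom_to_finite_def)
    have "h x \<in> carrier K"
      using that x by (intro hom_in_carrier[of h U K]) (simp_all add: continuous_hom_to_finite_def)
    then show "openin ?D {h x}" by simp
  qed
  obtain V where V: "openin X V" "{z \<in> C. f z \<in> {f x}} \<inter> {z \<in> C. g z \<in> {g x}} = V \<inter> C"
    using openin_Int[OF pre[OF f] pre[OF g]] unfolding topspace_U unfolding gtop_U openin_subtopology
    by blast
  have "x \<in> V" using V(2) x by blast
  then obtain z where z: "z \<in> generate P (\<gamma> ` S)" "z \<in> V"
    using x V(1) unfolding in_closure_of by meson
  then have "f z = f x" "g z = g x" "f z = g z" using on_gen[OF z(1)] V(2) by blast+
  then show ?thesis by simp
qed

lemma continuous_hom_exists: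
  assumes Q: "finite_p_group p Q" and h: "h \<in> S \<rightarrow> carrier Q"
    and A: "\<And>K b. b \<in> hom Q K \<Longrightarrow> A K (\<lambda>s\<in>S. b (h s))"
  shows "\<exists>f. continuous_hom_to_finite U Q f \<and> (\<forall>s\<in>S. f (\<gamma> s) = h s)"
proof -
  obtain K :: "nat monoid" and b c where K: "finite_p_group p K" "b \<in> hom Q K" "c \<in> hom K Q"
      "\<forall>x\<in>carrier Q. c (b x) = x"
    by (rule finite_p_group_on_nat[OF Q])
  let ?\<rho> = "(K, \<lambda>s\<in>S. b (h s))"
  have "(\<lambda>s\<in>S. b (h s)) \<in> S \<rightarrow>\<^sub>E carrier K"
    using h hom_in_carrier[OF K(2)] by (simp add: Pi_iff)
  then have \<rho>: "?\<rho> \<in> R"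
    using K(1) A[OF K(2)] by (simp add: realizations_def)
  have "continuous_hom_to_finite U Q (\<lambda>x. c (x ?\<rho>))"
    using continuous_hom_to_finite_compose[OF proj_continuous_hom[OF \<rho>], of c Q] K(3) by simp
  moreover have "\<forall>s\<in>S. c (\<gamma> s ?\<rho>) = h s"
    using K(4) h proj_gen[OF \<rho>] by (auto simp: Pi_iff)
  ultimately show ?thesis by (intro exI[of _ "\<lambda>x. c (x ?\<rho>)"] conjI)
qed

lemma continuous_hom_into_U:
  assumes "group G" "topspace (gtop G) = carrier G"
    and f: "\<And>x. x \<in> carrier G \<Longrightarrow> f x \<in> C"
    and proj: "\<And>\<rho>. \<rho> \<in> R \<Longrightarrow> continuous_hom_to_finite G (fst \<rho>) (\<lambda>x. f x \<rho>)"
  shows "f \<in> continuous_hom G U"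
proof -
  have "f \<in> hom G U"
  proof (rule homI)
    show "f x \<in> carrier U" if "x \<in> carrier G" for x using f[OF that] by simp
    show "f (x \<otimes>\<^bsub>G\<^esub> y) = f x \<otimes>\<^bsub>U\<^esub> f y" if xy: "x \<in> carrier G" "y \<in> carrier G" for x y
    proof (rule PiE_ext[of _ R "\<lambda>\<rho>. carrier (fst \<rho>)"])
      have "x \<otimes>\<^bsub>G\<^esub> y \<in> carrier G"
        using xy \<open>group G\<close> by (simp add: group.is_monoid monoid.m_closed)
      then show "f (x \<otimes>\<^bsub>G\<^esub> y) \<in> (\<Pi>\<^sub>E \<rho>\<in>R. carrier (fst \<rho>))"
        using in_C_D1[OF f] unfolding carrier_product_group by blast
      have "f x \<otimes>\<^bsub>P\<^esub> f y \<in> C"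
        using subgroup.m_closed[OF subgroup_C f[OF xy(1)] f[OF xy(2)]] .
      then show "f x \<otimes>\<^bsub>U\<^esub> f y \<in> (\<Pi>\<^sub>E \<rho>\<in>R. carrier (fst \<rho>))"
        using in_C_D1 unfolding mult_U carrier_product_group by blast
      show "f (x \<otimes>\<^bsub>G\<^esub> y) \<rho> = (f x \<otimes>\<^bsub>U\<^esub> f y) \<rho>" if "\<rho> \<in> R" for \<rho>
        using proj[OF that] xy that by (simp add: continuous_hom_to_finite_def hom_def)
    qed
  qed
  moreover have "continuous_map (gtop G) (gtop U) f"
  proof (rule continuous_map_into_U)
    show "f \<in> topspace (gtop G) \<rightarrow> C"
      using f unfolding assms(2) by (rule funcsetI)
  qed (use proj in \<open>simp add: continuous_hom_to_finite_def\<close>)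
  ultimately show ?thesis by (simp only: continuous_hom_def mem_Collect_eq simp_thms)
qed

end

text \<open>Universal properties.  Since a pro-\<open>p\<close> group is the inverse limit of its finite \<open>p\<close>-group
  quotients, finite targets \<open>Q\<close> suffice.\<close>

theorem free_pro_p_group_universal:
  assumes "finite_p_group p Q" "h \<in> X \<rightarrow> carrier Q"
  shows "\<exists>f. continuous_hom_to_finite (free_pro_p_group p X) Q f \<and> (\<forall>x\<in>X. f (free_basis p X x) = h x)"
  unfolding free_pro_p_group_def free_basis_def
  by (rule universal_construction.continuous_hom_exists[OF assms TrueI])

theorem free_pro_p_group_unique:
  assumes "group Q"
    and "continuous_hom_to_finite (free_pro_p_group p X) Q f"
    and "continuous_hom_to_finite (free_pro_p_group p X) Q g"
    and "\<And>x. x \<in> X \<Longrightarrow> f (free_basis p X x) = g (free_basis p X x)"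
    and "z \<in> carrier (free_pro_p_group p X)"
  shows "f z = g z"
  using assms universal_construction.continuous_hom_unique[of Q p X "\<lambda>K h. True" f g z]
  by (simp add: free_pro_p_group_def free_basis_def universal_construction.carrier_U)

theorem free_pro_p_product_universal:
  assumes G: "\<And>i. i \<in> I \<Longrightarrow> topological_group (G i)" and Q: "finite_p_group p Q"
    and \<psi>: "\<And>i. i \<in> I \<Longrightarrow> continuous_hom_to_finite (G i) Q (\<psi> i)"
  shows "\<exists>f. continuous_hom_to_finite (free_pro_p_product p I G) Q f \<and>
           (\<forall>i\<in>I. \<forall>x\<in>carrier (G i). f (free_product_incl p I G i x) = \<psi> i x)"
proof -
  let ?S = "SIGMA i:I. carrier (G i)"
  have "\<exists>f. continuous_hom_to_finite (free_pro_p_product p I G) Q f \<and>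
      (\<forall>s\<in>?S. f (universal_gen p ?S (product_condition I G) s) = case_prod \<psi> s)"
    unfolding free_pro_p_product_def
  proof (rule universal_construction.continuous_hom_exists[OF Q])
    show "case_prod \<psi> \<in> ?S \<rightarrow> carrier Q"
      using \<psi> by (auto simp: continuous_hom_to_finite_def hom_def)
    fix K :: "nat monoid" and b assume b: "b \<in> hom Q K"
    show "product_condition I G K (\<lambda>s\<in>?S. b (case_prod \<psi> s))"
      unfolding product_condition_def
    proof
      fix i assume i: "i \<in> I"
      have "continuous_hom_to_finite (G i) K (\<lambda>x. b (\<psi> i x))"
        by (rule continuous_hom_to_finite_compose[OF \<psi>[OF i] b])
      then show "continuous_hom_to_finite (G i) K (\<lambda>x. (\<lambda>s\<in>?S. b (case_prod \<psi> s)) (i, x))"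
        using G[OF i] i by (subst continuous_hom_to_finite_cong[of _ _ "\<lambda>x. b (\<psi> i x)"])
          (auto simp: topological_group_def)
    qed
  qed
  then show ?thesis by (auto simp: free_product_incl_def)
qed

theorem free_pro_p_product_unique:
  assumes "group Q"
    and "continuous_hom_to_finite (free_pro_p_product p I G) Q f"
    and "continuous_hom_to_finite (free_pro_p_product p I G) Q g"
    and "\<And>i x. i \<in> I \<Longrightarrow> x \<in> carrier (G i) \<Longrightarrow>
      f (free_product_incl p I G i x) = g (free_product_incl p I G i x)"
    and "z \<in> carrier (free_pro_p_product p I G)"
  shows "f z = g z"
  using assms universal_construction.continuous_hom_unique
    [of Q p "SIGMA i:I. carrier (G i)" "product_condition I G" f g z]
  by (auto simp: free_pro_p_product_def free_product_incl_def universal_construction.carrier_U)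

theorem free_product_incl_continuous_hom:
  assumes "topological_group (G i)" and i: "i \<in> I"
  shows "free_product_incl p I G i \<in> continuous_hom (G i) (free_pro_p_product p I G)"
  unfolding free_pro_p_product_def
proof (rule universal_construction.continuous_hom_into_U)
  let ?S = "SIGMA i:I. carrier (G i)" and ?A = "product_condition I G"
  show G: "group (G i)" "topspace (gtop (G i)) = carrier (G i)"
    using assms(1) by (simp_all add: topological_group_def)
  show "free_product_incl p I G i x \<in>
      product_topology (\<lambda>\<rho>. discrete_topology (carrier (fst \<rho>))) (realizations p ?S ?A) closure_of
        generate (product_group (realizations p ?S ?A) fst) (universal_gen p ?S ?A ` ?S)"
    if "x \<in> carrier (G i)" for x
    unfolding free_product_incl_def
    by (rule universal_construction.gen_in_C) (use that i in simp)
  show "continuous_hom_to_finite (G i) (fst \<rho>) (\<lambda>x. free_product_incl p I G i x \<rho>)"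
    if \<rho>: "\<rho> \<in> realizations p ?S ?A" for \<rho>
  proof -
    have "continuous_hom_to_finite (G i) (fst \<rho>) (\<lambda>x. snd \<rho> (i, x))"
      using \<rho> i by (auto simp: realizations_def product_condition_def)
    then show ?thesis
      using \<rho> by (simp add: free_product_incl_def universal_gen_def)
  qed
qed

theorem free_pro_p_product2_universal:
  assumes G: "topological_group G" and H: "topological_group H" and Q: "finite_p_group p Q"
    and \<phi>: "continuous_hom_to_finite G Q \<phi>" and \<psi>: "continuous_hom_to_finite H Q \<psi>"
  shows "\<exists>f. continuous_hom_to_finite (free_pro_p_product2 p G H) Q f \<and>
           (\<forall>x\<in>carrier G. f (free_product2_inl p G H x) = \<phi> x) \<and>
           (\<forall>y\<in>carrier H. f (free_product2_inr p G H y) = \<psi> y)"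
proof -
  let ?S = "carrier G <+> carrier H"
  have "\<exists>f. continuous_hom_to_finite (free_pro_p_product2 p G H) Q f \<and>
      (\<forall>s\<in>?S. f (universal_gen p ?S (product2_condition G H) s) = case_sum \<phi> \<psi> s)"
    unfolding free_pro_p_product2_def
  proof (rule universal_construction.continuous_hom_exists[OF Q])
    show "case_sum \<phi> \<psi> \<in> ?S \<rightarrow> carrier Q"
      using \<phi> \<psi> by (auto simp: continuous_hom_to_finite_def hom_def)
    fix K :: "nat monoid" and b assume b: "b \<in> hom Q K"
    have "continuous_hom_to_finite G K (\<lambda>x. (\<lambda>s\<in>?S. b (case_sum \<phi> \<psi> s)) (Inl x))"
      using continuous_hom_to_finite_compose[OF \<phi> b] G
      by (subst continuous_hom_to_finite_cong[of _ _ "\<lambda>x. b (\<phi> x)"]) (auto simp: topological_group_def)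
    moreover have "continuous_hom_to_finite H K (\<lambda>x. (\<lambda>s\<in>?S. b (case_sum \<phi> \<psi> s)) (Inr x))"
      using continuous_hom_to_finite_compose[OF \<psi> b] H
      by (subst continuous_hom_to_finite_cong[of _ _ "\<lambda>x. b (\<psi> x)"]) (auto simp: topological_group_def)
    ultimately show "product2_condition G H K (\<lambda>s\<in>?S. b (case_sum \<phi> \<psi> s))"
      unfolding product2_condition_def ..
  qed
  then obtain f where "continuous_hom_to_finite (free_pro_p_product2 p G H) Q f"
    "\<forall>s\<in>?S. f (universal_gen p ?S (product2_condition G H) s) = case_sum \<phi> \<psi> s" by blast
  then show ?thesis
    unfolding free_product2_inl_def free_product2_inr_def
    by (intro exI[of _ f]) (simp add: InlI InrI)
qed

theorem free_pro_p_product2_unique: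
  assumes "group Q"
    and "continuous_hom_to_finite (free_pro_p_product2 p G H) Q f"
    and "continuous_hom_to_finite (free_pro_p_product2 p G H) Q g"
    and "\<And>x. x \<in> carrier G \<Longrightarrow> f (free_product2_inl p G H x) = g (free_product2_inl p G H x)"
    and "\<And>y. y \<in> carrier H \<Longrightarrow> f (free_product2_inr p G H y) = g (free_product2_inr p G H y)"
    and "z \<in> carrier (free_pro_p_product2 p G H)"
  shows "f z = g z"
  using assms universal_construction.continuous_hom_unique
    [of Q p "carrier G <+> carrier H" "product2_condition G H" f g z]
  by (auto simp: free_pro_p_product2_def free_product2_inl_def free_product2_inr_def
      universal_construction.carrier_U)

theorem free_product2_continuous_hom:
  assumes "topological_group G" "topological_group H"
  shows "free_product2_inl p G H \<in> continuous_hom G (free_pro_p_product2 p G H)"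
    and "free_product2_inr p G H \<in> continuous_hom H (free_pro_p_product2 p G H)"
proof -
  let ?S = "carrier G <+> carrier H" and ?A = "product2_condition G H"
  show "free_product2_inl p G H \<in> continuous_hom G (free_pro_p_product2 p G H)"
    unfolding free_pro_p_product2_def
  proof (rule universal_construction.continuous_hom_into_U)
    show "group G" "topspace (gtop G) = carrier G"
      using assms(1) by (simp_all add: topological_group_def)
    show "continuous_hom_to_finite G (fst \<rho>) (\<lambda>x. free_product2_inl p G H x \<rho>)"
      if \<rho>: "\<rho> \<in> realizations p ?S ?A" for \<rho>
    proof -
      have "continuous_hom_to_finite G (fst \<rho>) (\<lambda>x. snd \<rho> (Inl x))"
        using \<rho> by (auto simp: realizations_def product2_condition_def)
      then show ?thesis
        using \<rho> by (simp add: free_product2_inl_def universal_gen_def)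
    qed
  qed (unfold free_product2_inl_def, rule universal_construction.gen_in_C, rule InlI, assumption)
  show "free_product2_inr p G H \<in> continuous_hom H (free_pro_p_product2 p G H)"
    unfolding free_pro_p_product2_def
  proof (rule universal_construction.continuous_hom_into_U)
    show "group H" "topspace (gtop H) = carrier H"
      using assms(2) by (simp_all add: topological_group_def)
    show "continuous_hom_to_finite H (fst \<rho>) (\<lambda>x. free_product2_inr p G H x \<rho>)"
      if \<rho>: "\<rho> \<in> realizations p ?S ?A" for \<rho>
    proof -
      have "continuous_hom_to_finite H (fst \<rho>) (\<lambda>x. snd \<rho> (Inr x))"
        using \<rho> by (auto simp: realizations_def product2_condition_def)
      then show ?thesis
        using \<rho> by (simp add: free_product2_inr_def universal_gen_def)
    qed
  qed (unfold free_product2_inr_def, rule universal_construction.gen_in_C, rule InrI, assumption)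
qed

theorem pro_p_group_free_constructions:
  assumes "prime p"
  shows "pro_p_group p (free_pro_p_group p X)"
    and "pro_p_group p (free_pro_p_product p I G)"
    and "pro_p_group p (free_pro_p_product2 p G' H)"
  unfolding free_pro_p_group_def free_pro_p_product_def free_pro_p_product2_def
  by (rule universal_construction.pro_p_group_U[OF assms])+


section \<open>Finite Serre graphs\<close>

record ('v, 'e) serre_graph =
  verts :: "'v set"
  edges :: "'e set"
  d0 :: "'e \<Rightarrow> 'v"
  d1 :: "'e \<Rightarrow> 'v"
  rev_edge :: "'e \<Rightarrow> 'e"

definition finite_serre_graph :: "('v, 'e) serre_graph \<Rightarrow> bool" where
  "finite_serre_graph \<Gamma> \<longleftrightarrow>
     finite (verts \<Gamma>) \<and> finite (edges \<Gamma>) \<and>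
     (\<forall>e\<in>edges \<Gamma>. d0 \<Gamma> e \<in> verts \<Gamma> \<and> d1 \<Gamma> e \<in> verts \<Gamma> \<and> rev_edge \<Gamma> e \<in> edges \<Gamma> \<and>
        rev_edge \<Gamma> (rev_edge \<Gamma> e) = e \<and> rev_edge \<Gamma> e \<noteq> e \<and> d0 \<Gamma> e = d1 \<Gamma> (rev_edge \<Gamma> e))"

fun path_between :: "('v, 'e) serre_graph \<Rightarrow> 'v \<Rightarrow> 'e list \<Rightarrow> 'v \<Rightarrow> bool" where
  "path_between \<Gamma> u [] v \<longleftrightarrow> u \<in> verts \<Gamma> \<and> u = v"
| "path_between \<Gamma> u (e # es) v \<longleftrightarrow> e \<in> edges \<Gamma> \<and> d0 \<Gamma> e = u \<and> path_between \<Gamma> (d1 \<Gamma> e) es v"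

definition connected_graph :: "('v, 'e) serre_graph \<Rightarrow> bool" where
  "connected_graph \<Gamma> \<longleftrightarrow> (\<forall>u\<in>verts \<Gamma>. \<forall>v\<in>verts \<Gamma>. \<exists>es. path_between \<Gamma> u es v)"

definition reduced_path :: "('v, 'e) serre_graph \<Rightarrow> 'e list \<Rightarrow> bool" where
  "reduced_path \<Gamma> es \<longleftrightarrow> (\<forall>i. Suc i < length es \<longrightarrow> es ! Suc i \<noteq> rev_edge \<Gamma> (es ! i))"

definition tree_graph :: "('v, 'e) serre_graph \<Rightarrow> bool" where
  "tree_graph \<Gamma> \<longleftrightarrow>
     connected_graph \<Gamma> \<and>
     \<not> (\<exists>v es. es \<noteq> [] \<and> path_between \<Gamma> v es v \<and> reduced_path \<Gamma> es)"

definition subgraph :: "('v, 'e) serre_graph \<Rightarrow> ('v, 'e) serre_graph \<Rightarrow> bool" where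
  "subgraph T \<Gamma> \<longleftrightarrow>
     finite_serre_graph T \<and> verts T \<subseteq> verts \<Gamma> \<and> edges T \<subseteq> edges \<Gamma> \<and>
     d0 T = d0 \<Gamma> \<and> d1 T = d1 \<Gamma> \<and> rev_edge T = rev_edge \<Gamma>"

definition maximal_subtree :: "('v, 'e) serre_graph \<Rightarrow> ('v, 'e) serre_graph \<Rightarrow> bool" where
  "maximal_subtree T \<Gamma> \<longleftrightarrow>
     subgraph T \<Gamma> \<and> tree_graph T \<and>
     (\<forall>T'. subgraph T' \<Gamma> \<and> tree_graph T' \<and> subgraph T T' \<longrightarrow> T' = T)"


section \<open>Graphs of pro-\<open>p\<close> groups and their fundamental pro-\<open>p\<close> groups\<close>

text \<open>The groups are kept apart from the graph, so that the restriction of \<open>(\<G>, \<Gamma>)\<close> to a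
  subgraph \<open>T\<close> is simply \<open>(\<G>, T)\<close>.\<close>

record ('v, 'e, 'g, 'h) graph_groups =
  vgrp :: "'v \<Rightarrow> 'g topgroup"
  egrp :: "'e \<Rightarrow> 'h topgroup"
  bd0 :: "'e \<Rightarrow> 'h \<Rightarrow> 'g"
  bd1 :: "'e \<Rightarrow> 'h \<Rightarrow> 'g"

definition graph_of_pro_p_groups ::
    "nat \<Rightarrow> ('v, 'e, 'g, 'h) graph_groups \<Rightarrow> ('v, 'e) serre_graph \<Rightarrow> bool" where
  "graph_of_pro_p_groups p \<G> \<Gamma> \<longleftrightarrow>
     finite_serre_graph \<Gamma> \<and> connected_graph \<Gamma> \<and>
     (\<forall>v\<in>verts \<Gamma>. pro_p_group p (vgrp \<G> v)) \<and>
     (\<forall>e\<in>edges \<Gamma>. pro_p_group p (egrp \<G> e) \<and> egrp \<G> (rev_edge \<Gamma> e) = egrp \<G> e \<and>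
        bd0 \<G> e \<in> continuous_hom (egrp \<G> e) (vgrp \<G> (d0 \<Gamma> e)) \<and>
        inj_on (bd0 \<G> e) (carrier (egrp \<G> e)) \<and>
        bd1 \<G> e \<in> continuous_hom (egrp \<G> e) (vgrp \<G> (d1 \<Gamma> e)) \<and>
        inj_on (bd1 \<G> e) (carrier (egrp \<G> e)) \<and>
        (\<forall>x\<in>carrier (egrp \<G> e). bd0 \<G> e x = bd1 \<G> (rev_edge \<Gamma> e) x))"

text \<open>The free pro-\<open>p\<close> product \<open>F \<amalg> \<Coprod>\<^sub>v \<G>(v)\<close> with its elements \<open>t\<^sub>e\<close> and its inclusions of
  the vertex groups.\<close>

abbreviation edge_free_group ::
    "nat \<Rightarrow> ('v, 'e) serre_graph \<Rightarrow> (nat monoid \<times> ('e \<Rightarrow> nat) \<Rightarrow> nat) topgroup" where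
  "edge_free_group p \<Gamma> \<equiv> free_pro_p_group p (edges \<Gamma>)"

abbreviation vertex_free_product ::
    "nat \<Rightarrow> ('v, 'e, 'g, 'h) graph_groups \<Rightarrow> ('v, 'e) serre_graph \<Rightarrow>
     (nat monoid \<times> ('v \<times> 'g \<Rightarrow> nat) \<Rightarrow> nat) topgroup" where
  "vertex_free_product p \<G> \<Gamma> \<equiv> free_pro_p_product p (verts \<Gamma>) (vgrp \<G>)"

type_synonym ('v, 'e, 'g) big_elem =
  "nat monoid \<times> ((nat monoid \<times> ('e \<Rightarrow> nat) \<Rightarrow> nat) + (nat monoid \<times> ('v \<times> 'g \<Rightarrow> nat) \<Rightarrow> nat) \<Rightarrow> nat)
   \<Rightarrow> nat"

definition big_product ::
    "nat \<Rightarrow> ('v, 'e, 'g, 'h) graph_groups \<Rightarrow> ('v, 'e) serre_graph \<Rightarrow> ('v, 'e, 'g) big_elem topgroup" where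
  "big_product p \<G> \<Gamma> = free_pro_p_product2 p (edge_free_group p \<Gamma>) (vertex_free_product p \<G> \<Gamma>)"

definition stable_letter ::
    "nat \<Rightarrow> ('v, 'e, 'g, 'h) graph_groups \<Rightarrow> ('v, 'e) serre_graph \<Rightarrow> 'e \<Rightarrow> ('v, 'e, 'g) big_elem" where
  "stable_letter p \<G> \<Gamma> e =
     free_product2_inl p (edge_free_group p \<Gamma>) (vertex_free_product p \<G> \<Gamma>)
       (free_basis p (edges \<Gamma>) e)"

definition vertex_incl ::
    "nat \<Rightarrow> ('v, 'e, 'g, 'h) graph_groups \<Rightarrow> ('v, 'e) serre_graph \<Rightarrow> 'v \<Rightarrow> 'g \<Rightarrow> ('v, 'e, 'g) big_elem" where
  "vertex_incl p \<G> \<Gamma> v x =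
     free_product2_inr p (edge_free_group p \<Gamma>) (vertex_free_product p \<G> \<Gamma>)
       (free_product_incl p (verts \<Gamma>) (vgrp \<G>) v x)"

definition relators ::
    "nat \<Rightarrow> ('v, 'e, 'g, 'h) graph_groups \<Rightarrow> ('v, 'e) serre_graph \<Rightarrow> ('v, 'e) serre_graph \<Rightarrow>
     ('v, 'e, 'g) big_elem set" where
  "relators p \<G> \<Gamma> T =
     (let P = big_product p \<G> \<Gamma>; t = stable_letter p \<G> \<Gamma>; \<iota> = vertex_incl p \<G> \<Gamma> in
       {t e | e. e \<in> edges T} \<union>
       {t (rev_edge \<Gamma> e) \<otimes>\<^bsub>P\<^esub> t e | e. e \<in> edges \<Gamma>} \<union>
       {inv\<^bsub>P\<^esub> (\<iota> (d0 \<Gamma> e) (bd0 \<G> e x)) \<otimes>\<^bsub>P\<^esub> t e \<otimes>\<^bsub>P\<^esub> \<iota> (d1 \<Gamma> e) (bd1 \<G> e x) \<otimes>\<^bsub>P\<^esub> inv\<^bsub>P\<^esub> (t e)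
         | e x. e \<in> edges \<Gamma> \<and> x \<in> carrier (egrp \<G> e)})"

definition fundamental_kernel ::
    "nat \<Rightarrow> ('v, 'e, 'g, 'h) graph_groups \<Rightarrow> ('v, 'e) serre_graph \<Rightarrow> ('v, 'e) serre_graph \<Rightarrow>
     ('v, 'e, 'g) big_elem set" where
  "fundamental_kernel p \<G> \<Gamma> T = closed_normal_closure (big_product p \<G> \<Gamma>) (relators p \<G> \<Gamma> T)"

text \<open>\<open>\<Pi>\<^sub>1(\<G>, \<Gamma>)\<close>, formed with respect to the maximal subtree \<open>T\<close>, and its canonical maps.\<close>

definition fundamental_group ::
    "nat \<Rightarrow> ('v, 'e, 'g, 'h) graph_groups \<Rightarrow> ('v, 'e) serre_graph \<Rightarrow> ('v, 'e) serre_graph \<Rightarrow>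
     ('v, 'e, 'g) big_elem set topgroup" where
  "fundamental_group p \<G> \<Gamma> T = quotient_group (big_product p \<G> \<Gamma>) (fundamental_kernel p \<G> \<Gamma> T)"

definition canonical_map ::
    "nat \<Rightarrow> ('v, 'e, 'g, 'h) graph_groups \<Rightarrow> ('v, 'e) serre_graph \<Rightarrow> ('v, 'e) serre_graph \<Rightarrow>
     'v \<Rightarrow> 'g \<Rightarrow> ('v, 'e, 'g) big_elem set" where
  "canonical_map p \<G> \<Gamma> T v x =
     fundamental_kernel p \<G> \<Gamma> T #>\<^bsub>big_product p \<G> \<Gamma>\<^esub> vertex_incl p \<G> \<Gamma> v x"

definition proper_graph_of_groups ::
    "nat \<Rightarrow> ('v, 'e, 'g, 'h) graph_groups \<Rightarrow> ('v, 'e) serre_graph \<Rightarrow> ('v, 'e) serre_graph \<Rightarrow> bool" where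
  "proper_graph_of_groups p \<G> \<Gamma> T \<longleftrightarrow>
     (\<forall>v\<in>verts \<Gamma>. inj_on (canonical_map p \<G> \<Gamma> T v) (carrier (vgrp \<G> v)))"

end

theory Submission
  imports Defs "HOL-Algebra.Group_Action"
begin

text \<open>
  A class in \<open>H\<^sup>1\<close> is a continuous character, and \<open>\<alpha> \<smile> \<beta> = 0\<close> means that some continuous
  \<open>c\<close> satisfies \<open>c(xy) = c(x) + c(y) - \<alpha>(x) \<beta>(y)\<close>. Let \<open>\<alpha>\<close> be in the radical of \<open>\<Pi>\<^sub>1(\<G>, \<Gamma>)\<close>.

  By (2), a character of a vertex group propagates along the tree \<open>T\<close> to a character of \<open>G\<^sub>T\<close>, and
  by (3) that one extends to \<open>\<Pi>\<^sub>1(\<G>, \<Gamma>)\<close> with all stable letters sent to 0. Hence \<open>\<alpha>\<close> restricts to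
  the radical of every vertex group, so by (1) it vanishes there.

  It remains to show \<open>\<alpha>(t\<^sub>e) = 0\<close> for every edge \<open>e\<close> outside \<open>T\<close>. Choose \<open>\<beta>\<close> from \<open>G\<^sub>T\<close> with nonzero
  restriction to \<open>\<G>(e)\<close>, and \<open>c\<close> for \<open>\<alpha> \<smile> \<beta> = 0\<close>. As \<open>\<alpha>\<close> vanishes on the vertex groups, \<open>c\<close>
  restricts to characters of them, which fit together over \<open>T\<close>; so by (3) the two restrictions of
  \<open>c\<close> to \<open>\<G>(e)\<close> agree. But the relation \<open>\<partial>\<^sub>0(x) t\<^sub>e = t\<^sub>e \<partial>\<^sub>1(x)\<close> says that they differ by
  \<open>\<alpha>(t\<^sub>e) \<beta>(\<partial>\<^sub>1(x))\<close>.
\<close>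

section \<open>Characters of pro-\<open>p\<close> groups\<close>

text \<open>Cohomology enters only through functions. A 0-cochain is a constant and the action is
  trivial, so every 1-coboundary is zero, a class in H^1 is a singleton, and it amounts to a
  character up to values off the carrier. Restriction of classes becomes composition, and the
  vanishing of a cup product becomes a congruence mod p.

  Beyond its defining relations, the fundamental group is used through two facts about maps to F_p:
  compatible characters of the vertex groups glue to a character that kills the stable letters, and
  a character is determined by its values on the vertex groups and the stable letters.

  Two points need work of their own. Hypothesis (3) extends a given character of an edge group, but
  a nonzero one must exist first; for a nontrivial pro-p group it comes from a finite quotient and a
  count of fixed points. And maximality of T is meant for inclusion among subtrees, so that T
  reaches every vertex has to be derived before families indexed by the vertices of T can serve for
  \<open>\<Gamma>\<close>.\<close>

lemma (in group_action) second_fixed_point: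
  assumes p: "prime p" and ord: "order G = p ^ k" and fin: "finite E" and dvd: "p dvd card E"
    and x: "x \<in> E" "\<And>g. g \<in> carrier G \<Longrightarrow> \<phi> g x = x"
  obtains y where "y \<in> E" "y \<noteq> x" "\<And>g. g \<in> carrier G \<Longrightarrow> \<phi> g y = y"
proof -
  interpret G: group G using group_hom group_hom.axioms(1) by blast
  let ?O = "orbits G E \<phi>"
  have orb_card: "card (orbit G \<phi> y) = 1 \<or> p dvd card (orbit G \<phi> y)" if "y \<in> E" for y
  proof -
    have "card (orbit G \<phi> y) dvd p ^ k"
      using orbit_stabilizer_theorem[OF that] ord by (metis dvd_triv_left)
    then obtain i where "card (orbit G \<phi> y) = p ^ i" 
      using divides_primepow_nat[OF p] by blast
    then show ?thesis by (cases i) auto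
  qed
  have orbx: "orbit G \<phi> x = {x}"
    using x(2) G.one_closed unfolding orbit_def by (auto intro: exI[of _ "\<one>"])
  have fin_orb: "finite ?O"
    using fin by (simp add: orbits_def setcompr_eq_image)
  have xO: "{x} \<in> ?O" using x(1) orbx unfolding orbits_def by force
  have "card E = (\<Sum>X\<in>?O. card X)"
    using disjoint_sum[OF fin, of "\<lambda>_. 1::nat"] by simp
  also have "\<dots> = 1 + (\<Sum>X\<in>?O - {{x}}. card X)"
    using sum.remove[OF fin_orb xO, of card] by simp
  finally have card_E: "card E = 1 + (\<Sum>X\<in>?O - {{x}}. card X)" .
  \<comment> \<open>Otherwise \<open>card E\<close> would be 1 mod p, as \<open>{x}\<close> is an
    orbit. An orbit whose size is prime to p is a single point, since its size divides a power of
    p.\<close>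
  have "\<not> (\<forall>X \<in> ?O - {{x}}. p dvd card X)"
  proof
    assume "\<forall>X \<in> ?O - {{x}}. p dvd card X"
    then have "p dvd (\<Sum>X\<in>?O - {{x}}. card X)" by (intro dvd_sum) blast
    then have "p dvd 1" using dvd card_E by (metis dvd_add_left_iff)
    then show False using p by (simp add: not_prime_unit)
  qed
  then obtain y where y: "y \<in> E" "orbit G \<phi> y \<noteq> {x}" "\<not> p dvd card (orbit G \<phi> y)"
    unfolding orbits_def by blast
  then have "card (orbit G \<phi> y) = 1" using orb_card by blast
  moreover have "y \<in> orbit G \<phi> y"
    using y(1) orbit_refl by blast
  ultimately have "orbit G \<phi> y = {y}" by (metis card_1_singletonE singletonD)
  then show ?thesis
    using y unfolding orbit_def by (intro that[of y]) auto
qed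

lemma carrier_Fp [simp]: "carrier (Fp p) = {0..int p - 1}"
  and add_Fp [simp]: "x \<oplus>\<^bsub>Fp p\<^esub> y = (x + y) mod int p"
  and mult_Fp [simp]: "x \<otimes>\<^bsub>Fp p\<^esub> y = (x * y) mod int p"
  and zero_Fp [simp]: "\<zero>\<^bsub>Fp p\<^esub> = 0"
  by (simp_all add: Fp_def residue_ring_def)

text \<open>The homomorphisms to \<open>F\<^sub>p\<close> are the fixed points of the action \<open>(g f)(x) = f (x g) - f g\<close> on
  the functions with \<open>f 1 = 0\<close>, and the number of these functions is a positive power of \<open>p\<close>.\<close>

lemma p_group_nontrivial_hom:
  assumes p: "prime p" and K: "group K" and ord: "order K = p ^ k" and k: "k > 0"
  obtains h x where "h \<in> hom K (add_monoid (Fp p))" "x \<in> carrier K" "h x \<noteq> 0"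
proof -
  interpret K: group K by (rule K)
  let ?q = "int p"
  have q: "?q > 1" using p prime_gt_1_nat by simp
  have card_K: "card (carrier K) = p ^ k" using ord by (simp add: order_def)
  then have finK: "finite (carrier K)" using p by (metis card.infinite not_prime_0 power_not_zero)
  define E where "E = {f \<in> carrier K \<rightarrow>\<^sub>E {0..?q - 1}. f \<one>\<^bsub>K\<^esub> = 0}"
  \<comment> \<open>Right translation by \<open>g\<close> moves the value at 1 to
    \<open>f g\<close>; subtracting \<open>f g\<close> brings the function back into
    \<open>E\<close>.\<close>
  define \<phi> where "\<phi> g = (\<lambda>f\<in>E. \<lambda>x\<in>carrier K. (f (x \<otimes>\<^bsub>K\<^esub> g) - f g) mod ?q)" for g
  have \<phi>E: "\<phi> g f \<in> E" if "g \<in> carrier K" "f \<in> E" for g f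
    using that q by (auto simp: E_def \<phi>_def)
  have \<phi>_mult: "\<phi> (g \<otimes>\<^bsub>K\<^esub> h) f = \<phi> g (\<phi> h f)" if "g \<in> carrier K" "h \<in> carrier K" "f \<in> E" for g h f
  proof -
    have "\<phi> g (\<phi> h f) = (\<lambda>x\<in>carrier K. (\<phi> h f (x \<otimes>\<^bsub>K\<^esub> g) - \<phi> h f g) mod ?q)"
      using \<phi>E[OF that(2,3)] by (simp add: \<phi>_def[of g])
    also have "\<dots> = \<phi> (g \<otimes>\<^bsub>K\<^esub> h) f"
      using that by (simp add: \<phi>_def K.m_assoc mod_diff_eq cong: restrict_cong)
    finally show ?thesis by simp
  qed
  have \<phi>_one: "\<phi> \<one>\<^bsub>K\<^esub> f = f" if "f \<in> E" for f
  proof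
    fix x show "\<phi> \<one>\<^bsub>K\<^esub> f x = f x"
    proof (cases "x \<in> carrier K")
      case True
      then have "f x \<in> {0..?q-1}" "f \<one>\<^bsub>K\<^esub> = 0" using that by (auto simp: E_def)
      then show ?thesis using True that by (simp add: \<phi>_def)
    next
      case False
      then show ?thesis using that by (auto simp: \<phi>_def E_def)
    qed
  qed
  have bij: "\<phi> g \<in> Bij E" if g: "g \<in> carrier K" for g
  proof -
    have "bij_betw (\<phi> g) E E"
      using \<phi>E \<phi>_one \<phi>_mult[of g "inv\<^bsub>K\<^esub> g"] \<phi>_mult[of "inv\<^bsub>K\<^esub> g" g] g
      by (intro bij_betw_byWitness[where f' = "\<phi> (inv\<^bsub>K\<^esub> g)"]) auto
    then show ?thesis by (simp add: Bij_def \<phi>_def)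
  qed
  have "\<phi> \<in> hom K (BijGroup E)"
  proof (rule homI)
    show "\<phi> g \<in> carrier (BijGroup E)" if "g \<in> carrier K" for g
      using bij[OF that] by (simp add: BijGroup_def)
    show "\<phi> (g \<otimes>\<^bsub>K\<^esub> h) = \<phi> g \<otimes>\<^bsub>BijGroup E\<^esub> \<phi> h" if "g \<in> carrier K" "h \<in> carrier K" for g h
    proof
      fix f show "\<phi> (g \<otimes>\<^bsub>K\<^esub> h) f = (\<phi> g \<otimes>\<^bsub>BijGroup E\<^esub> \<phi> h) f"
        using that \<phi>_mult[OF that] bij by (cases "f \<in> E") (simp_all add: BijGroup_def compose_def \<phi>_def)
    qed
  qed
  then interpret group_action K E \<phi>
    by (simp add: group_action_def group_hom_def group_hom_axioms_def K group_BijGroup)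
  obtain z where z: "z \<in> carrier K" "z \<noteq> \<one>\<^bsub>K\<^esub>"
  proof -
    have "card (carrier K) \<noteq> 1" using card_K one_less_power[OF prime_gt_1_nat[OF p] k] by linarith
    then show ?thesis
      using that K.one_closed by (metis card_1_singleton_iff One_nat_def insertI1 insert_absorb is_singletonI' is_singleton_the_elem emptyE)
  qed
  \<comment> \<open>\<open>B x\<close> is the set of values allowed at \<open>x\<close>, which makes
    \<open>E\<close> a product of finite sets. The factor at some \<open>z\<close> other than 1 has
    p elements; this is where \<open>k > 0\<close> enters.\<close>
  define B where "B x = (if x = \<one>\<^bsub>K\<^esub> then {0} else {0..?q - 1})" for x
  have E_eq: "E = Pi\<^sub>E (carrier K) B"
  proof (intro equalityI subsetI)
    fix f assume f: "f \<in> Pi\<^sub>E (carrier K) B"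
    have fB: "f x \<in> B x" if "x \<in> carrier K" for x by (rule PiE_mem[OF f that])
    have "f x \<in> {0..?q - 1}" if "x \<in> carrier K" for x
      using fB[OF that] q by (simp add: B_def split: if_splits)
    moreover have "f \<one>\<^bsub>K\<^esub> = 0" using fB[of "\<one>\<^bsub>K\<^esub>"] by (simp add: B_def)
    moreover have "f \<in> extensional (carrier K)" using f by (simp add: PiE_def)
    ultimately show "f \<in> E" unfolding E_def PiE_iff by blast
  qed (auto simp: E_def B_def PiE_iff)
  have finE: "finite E"
    unfolding E_eq by (rule finite_PiE[OF finK]) (simp add: B_def)
  have "card E = (\<Prod>x\<in>carrier K. card (B x))"
    unfolding E_eq by (rule card_PiE[OF finK])
  moreover have "p dvd card (B z)" using z by (simp add: B_def)
  ultimately have dvd: "p dvd card E"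
    using dvd_trans[OF _ dvd_prodI[OF finK z(1)]] by metis
  \<comment> \<open>The zero function is the fixed point known in advance; a second one is a nonzero
    homomorphism.\<close>
  have zero: "(\<lambda>x\<in>carrier K. 0) \<in> E" using q by (auto simp: E_def)
  have fixed: "\<phi> g (\<lambda>x\<in>carrier K. 0) = (\<lambda>x\<in>carrier K. 0)" if "g \<in> carrier K" for g
    using that zero by (auto simp: \<phi>_def)
  obtain h where h: "h \<in> E" "h \<noteq> (\<lambda>x\<in>carrier K. 0)" "\<And>g. g \<in> carrier K \<Longrightarrow> \<phi> g h = h"
    using second_fixed_point[OF p ord finE dvd zero fixed] by blast
  have hx: "h x \<in> {0..?q-1}" if "x \<in> carrier K" for x using h(1) that by (auto simp: E_def)
  have "h (x \<otimes>\<^bsub>K\<^esub> g) = (h x + h g) mod ?q" if "x \<in> carrier K" "g \<in> carrier K" for x g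
  proof -
    have "h x = (h (x \<otimes>\<^bsub>K\<^esub> g) - h g) mod ?q"
      using fun_cong[OF h(3)[OF that(2)], of x] that h(1) by (simp add: \<phi>_def)
    then have "(h x + h g) mod ?q = h (x \<otimes>\<^bsub>K\<^esub> g) mod ?q" by (simp add: mod_add_left_eq)
    then show ?thesis using hx[of "x \<otimes>\<^bsub>K\<^esub> g"] that by simp
  qed
  then have "h \<in> hom K (add_monoid (Fp p))"
    using hx by (intro homI) simp_all
  moreover obtain x where "x \<in> carrier K" "h x \<noteq> 0"
  proof -
    have "h \<in> extensional (carrier K)" using h(1) by (simp add: E_def PiE_def)
    then show ?thesis using h(2) that by (metis (no_types, lifting) extensionalityI restrict_apply restrict_extensional)
  qed
  ultimately show ?thesis by (rule that)
qed

text \<open>In a compact Hausdorff space quasi-components and components coincide, and here the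
  component of \<open>x\<close> is a single point. So some clopen set tells \<open>x\<close> and
  \<open>y\<close> apart, and it or its complement contains \<open>x\<close>.\<close>

lemma totally_disconnected_separation:
  assumes "compact_space X" "Hausdorff_space X" "totally_disconnected_space X"
    and "x \<in> topspace X" "y \<in> topspace X" "x \<noteq> y"
  obtains U where "openin X U" "closedin X U" "x \<in> U" "y \<notin> U"
proof -
  have "connectedin X (connected_component_of_set X x)" by (rule connectedin_connected_component_of)
  then obtain a where "connected_component_of_set X x \<subseteq> {a}"
    using assms(3) unfolding totally_disconnected_space_def by blast
  moreover have "x \<in> connected_component_of_set X x"
    using assms(4) by (simp add: connected_component_of_refl)
  ultimately have "\<not> connected_component_of X x y" using assms(6) by blast
  then have "\<not> quasi_component_of X x y"
    using quasi_eq_connected_component_of[of X x] assms(1,2) by simp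
  then obtain U where U: "closedin X U" "openin X U" "(x \<in> U) \<noteq> (y \<in> U)"
    using assms(4,5) by (auto simp: quasi_component_of_def)
  show ?thesis
  proof (cases "x \<in> U")
    case True
    then show ?thesis using U that by blast
  next
    case False
    then show ?thesis using U assms(4) that[of "topspace X - U"] by blast
  qed
qed

lemma topological_group_right_translation:
  assumes "topological_group G" "c \<in> carrier G"
  shows "continuous_map (gtop G) (gtop G) (\<lambda>z. z \<otimes>\<^bsub>G\<^esub> c)"
proof -
  have "continuous_map (gtop G) (prod_topology (gtop G) (gtop G)) (\<lambda>z. (z, c))"
    using assms by (simp add: topological_group_def continuous_map_pairedI)
  moreover have "continuous_map (prod_topology (gtop G) (gtop G)) (gtop G) (\<lambda>(x, y). x \<otimes>\<^bsub>G\<^esub> y)"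
    using assms(1) by (simp add: topological_group_def)
  ultimately show ?thesis
    using continuous_map_compose by (fastforce simp: o_def)
qed

text \<open>For a clopen \<open>U\<close>, the \<open>g\<close> with \<open>a g b \<in> U \<longleftrightarrow> a b \<in> U\<close> for all \<open>a\<close> and \<open>b\<close> form a normal
  subgroup, and it is open by the tube lemma.\<close>

lemma profinite_open_normal_subgroup:
  assumes G: "profinite_group G" and x: "x \<in> carrier G" "x \<noteq> \<one>\<^bsub>G\<^esub>"
  obtains N where "N \<lhd> G" "openin (gtop G) N" "x \<notin> N"
proof -
  interpret G: group G using G by (simp add: profinite_group_def topological_group_def)
  have top: "topspace (gtop G) = carrier G"
    and mult: "continuous_map (prod_topology (gtop G) (gtop G)) (gtop G) (\<lambda>(x, y). x \<otimes>\<^bsub>G\<^esub> y)"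
    and comp: "compact_space (gtop G)"
    using G by (simp_all add: profinite_group_def topological_group_def)
  obtain U where U: "openin (gtop G) U" "closedin (gtop G) U" "\<one>\<^bsub>G\<^esub> \<in> U" "x \<notin> U"
    using totally_disconnected_separation[of "gtop G" "\<one>\<^bsub>G\<^esub>" x] G x top
    by (auto simp: profinite_group_def)
  define N where "N = {g \<in> carrier G. \<forall>a\<in>carrier G. \<forall>b\<in>carrier G.
      a \<otimes>\<^bsub>G\<^esub> g \<otimes>\<^bsub>G\<^esub> b \<in> U \<longleftrightarrow> a \<otimes>\<^bsub>G\<^esub> b \<in> U}"
  have N_I: "g \<in> N" if "g \<in> carrier G"
    "\<And>a b. a \<in> carrier G \<Longrightarrow> b \<in> carrier G \<Longrightarrow> a \<otimes>\<^bsub>G\<^esub> g \<otimes>\<^bsub>G\<^esub> b \<in> U \<longleftrightarrow> a \<otimes>\<^bsub>G\<^esub> b \<in> U" for g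
    using that by (simp add: N_def)
  have N_D: "a \<otimes>\<^bsub>G\<^esub> g \<otimes>\<^bsub>G\<^esub> b \<in> U \<longleftrightarrow> a \<otimes>\<^bsub>G\<^esub> b \<in> U" if "g \<in> N" "a \<in> carrier G" "b \<in> carrier G" for a b g
    using that by (simp add: N_def)
  have N_sub: "g \<in> carrier G" if "g \<in> N" for g using that by (simp add: N_def)
  have N_mult: "g \<otimes>\<^bsub>G\<^esub> h \<in> N" if gh: "g \<in> N" "h \<in> N" for g h
  proof (rule N_I)
    have gc: "g \<in> carrier G" and hc: "h \<in> carrier G" using gh N_sub by auto
    then show "g \<otimes>\<^bsub>G\<^esub> h \<in> carrier G" by simp
    fix a b assume ab: "a \<in> carrier G" "b \<in> carrier G"
    have "a \<otimes>\<^bsub>G\<^esub> (g \<otimes>\<^bsub>G\<^esub> h) \<otimes>\<^bsub>G\<^esub> b = a \<otimes>\<^bsub>G\<^esub> g \<otimes>\<^bsub>G\<^esub> (h \<otimes>\<^bsub>G\<^esub> b)"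
      and "a \<otimes>\<^bsub>G\<^esub> (h \<otimes>\<^bsub>G\<^esub> b) = a \<otimes>\<^bsub>G\<^esub> h \<otimes>\<^bsub>G\<^esub> b"
      using ab gc hc by (simp_all add: G.m_assoc)
    then show "a \<otimes>\<^bsub>G\<^esub> (g \<otimes>\<^bsub>G\<^esub> h) \<otimes>\<^bsub>G\<^esub> b \<in> U \<longleftrightarrow> a \<otimes>\<^bsub>G\<^esub> b \<in> U"
      using N_D[OF gh(1) ab(1), of "h \<otimes>\<^bsub>G\<^esub> b"] N_D[OF gh(2) ab] ab hc by simp
  qed
  have N_inv: "inv\<^bsub>G\<^esub> g \<in> N" if g: "g \<in> N" for g
  proof (rule N_I)
    have gc: "g \<in> carrier G" using g N_sub by auto
    then show "inv\<^bsub>G\<^esub> g \<in> carrier G" by simp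
    fix a b assume ab: "a \<in> carrier G" "b \<in> carrier G"
    have "a \<otimes>\<^bsub>G\<^esub> inv\<^bsub>G\<^esub> g \<otimes>\<^bsub>G\<^esub> g \<otimes>\<^bsub>G\<^esub> b = a \<otimes>\<^bsub>G\<^esub> b"
      using ab gc by (simp add: G.m_assoc)
    then show "a \<otimes>\<^bsub>G\<^esub> inv\<^bsub>G\<^esub> g \<otimes>\<^bsub>G\<^esub> b \<in> U \<longleftrightarrow> a \<otimes>\<^bsub>G\<^esub> b \<in> U"
      using N_D[OF g, of "a \<otimes>\<^bsub>G\<^esub> inv\<^bsub>G\<^esub> g" b] ab gc by simp
  qed
  have one_N: "\<one>\<^bsub>G\<^esub> \<in> N" by (rule N_I) simp_all
  have sub: "subgroup N G"
    using N_sub one_N N_inv N_mult by (intro G.subgroupI) auto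
  have normal: "N \<lhd> G"
  proof (rule G.normal_invI[OF sub])
    fix y g assume y: "y \<in> carrier G" and g: "g \<in> N"
    have gc: "g \<in> carrier G" using g N_sub by auto
    show "y \<otimes>\<^bsub>G\<^esub> g \<otimes>\<^bsub>G\<^esub> inv\<^bsub>G\<^esub> y \<in> N"
    proof (rule N_I)
      show "y \<otimes>\<^bsub>G\<^esub> g \<otimes>\<^bsub>G\<^esub> inv\<^bsub>G\<^esub> y \<in> carrier G" using y gc by simp
      fix a b assume ab: "a \<in> carrier G" "b \<in> carrier G"
      have "a \<otimes>\<^bsub>G\<^esub> (y \<otimes>\<^bsub>G\<^esub> g \<otimes>\<^bsub>G\<^esub> inv\<^bsub>G\<^esub> y) \<otimes>\<^bsub>G\<^esub> b = (a \<otimes>\<^bsub>G\<^esub> y) \<otimes>\<^bsub>G\<^esub> g \<otimes>\<^bsub>G\<^esub> (inv\<^bsub>G\<^esub> y \<otimes>\<^bsub>G\<^esub> b)"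
        and "(a \<otimes>\<^bsub>G\<^esub> y) \<otimes>\<^bsub>G\<^esub> (inv\<^bsub>G\<^esub> y \<otimes>\<^bsub>G\<^esub> b) = a \<otimes>\<^bsub>G\<^esub> b"
        using ab y gc G.m_assoc[of y "inv\<^bsub>G\<^esub> y" b, symmetric] by (simp_all add: G.m_assoc)
      then show "a \<otimes>\<^bsub>G\<^esub> (y \<otimes>\<^bsub>G\<^esub> g \<otimes>\<^bsub>G\<^esub> inv\<^bsub>G\<^esub> y) \<otimes>\<^bsub>G\<^esub> b \<in> U \<longleftrightarrow> a \<otimes>\<^bsub>G\<^esub> b \<in> U"
        using N_D[OF g, of "a \<otimes>\<^bsub>G\<^esub> y" "inv\<^bsub>G\<^esub> y \<otimes>\<^bsub>G\<^esub> b"] ab y by simp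
    qed
  qed
  let ?X = "gtop G" and ?D = "discrete_topology (UNIV :: bool set)"
  \<comment> \<open>As \<open>U\<close> is clopen, membership in it is a continuous map to the
    discrete two-point space.\<close>
  have char: "continuous_map ?X ?D (\<lambda>z. z \<in> U)"
    unfolding continuous_map_def
  proof (intro conjI allI impI)
    fix V :: "bool set"
    have "{z \<in> topspace ?X. (z \<in> U) \<in> V} =
        (if True \<in> V then U else {}) \<union> (if False \<in> V then topspace ?X - U else {})"
    proof (intro equalityI subsetI)
      fix z assume "z \<in> {z \<in> topspace ?X. (z \<in> U) \<in> V}"
      then show "z \<in> (if True \<in> V then U else {}) \<union> (if False \<in> V then topspace ?X - U else {})"
        by (cases "z \<in> U") simp_all
    next
      fix z assume "z \<in> (if True \<in> V then U else {}) \<union> (if False \<in> V then topspace ?X - U else {})"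
      then show "z \<in> {z \<in> topspace ?X. (z \<in> U) \<in> V}"
        using openin_subset[OF U(1)] by (cases "z \<in> U") (auto split: if_splits)
    qed
    then show "openin ?X {z \<in> topspace ?X. (z \<in> U) \<in> V}"
      using U(1,2) by (simp add: openin_Un openin_diff)
  qed simp
  have mult': "continuous_map Z ?X (\<lambda>z. f z \<otimes>\<^bsub>G\<^esub> g z)"
    if "continuous_map Z ?X f" "continuous_map Z ?X g" for Z :: "('a \<times> 'a \<times> 'a) topology" and f g
    using continuous_map_compose[OF continuous_map_pairedI[OF that] mult] by (simp add: o_def)
  let ?Z = "prod_topology ?X (prod_topology ?X ?X)"
  have 1: "continuous_map ?Z ?X fst" "continuous_map ?Z ?X (\<lambda>z. fst (snd z))" "continuous_map ?Z ?X (\<lambda>z. snd (snd z))"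
    by (auto intro: continuous_map_fst continuous_map_snd
       continuous_map_compose[OF continuous_map_snd continuous_map_fst, unfolded o_def]
       continuous_map_compose[OF continuous_map_snd continuous_map_snd, unfolded o_def])
  have c1: "continuous_map ?Z ?D (\<lambda>z. fst (snd z) \<otimes>\<^bsub>G\<^esub> fst z \<otimes>\<^bsub>G\<^esub> snd (snd z) \<in> U)"
    using continuous_map_compose[OF mult'[OF mult'[OF 1(2) 1(1)] 1(3)] char] by (simp add: o_def)
  have c2: "continuous_map ?Z ?D (\<lambda>z. fst (snd z) \<otimes>\<^bsub>G\<^esub> snd (snd z) \<in> U)"
    using continuous_map_compose[OF mult'[OF 1(2) 1(3)] char] by (simp add: o_def)
  have c: "continuous_map ?Z (prod_topology ?D ?D)
      (\<lambda>z. (fst (snd z) \<otimes>\<^bsub>G\<^esub> fst z \<otimes>\<^bsub>G\<^esub> snd (snd z) \<in> U, fst (snd z) \<otimes>\<^bsub>G\<^esub> snd (snd z) \<in> U))"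
    by (rule continuous_map_pairedI[OF c1 c2])
  \<comment> \<open>A point of \<open>?Z\<close> is a triple (g, (a, b)), and \<open>W\<close>
    collects those for which \<open>a g b\<close> and \<open>a b\<close> are both in
    \<open>U\<close> or both outside. It is open and contains every triple with g = 1, so
    compactness in (a, b) gives a neighbourhood \<open>V\<close> of 1 that works for all a and b at
    once.\<close>
  define W where "W = {z \<in> topspace ?Z.
      (fst (snd z) \<otimes>\<^bsub>G\<^esub> fst z \<otimes>\<^bsub>G\<^esub> snd (snd z) \<in> U) = (fst (snd z) \<otimes>\<^bsub>G\<^esub> snd (snd z) \<in> U)}"
  have "openin (prod_topology ?D ?D) {u. fst u = snd u}"
    by (simp flip: prod_topology_discrete_topology)
  from openin_continuous_map_preimage[OF c this] have W: "openin ?Z W"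
    by (simp add: W_def)
  have "compactin (prod_topology ?X ?X) (carrier G \<times> carrier G)"
    using comp by (simp add: compactin_Times top[symmetric] compact_space_def[symmetric])
  moreover have "{\<one>\<^bsub>G\<^esub>} \<times> (carrier G \<times> carrier G) \<subseteq> W"
    by (auto simp: W_def top)
  ultimately obtain V V' where V: "openin ?X V" "\<one>\<^bsub>G\<^esub> \<in> V" "carrier G \<times> carrier G \<subseteq> V'" "V \<times> V' \<subseteq> W"
    using tube_lemma_right[OF W, of "carrier G \<times> carrier G" "\<one>\<^bsub>G\<^esub>"] top by auto
  have VN: "V \<subseteq> N"
  proof
    fix g assume g: "g \<in> V"
    have "g \<in> carrier G" using g openin_subset[OF V(1)] top by auto
    then show "g \<in> N"
      using V(3,4) g by (intro N_I) (force simp: W_def)+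
  qed
  \<comment> \<open>A subgroup that contains a neighbourhood \<open>V\<close> of 1 contains the
    translate of \<open>V\<close> by each of its elements.\<close>
  have "openin ?X N"
  proof (subst openin_subopen, intro ballI)
    fix n assume n: "n \<in> N"
    have nc: "n \<in> carrier G" by (rule N_sub[OF n])
    let ?V = "{z \<in> topspace ?X. z \<otimes>\<^bsub>G\<^esub> inv\<^bsub>G\<^esub> n \<in> V}"
    have "continuous_map ?X ?X (\<lambda>z. z \<otimes>\<^bsub>G\<^esub> inv\<^bsub>G\<^esub> n)"
      using G nc by (intro topological_group_right_translation) (simp_all add: profinite_group_def)
    then have "openin ?X ?V" by (rule openin_continuous_map_preimage[OF _ V(1)])
    moreover have "n \<in> ?V" using nc V(2) top by simp
    moreover have "?V \<subseteq> N"
    proof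
      fix z assume z: "z \<in> ?V"
      then have "z \<otimes>\<^bsub>G\<^esub> inv\<^bsub>G\<^esub> n \<in> N" "z \<in> carrier G" using VN top by auto
      moreover have "z = z \<otimes>\<^bsub>G\<^esub> inv\<^bsub>G\<^esub> n \<otimes>\<^bsub>G\<^esub> n" using \<open>z \<in> carrier G\<close> nc by (simp add: G.m_assoc)
      ultimately show "z \<in> N" using N_mult n by metis
    qed
    ultimately show "\<exists>T. openin ?X T \<and> n \<in> T \<and> T \<subseteq> N" by blast
  qed
  moreover have "x \<notin> N"
    using N_D[of x "\<one>\<^bsub>G\<^esub>" "\<one>\<^bsub>G\<^esub>"] U x by auto
  ultimately show ?thesis using normal that by blast
qed

text \<open>A nontrivial element survives in the quotient by some open normal subgroup. That
  quotient is a nontrivial finite p-group and so has a nonzero homomorphism to F_p, which is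
  composed with the projection.\<close>

lemma pro_p_group_nontrivial_character:
  assumes p: "prime p" and G: "pro_p_group p G" and nt: "carrier G \<noteq> {\<one>\<^bsub>G\<^esub>}"
  obtains \<eta> x where "continuous_hom_to_finite G (add_monoid (Fp p)) \<eta>" "x \<in> carrier G" "\<eta> x \<noteq> 0"
proof -
  have prof: "profinite_group G" using G by (simp add: pro_p_group_def)
  interpret G: group G using prof by (simp add: profinite_group_def topological_group_def)
  have top: "topspace (gtop G) = carrier G"
    using prof by (simp add: profinite_group_def topological_group_def)
  obtain x where x: "x \<in> carrier G" "x \<noteq> \<one>\<^bsub>G\<^esub>" using nt G.one_closed by blast
  obtain N where N: "N \<lhd> G" "openin (gtop G) N" "x \<notin> N"
    using profinite_open_normal_subgroup[OF prof x] .
  interpret N: normal N G by (rule N(1))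
  obtain k where k: "order (G Mod N) = p ^ k" using G N by (auto simp: pro_p_group_def)
  have rcos: "N #>\<^bsub>G\<^esub> y \<in> carrier (G Mod N)" if "y \<in> carrier G" for y
    using that by (auto simp: carrier_FactGroup)
  have "k > 0"
  proof (rule ccontr)
    assume "\<not> k > 0"
    then have "card (carrier (G Mod N)) = 1" using k by (simp add: order_def)
    then have "N #>\<^bsub>G\<^esub> x = N #>\<^bsub>G\<^esub> \<one>\<^bsub>G\<^esub>"
      using rcos[OF x(1)] rcos[OF G.one_closed] by (metis card_1_singletonE singletonD)
    then have "x \<in> N"
      using G.rcos_self[OF x(1) N.subgroup_axioms] G.coset_mult_one[OF N.subset] by simp
    then show False using N(3) by simp
  qed
  then obtain h y where h: "h \<in> hom (G Mod N) (add_monoid (Fp p))" "y \<in> carrier (G Mod N)" "h y \<noteq> 0"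
    using p_group_nontrivial_hom[OF p N.factorgroup_is_group k] by blast
  let ?\<eta> = "\<lambda>x. h (N #>\<^bsub>G\<^esub> x)"
  have "?\<eta> \<in> hom G (add_monoid (Fp p))"
    using hom_compose[OF N.r_coset_hom_Mod h(1)] by (simp add: o_def)
  moreover have "continuous_map (gtop G) (discrete_topology (carrier (add_monoid (Fp p)))) ?\<eta>"
  proof -
    \<comment> \<open>The value depends only on the coset of the open subgroup \<open>N\<close>, so
      with \<open>z\<close> a preimage contains the open coset \<open>?T\<close>.\<close>
    have "openin (gtop G) {z \<in> topspace (gtop G). ?\<eta> z \<in> V}" for V
    proof (subst openin_subopen, intro ballI)
      fix z assume z: "z \<in> {z \<in> topspace (gtop G). ?\<eta> z \<in> V}"
      then have zc: "z \<in> carrier G" using top by simp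
      show "\<exists>T. openin (gtop G) T \<and> z \<in> T \<and> T \<subseteq> {z \<in> topspace (gtop G). ?\<eta> z \<in> V}"
      proof (intro exI conjI subsetI)
        let ?T = "{w \<in> topspace (gtop G). w \<otimes>\<^bsub>G\<^esub> inv\<^bsub>G\<^esub> z \<in> N}"
        show "openin (gtop G) ?T"
          using prof zc N(2) by (intro openin_continuous_map_preimage[OF topological_group_right_translation])
            (simp_all add: profinite_group_def)
        show "z \<in> ?T" using zc top by simp
        fix w assume w: "w \<in> ?T"
        then have "w \<in> N #>\<^bsub>G\<^esub> z"
          using N.rcos_module_rev[OF G.group_axioms zc] top by simp
        then have "N #>\<^bsub>G\<^esub> w = N #>\<^bsub>G\<^esub> z"
          using G.repr_independence[OF _ zc N.subgroup_axioms] by simp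
        then show "w \<in> {z \<in> topspace (gtop G). ?\<eta> z \<in> V}" using w z by simp
      qed
    qed
    moreover have "?\<eta> z \<in> carrier (add_monoid (Fp p))" if "z \<in> topspace (gtop G)" for z
      using rcos[of z] that h(1) top by (metis hom_in_carrier)
    ultimately show ?thesis unfolding continuous_map_def by auto
  qed
  ultimately have "continuous_hom_to_finite G (add_monoid (Fp p)) ?\<eta>"
    by (simp only: continuous_hom_to_finite_def)
  moreover obtain z where "z \<in> carrier G" "y = N #>\<^bsub>G\<^esub> z"
    using h(2) by (auto simp: carrier_FactGroup)
  ultimately show ?thesis using h(3) that by blast
qed

section \<open>Cohomology in degrees 1 and 2\<close>

declare One_nat_def [simp del]

abbreviation character :: "nat \<Rightarrow> ('a, 'm) topgroup_scheme \<Rightarrow> ('a \<Rightarrow> int) \<Rightarrow> bool" where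
  "character p G \<equiv> continuous_hom_to_finite G (add_monoid (Fp p))"

text \<open>Passes from functions on the group to functions of tuples with one entry. The
  restriction turns agreement on the carrier into equality of cochains.\<close>

definition cochain1 :: "('a, 'm) topgroup_scheme \<Rightarrow> ('a \<Rightarrow> int) \<Rightarrow> (nat \<Rightarrow> 'a) \<Rightarrow> int" where
  "cochain1 G c = (\<lambda>x\<in>tuples 1 G. c (x 0))"

definition cup_trivial :: "nat \<Rightarrow> ('a, 'm) topgroup_scheme \<Rightarrow> ('a \<Rightarrow> int) \<Rightarrow> ('a \<Rightarrow> int) \<Rightarrow> bool" where
  "cup_trivial p G \<alpha> \<beta> \<longleftrightarrow>
     (\<exists>c. continuous_map (gtop G) (discrete_topology {0..int p - 1}) c \<and>
        (\<forall>x\<in>carrier G. \<forall>y\<in>carrier G.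
           (c x + c y - c (x \<otimes>\<^bsub>G\<^esub> y)) mod int p = (\<alpha> x * \<beta> y) mod int p))"

lemma Fp_cring: "p > 1 \<Longrightarrow> cring (Fp p)"
  unfolding Fp_def by (intro residues.cring) (simp add: residues_def)

lemma neg_Fp: "p > 1 \<Longrightarrow> \<ominus>\<^bsub>Fp p\<^esub> x = (- x) mod int p"
  unfolding Fp_def by (intro residues.res_neg_eq) (simp add: residues_def)

lemma characterI:
  assumes \<eta>: "continuous_map (gtop G) (discrete_topology {0..int p - 1}) \<eta>"
    and top: "topspace (gtop G) = carrier G"
    and mult: "\<And>x y. x \<in> carrier G \<Longrightarrow> y \<in> carrier G \<Longrightarrow> \<eta> (x \<otimes>\<^bsub>G\<^esub> y) = (\<eta> x + \<eta> y) mod int p"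
  shows "character p G \<eta>"
proof -
  have "\<eta> \<in> carrier G \<rightarrow> {0..int p - 1}"
    using continuous_map_funspace[OF \<eta>] by (simp only: top topspace_discrete_topology)
  then have "\<eta> \<in> hom G (add_monoid (Fp p))"
    using mult by (intro homI) (simp_all add: Pi_iff)
  then show ?thesis
    using \<eta> by (simp add: continuous_hom_to_finite_def)
qed

lemma characterD:
  assumes "character p G \<eta>"
  shows "continuous_map (gtop G) (discrete_topology {0..int p - 1}) \<eta>"
    and "\<And>x. x \<in> carrier G \<Longrightarrow> \<eta> x \<in> {0..int p - 1}"
    and "\<And>x y. x \<in> carrier G \<Longrightarrow> y \<in> carrier G \<Longrightarrow> \<eta> (x \<otimes>\<^bsub>G\<^esub> y) = (\<eta> x + \<eta> y) mod int p"
proof -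
  show "continuous_map (gtop G) (discrete_topology {0..int p - 1}) \<eta>"
    using assms by (simp add: continuous_hom_to_finite_def)
  have hom: "\<eta> \<in> hom G (add_monoid (Fp p))"
    using assms by (simp only: continuous_hom_to_finite_def)
  show "\<eta> x \<in> {0..int p - 1}" if "x \<in> carrier G" for x
    using hom_in_carrier[OF hom that] by simp
  show "\<eta> (x \<otimes>\<^bsub>G\<^esub> y) = (\<eta> x + \<eta> y) mod int p" if "x \<in> carrier G" "y \<in> carrier G" for x y
    using hom_mult[OF hom that] by simp
qed

lemma continuous_map_discrete2:
  assumes "continuous_map X (discrete_topology A) f" "continuous_map X (discrete_topology B) g"
    and "\<And>a b. a \<in> A \<Longrightarrow> b \<in> B \<Longrightarrow> h a b \<in> C"
  shows "continuous_map X (discrete_topology C) (\<lambda>x. h (f x) (g x))"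
proof -
  have 1: "continuous_map X (discrete_topology (A \<times> B)) (\<lambda>x. (f x, g x))"
    using continuous_map_pairedI[OF assms(1,2)] by (simp add: prod_topology_discrete_topology)
  have 2: "continuous_map (discrete_topology (A \<times> B)) (discrete_topology C) (\<lambda>z. h (fst z) (snd z))"
    using assms(3) by auto
  show ?thesis
    using continuous_map_compose[OF 1 2] by (simp add: o_def)
qed

lemma mod_add_diff_eq: "(x mod q + y mod q - z mod q) mod q = (x + y - z) mod q" for x y z q :: int
proof -
  have "x mod q + y mod q - z mod q - (x + y - z) = q * (z div q - x div q - y div q)"
    by (simp add: minus_mult_div_eq_mod [symmetric] algebra_simps)
  then show ?thesis by (simp add: mod_eq_dvd_iff)
qed

text \<open>These assumptions pass to \<open>quotient_group G N\<close> directly from its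
  definition, so the fundamental group and the vertex groups can be treated alike.\<close>

locale cohomology_context = group G for G (structure) and p :: nat +
  constrains G :: "('a, 'm) topgroup_scheme"
  assumes topspace_G: "topspace (gtop G) = carrier G" and p_gt_1: "p > 1"
begin

abbreviation cont :: "('a \<Rightarrow> int) \<Rightarrow> bool" where
  "cont \<equiv> continuous_map (gtop G) (discrete_topology {0..int p - 1})"

lemma cont_range: "cont c \<Longrightarrow> x \<in> carrier G \<Longrightarrow> c x \<in> {0..int p - 1}"
  using continuous_map_funspace[of "gtop G" "discrete_topology {0..int p - 1}" c]
  unfolding topspace_G topspace_discrete_topology by (rule funcset_mem)

lemma cont_range_mod: "cont c \<Longrightarrow> x \<in> carrier G \<Longrightarrow> c x mod int p = c x"
  using cont_range[of c x] by (simp only: atLeastAtMost_iff mod_pos_pos_trivial zle_diff1_eq simp_thms)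

lemma tuples1_entry: "x \<in> tuples 1 G \<Longrightarrow> x 0 \<in> carrier G"
  by (auto simp: tuples_def)

lemma tuples1_I: "a \<in> carrier G \<Longrightarrow> (\<lambda>i\<in>{..<1}. a) \<in> tuples 1 G"
  by (auto simp: tuples_def)

lemma tuples1_eta: "x \<in> tuples 1 G \<Longrightarrow> (\<lambda>i\<in>{..<1}. x 0) = x"
  by (auto simp: tuples_def fun_eq_iff restrict_def PiE_def extensional_def)

lemma cochain1_apply: "a \<in> carrier G \<Longrightarrow> cochain1 G c (\<lambda>i\<in>{..<1}. a) = c a"
  using tuples1_I[of a] by (simp add: cochain1_def)

lemma cochain1_eq_iff: "cochain1 G c = cochain1 G d \<longleftrightarrow> (\<forall>x\<in>carrier G. c x = d x)"
proof
  assume *: "cochain1 G c = cochain1 G d"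
  show "\<forall>x\<in>carrier G. c x = d x"
    using cochain1_apply[of _ c] cochain1_apply[of _ d] unfolding * by simp
next
  assume "\<forall>x\<in>carrier G. c x = d x"
  then show "cochain1 G c = cochain1 G d"
    unfolding cochain1_def using tuples1_entry by (auto intro: restrict_ext)
qed

lemma carrier_cochains1: "carrier (cochains p 1 G) = cochain1 G ` Collect cont"
proof (intro equalityI subsetI)
  fix f assume "f \<in> carrier (cochains p 1 G)"
  then have f: "f \<in> extensional (tuples 1 G)"
    "continuous_map (product_topology (\<lambda>_. gtop G) {..<1}) (discrete_topology {0..int p - 1}) f"
    by (simp_all add: cochains_def)
  let ?c = "\<lambda>a. f (\<lambda>i\<in>{..<1}. a)"
  have "continuous_map (gtop G) (product_topology (\<lambda>_. gtop G) {..<1::nat}) (\<lambda>a. \<lambda>i\<in>{..<1}. a)"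
    by (auto simp: continuous_map_componentwise)
  then have "cont ?c"
    using continuous_map_compose[OF _ f(2)] by (auto simp: o_def)
  moreover have "f = cochain1 G ?c"
    using f(1) tuples1_eta by (auto simp: cochain1_def fun_eq_iff extensional_def restrict_def)
  ultimately show "f \<in> cochain1 G ` Collect cont" by blast
next
  fix f assume "f \<in> cochain1 G ` Collect cont"
  then obtain c where c: "cont c" "f = cochain1 G c" by blast
  have "continuous_map (product_topology (\<lambda>_. gtop G) {..<1::nat}) (gtop G) (\<lambda>x. x 0)"
    by (intro continuous_map_product_projection) simp
  then have "continuous_map (product_topology (\<lambda>_. gtop G) {..<1::nat}) (discrete_topology {0..int p - 1}) (\<lambda>x. c (x 0))"
    using continuous_map_compose[OF _ c(1)] by (fastforce simp: o_def)
  then have "continuous_map (product_topology (\<lambda>_. gtop G) {..<1::nat}) (discrete_topology {0..int p - 1}) f"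
    by (rule continuous_map_eq) (simp add: c(2) cochain1_def tuples_def topspace_G)
  moreover have "f \<in> extensional (tuples 1 G)" by (simp add: c(2) cochain1_def)
  ultimately show "f \<in> carrier (cochains p 1 G)" by (simp add: cochains_def)
qed

text \<open>A 0-cochain has one value c, and with trivial action its coboundary is c - c. Hence
  cosets of the 1-coboundaries are singletons.\<close>

lemma coboundaries1: "coboundaries p 1 G = {cochain1 G (\<lambda>_. 0)}"
proof -
  interpret F: cring "Fp p" by (rule Fp_cring[OF p_gt_1])
  have tup0: "(\<lambda>i\<in>{..<0::nat}. y i) = (\<lambda>_. undefined)" for y :: "nat \<Rightarrow> 'a"
    by (simp add: restrict_def)
  have cob: "coboundary p 0 G f = cochain1 G (\<lambda>_. 0)" if f: "f \<in> carrier (cochains p 0 G)" for f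
  proof -
    have "f (\<lambda>_. undefined) \<in> {0..int p - 1}"
      using f by (auto simp: cochains_def continuous_map_def)
    then have "f (\<lambda>_. undefined) \<oplus>\<^bsub>Fp p\<^esub> (\<ominus>\<^bsub>Fp p\<^esub> f (\<lambda>_. undefined)) = 0"
      using F.r_neg by simp
    then show ?thesis
      using neg_Fp[OF p_gt_1]
      by (simp add: coboundary_def cochain1_def signed_def tup0 restrict_def mod_simps One_nat_def)
  qed
  have "(\<lambda>x\<in>tuples 0 G. 0) \<in> carrier (cochains p 0 G)"
    using p_gt_1 by (auto simp: cochains_def tuples_def intro: continuous_map_eq[of _ _ "\<lambda>_. 0"])
  then have "coboundary p 0 G ` carrier (cochains p 0 G) = {cochain1 G (\<lambda>_. 0)}"
    using cob by force
  then show ?thesis by (simp add: coboundaries_def One_nat_def)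
qed

lemma tuples2_entry: "x \<in> tuples (Suc 1) G \<Longrightarrow> x 0 \<in> carrier G \<and> x 1 \<in> carrier G"
  by (auto simp: tuples_def PiE_iff)

lemma tuples2_I: "a \<in> carrier G \<Longrightarrow> b \<in> carrier G \<Longrightarrow>
    (\<lambda>i\<in>{..<Suc 1}. if i = 0 then a else b) \<in> tuples (Suc 1) G"
  by (auto simp: tuples_def)

lemma coboundary1:
  assumes c: "cont c"
  shows "coboundary p 1 G (cochain1 G c) =
    (\<lambda>x\<in>tuples (Suc 1) G. (c (x 0) + c (x 1) - c (x 0 \<otimes> x 1)) mod int p)"
  unfolding coboundary_def
proof (rule restrict_ext)
  interpret F: cring "Fp p" by (rule Fp_cring[OF p_gt_1])
  fix x assume "x \<in> tuples (Suc 1) G"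
  then have x: "x 0 \<in> carrier G" "x 1 \<in> carrier G" using tuples2_entry by auto
  have e1: "cochain1 G c (\<lambda>i\<in>{..<1}. x (Suc i)) = c (x 1)"
    and e2: "cochain1 G c (\<lambda>i\<in>{..<1}. x i) = c (x 0)"
    and e3: "cochain1 G c (\<lambda>i\<in>{..<1}. if i < 0 then x i else if i = 0 then x 0 \<otimes> x (Suc 0) else x (Suc i)) = c (x 0 \<otimes> x 1)"
    using cochain1_apply[of "x 1" c] cochain1_apply[of "x 0" c] cochain1_apply[of "x 0 \<otimes> x 1" c] x
    by (auto simp: One_nat_def cong: restrict_cong)
  have "(\<Oplus>\<^bsub>Fp p\<^esub>j\<in>{..<1}. signed p (Suc j)
         (cochain1 G c (\<lambda>i\<in>{..<1}. if i < j then x i else if i = j then x j \<otimes> x (Suc j) else x (Suc i))))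
      = \<ominus>\<^bsub>Fp p\<^esub> c (x 0 \<otimes> x 1)"
    using e3 cont_range[OF c, of "x 0 \<otimes> x 1"] x p_gt_1
    by (simp add: lessThan_Suc F.finsum_insert signed_def neg_Fp One_nat_def)
  then show "cochain1 G c (\<lambda>i\<in>{..<1}. x (Suc i)) \<oplus>\<^bsub>Fp p\<^esub>
       (\<Oplus>\<^bsub>Fp p\<^esub>j\<in>{..<1}. signed p (Suc j)
         (cochain1 G c (\<lambda>i\<in>{..<1}. if i < j then x i else if i = j then x j \<otimes> x (Suc j) else x (Suc i)))) \<oplus>\<^bsub>Fp p\<^esub>
       signed p (Suc 1) (cochain1 G c (\<lambda>i\<in>{..<1}. x i)) =
     (c (x 0) + c (x 1) - c (x 0 \<otimes> x 1)) mod int p"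
    unfolding e1 e2 by (simp add: signed_def neg_Fp[OF p_gt_1] mod_simps algebra_simps One_nat_def)
qed


lemma restrict_tuples2_eq_iff:
  "(\<lambda>x\<in>tuples (Suc 1) G. f (x 0) (x 1)) = (\<lambda>x\<in>tuples (Suc 1) G. g (x 0) (x 1)) \<longleftrightarrow>
    (\<forall>x\<in>carrier G. \<forall>y\<in>carrier G. f x y = g x y)"
proof
  assume eq: "(\<lambda>x\<in>tuples (Suc 1) G. f (x 0) (x 1)) = (\<lambda>x\<in>tuples (Suc 1) G. g (x 0) (x 1))"
  show "\<forall>x\<in>carrier G. \<forall>y\<in>carrier G. f x y = g x y"
  proof (intro ballI)
    fix a b assume ab: "a \<in> carrier G" "b \<in> carrier G"
    show "f a b = g a b"
      using fun_cong[OF eq, of "\<lambda>i\<in>{..<Suc 1}. if i = 0 then a else b"] tuples2_I[OF ab] by simp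
  qed
next
  assume "\<forall>x\<in>carrier G. \<forall>y\<in>carrier G. f x y = g x y"
  then show "(\<lambda>x\<in>tuples (Suc 1) G. f (x 0) (x 1)) = (\<lambda>x\<in>tuples (Suc 1) G. g (x 0) (x 1))"
    using tuples2_entry by (intro restrict_ext) blast
qed

lemma cocycles1: "cocycles p 1 G = cochain1 G ` Collect (character p G)"
proof -
  have "coboundary p 1 G (cochain1 G c) = \<one>\<^bsub>cochains p (Suc 1) G\<^esub> \<longleftrightarrow> character p G c"
    if c: "cont c" for c
  proof -
    have "coboundary p 1 G (cochain1 G c) = \<one>\<^bsub>cochains p (Suc 1) G\<^esub> \<longleftrightarrow>
        (\<forall>x\<in>carrier G. \<forall>y\<in>carrier G. (c x + c y - c (x \<otimes> y)) mod int p = 0)"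
      unfolding coboundary1[OF c]
      using restrict_tuples2_eq_iff[of "\<lambda>x y. (c x + c y - c (x \<otimes> y)) mod int p" "\<lambda>x y. 0"]
      by (simp add: cochains_def)
    also have "\<dots> \<longleftrightarrow> (\<forall>x\<in>carrier G. \<forall>y\<in>carrier G. c (x \<otimes> y) = (c x + c y) mod int p)"
    proof (intro ball_cong refl)
      fix x y assume "x \<in> carrier G" "y \<in> carrier G"
      then have "c (x \<otimes> y) mod int p = c (x \<otimes> y)" by (intro cont_range_mod[OF c]) simp
      then show "(c x + c y - c (x \<otimes> y)) mod int p = 0 \<longleftrightarrow> c (x \<otimes> y) = (c x + c y) mod int p"
        by (metis mod_eq_dvd_iff mod_0_imp_dvd dvd_imp_mod_0)
    qed
    also have "\<dots> \<longleftrightarrow> character p G c"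
      using characterI[OF c topspace_G] characterD(3)[where G = G and \<eta> = c] by blast
    finally show ?thesis .
  qed
  then show ?thesis
    unfolding cocycles_def kernel_def carrier_cochains1 using characterD(1)[where G = G and p = p] by auto
qed

lemma zero_add_cochain1:
  assumes "cont c"
  shows "coboundaries p 1 G #>\<^bsub>cochains p 1 G\<^esub> cochain1 G c = {cochain1 G c}"
proof -
  have "cochain1 G (\<lambda>_. 0) \<otimes>\<^bsub>cochains p 1 G\<^esub> cochain1 G c = cochain1 G c"
    using cont_range_mod[OF assms] tuples1_entry
    by (auto simp: cochains_def cochain1_def fun_eq_iff)
  then show ?thesis by (simp add: r_coset_def coboundaries1)
qed

lemma carrier_cohomology1:
  "carrier (cohomology p 1 G) = (\<lambda>\<eta>. {cochain1 G \<eta>}) ` Collect (character p G)"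
proof -
  have "coboundaries p 1 G #>\<^bsub>cochains p 1 G\<lparr>carrier := cocycles p 1 G\<rparr>\<^esub> cochain1 G \<eta> = {cochain1 G \<eta>}"
    if "character p G \<eta>" for \<eta>
    using zero_add_cochain1[OF characterD(1)[OF that]] by (simp add: r_coset_def)
  then show ?thesis
    by (auto simp: cohomology_def FactGroup_def RCOSETS_def cocycles1)
qed

lemma one_cohomology1: "\<one>\<^bsub>cohomology p 1 G\<^esub> = {cochain1 G (\<lambda>_. 0)}"
  by (simp add: cohomology_def coboundaries1)

lemma zero_character: "character p G (\<lambda>_. 0)"
  using p_gt_1 topspace_G by (intro characterI) auto

text \<open>Both factors have one representative, so their product is one coset of the
  2-coboundaries, namely that of the cochain \<open>u\<close>. It is the trivial coset exactly if
  \<open>u\<close> is itself a coboundary.\<close>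

lemma cup_eq_one_iff:
  assumes \<alpha>: "character p G \<alpha>" and \<beta>: "character p G \<beta>"
  shows "cup p 1 1 G {cochain1 G \<alpha>} {cochain1 G \<beta>} = \<one>\<^bsub>cohomology p 2 G\<^esub> \<longleftrightarrow> cup_trivial p G \<alpha> \<beta>"
proof -
  define b where "b c = (\<lambda>x\<in>tuples (Suc 1) G. (c (x 0) + c (x 1) - c (x 0 \<otimes> x 1)) mod int p)" for c
  define u where "u = (\<lambda>x\<in>tuples (Suc 1) G. (\<alpha> (x 0) * \<beta> (x 1)) mod int p)"
  have cup: "cup_cochain p 1 1 G (cochain1 G \<alpha>) (cochain1 G \<beta>) = u"
    unfolding cup_cochain_def u_def
  proof (simp only: plus_1_eq_Suc, rule restrict_ext)
    fix x assume "x \<in> tuples (Suc 1) G"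
    then show "cochain1 G \<alpha> (\<lambda>i\<in>{..<1}. x i) \<otimes>\<^bsub>Fp p\<^esub> cochain1 G \<beta> (\<lambda>i\<in>{..<1}. x (Suc i)) = \<alpha> (x 0) * \<beta> (x 1) mod int p"
      using tuples2_entry[of x] cochain1_apply[of "x 0" \<alpha>] cochain1_apply[of "x 1" \<beta>]
      by (simp add: One_nat_def cong: restrict_cong)
  qed
  have "coboundaries p 2 G = coboundary p 1 G ` carrier (cochains p 1 G)"
    by (simp add: coboundaries_def numeral_2_eq_2 One_nat_def)
  also have "\<dots> = b ` Collect cont"
    unfolding carrier_cochains1 image_image
    by (intro image_cong refl) (simp only: mem_Collect_eq coboundary1 b_def)
  finally have B: "coboundaries p 2 G = b ` Collect cont" .
  have mult: "f \<otimes>\<^bsub>cochains p 2 G\<^esub> g = (\<lambda>x\<in>tuples (Suc 1) G. (f x + g x) mod int p)" for f g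
    by (simp add: cochains_def numeral_2_eq_2 One_nat_def)
  have "cup p 1 1 G {cochain1 G \<alpha>} {cochain1 G \<beta>} = (\<lambda>f. f \<otimes>\<^bsub>cochains p 2 G\<^esub> u) ` (b ` Collect cont)"
    unfolding B[symmetric] by (auto simp: cup_def cup r_coset_def)
  moreover have "\<one>\<^bsub>cohomology p 2 G\<^esub> = b ` Collect cont"
    by (simp add: cohomology_def B)
  moreover have "(\<lambda>f. f \<otimes>\<^bsub>cochains p 2 G\<^esub> u) ` (b ` Collect cont) = b ` Collect cont \<longleftrightarrow> u \<in> b ` Collect cont"
  proof
    assume *: "(\<lambda>f. f \<otimes>\<^bsub>cochains p 2 G\<^esub> u) ` (b ` Collect cont) = b ` Collect cont"
    \<comment> \<open>\<open>b\<close> of the zero function is the zero cochain, so the coset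
      contains \<open>u\<close> itself.\<close>
    have "cont (\<lambda>_. 0)" using p_gt_1 by auto
    then have "b (\<lambda>_. 0) \<otimes>\<^bsub>cochains p 2 G\<^esub> u \<in> b ` Collect cont" using * by blast
    moreover have "b (\<lambda>_. 0) \<otimes>\<^bsub>cochains p 2 G\<^esub> u = u"
      unfolding mult b_def u_def by (intro restrict_ext) simp
    ultimately show "u \<in> b ` Collect cont" by simp
  next
    assume "u \<in> b ` Collect cont"
    then obtain d where d: "cont d" "u = b d" by blast
    \<comment> \<open>Translation by \<open>u = b d\<close> sends \<open>b c\<close> to
      \<open>b (c + d)\<close>, and subtracting \<open>d\<close> gives a preimage; so it maps the
      coboundaries onto themselves.\<close>
    have add: "b c \<otimes>\<^bsub>cochains p 2 G\<^esub> u = b (\<lambda>x. (c x + d x) mod int p)" for c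
      unfolding mult d(2) b_def
      by (intro restrict_ext) (simp add: mod_add_diff_eq mod_add_eq, simp add: algebra_simps)
    have cont_add: "cont (\<lambda>x. (c x + d x) mod int p)" and cont_diff: "cont (\<lambda>x. (c x - d x) mod int p)"
      if "cont c" for c
      using that d(1) p_gt_1 by (auto intro!: continuous_map_discrete2[where h = "\<lambda>a b. (a + b) mod int p"]
        continuous_map_discrete2[where h = "\<lambda>a b. (a - b) mod int p"])
    show "(\<lambda>f. f \<otimes>\<^bsub>cochains p 2 G\<^esub> u) ` (b ` Collect cont) = b ` Collect cont"
    proof (intro equalityI subsetI)
      fix f assume "f \<in> (\<lambda>f. f \<otimes>\<^bsub>cochains p 2 G\<^esub> u) ` (b ` Collect cont)"
      then show "f \<in> b ` Collect cont" using add cont_add by auto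
    next
      fix f assume "f \<in> b ` Collect cont"
      then obtain c where c: "cont c" "f = b c" by blast
      have "b (\<lambda>x. (c x - d x) mod int p) \<otimes>\<^bsub>cochains p 2 G\<^esub> u = f"
        unfolding mult d(2) c(2) b_def
        by (intro restrict_ext) (simp add: mod_add_diff_eq mod_add_eq, simp add: algebra_simps)
      then show "f \<in> (\<lambda>f. f \<otimes>\<^bsub>cochains p 2 G\<^esub> u) ` (b ` Collect cont)"
        using cont_diff[OF c(1)] by force
    qed
  qed
  moreover have "u \<in> b ` Collect cont \<longleftrightarrow> cup_trivial p G \<alpha> \<beta>"
  proof -
    have "u = b c \<longleftrightarrow> (\<forall>x\<in>carrier G. \<forall>y\<in>carrier G. (\<alpha> x * \<beta> y) mod int p = (c x + c y - c (x \<otimes> y)) mod int p)" for c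
      unfolding u_def b_def
      by (rule restrict_tuples2_eq_iff[of "\<lambda>x y. (\<alpha> x * \<beta> y) mod int p" "\<lambda>x y. (c x + c y - c (x \<otimes> y)) mod int p"])
    then show ?thesis
      unfolding cup_trivial_def by (simp add: image_iff Bex_def eq_commute[of "(\<alpha> x * \<beta> y) mod int p" for x y])
  qed
  ultimately show ?thesis by simp
qed

text \<open>The zero class always lies in the radical, so triviality is a pure vanishing statement.
  In this form both hypothesis (1) and the conclusion become statements about characters.\<close>

lemma cup_radical_trivial_iff:
  "cup_radical p G = {\<one>\<^bsub>cohomology p 1 G\<^esub>} \<longleftrightarrow>
    (\<forall>\<alpha>. character p G \<alpha> \<and> (\<forall>\<beta>. character p G \<beta> \<longrightarrow> cup_trivial p G \<alpha> \<beta>) \<longrightarrow> (\<forall>x\<in>carrier G. \<alpha> x = 0))"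
proof -
  have mem: "{cochain1 G \<alpha>} \<in> cup_radical p G \<longleftrightarrow> (\<forall>\<beta>. character p G \<beta> \<longrightarrow> cup_trivial p G \<alpha> \<beta>)"
    if "character p G \<alpha>" for \<alpha>
    using that cup_eq_one_iff[OF that] unfolding cup_radical_def carrier_cohomology1 by auto
  have sub: "cup_radical p G \<subseteq> (\<lambda>\<eta>. {cochain1 G \<eta>}) ` Collect (character p G)"
    unfolding cup_radical_def carrier_cohomology1 by blast
  have "cup_trivial p G (\<lambda>_. 0) \<beta>" for \<beta>
    unfolding cup_trivial_def using p_gt_1 by (intro exI[of _ "\<lambda>_. 0"]) auto
  then have zero: "{cochain1 G (\<lambda>_. 0)} \<in> cup_radical p G"
    using mem[OF zero_character] by blast
  have eq0: "{cochain1 G \<alpha>} = {cochain1 G (\<lambda>_. 0)} \<longleftrightarrow> (\<forall>x\<in>carrier G. \<alpha> x = 0)" for \<alpha>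
    using cochain1_eq_iff by auto
  show ?thesis
    unfolding one_cohomology1
  proof
    assume *: "cup_radical p G = {{cochain1 G (\<lambda>_. 0)}}"
    show "\<forall>\<alpha>. character p G \<alpha> \<and> (\<forall>\<beta>. character p G \<beta> \<longrightarrow> cup_trivial p G \<alpha> \<beta>) \<longrightarrow> (\<forall>x\<in>carrier G. \<alpha> x = 0)"
      using mem eq0 unfolding * by blast
  next
    assume *: "\<forall>\<alpha>. character p G \<alpha> \<and> (\<forall>\<beta>. character p G \<beta> \<longrightarrow> cup_trivial p G \<alpha> \<beta>) \<longrightarrow> (\<forall>x\<in>carrier G. \<alpha> x = 0)"
    have "A = {cochain1 G (\<lambda>_. 0)}" if A: "A \<in> cup_radical p G" for A
    proof -
      obtain \<alpha> where "character p G \<alpha>" "A = {cochain1 G \<alpha>}" using subsetD[OF sub A] by blast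
      moreover from this have "\<forall>\<beta>. character p G \<beta> \<longrightarrow> cup_trivial p G \<alpha> \<beta>"
        using mem[of \<alpha>] A by simp
      ultimately show ?thesis using * eq0[of \<alpha>] by simp
    qed
    then show "cup_radical p G = {{cochain1 G (\<lambda>_. 0)}}" using zero by blast
  qed
qed

end

text \<open>On singletons the induced map is composition with \<open>\<phi>\<close>; this is how the
  restriction maps in (2) and (3) are read.\<close>

lemma cohomology_map_character:
  assumes G: "cohomology_context G p" and H: "cohomology_context H p"
    and \<phi>: "\<phi> \<in> continuous_hom G H" and \<eta>: "character p H \<eta>"
  shows "character p G (\<lambda>x. \<eta> (\<phi> x))"
    and "cohomology_map p 1 G \<phi> {cochain1 H \<eta>} = {cochain1 G (\<lambda>x. \<eta> (\<phi> x))}"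
proof -
  interpret G: cohomology_context G p by (rule G)
  interpret H: cohomology_context H p by (rule H)
  have \<phi>H: "\<phi> x \<in> carrier H" if "x \<in> carrier G" for x
    using \<phi> that by (auto simp: continuous_hom_def hom_def)
  have "G.cont (\<lambda>x. \<eta> (\<phi> x))"
    using \<phi> characterD(1)[OF \<eta>] continuous_map_compose[of "gtop G" "gtop H" \<phi> _ \<eta>]
    by (simp add: continuous_hom_def o_def)
  then show char: "character p G (\<lambda>x. \<eta> (\<phi> x))"
    using \<phi> characterD(3)[OF \<eta>] \<phi>H
    by (intro characterI G.topspace_G) (auto simp: continuous_hom_def hom_def)
  have "pullback_cochain 1 G \<phi> (cochain1 H \<eta>) = cochain1 G (\<lambda>x. \<eta> (\<phi> x))"
    unfolding pullback_cochain_def cochain1_def[of G]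
  proof (rule restrict_ext)
    fix x assume "x \<in> tuples 1 G"
    then have "\<phi> (x 0) \<in> carrier H" using G.tuples1_entry \<phi>H by blast
    then show "cochain1 H \<eta> (\<lambda>i\<in>{..<1}. \<phi> (x i)) = \<eta> (\<phi> (x 0))"
      using H.cochain1_apply[of "\<phi> (x 0)" \<eta>] by (simp cong: restrict_cong)
  qed
  then show "cohomology_map p 1 G \<phi> {cochain1 H \<eta>} = {cochain1 G (\<lambda>x. \<eta> (\<phi> x))}"
    using G.zero_add_cochain1[OF characterD(1)[OF char]] by (simp add: cohomology_map_def)
qed

lemma cup_trivial_pullback:
  assumes G: "cohomology_context G p" and \<phi>: "\<phi> \<in> continuous_hom G H"
    and "cup_trivial p H \<alpha> \<beta>"
  shows "cup_trivial p G (\<lambda>x. \<alpha> (\<phi> x)) (\<lambda>x. \<beta> (\<phi> x))"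
proof -
  obtain c where c: "continuous_map (gtop H) (discrete_topology {0..int p - 1}) c"
     "\<And>x y. x \<in> carrier H \<Longrightarrow> y \<in> carrier H \<Longrightarrow>
           (c x + c y - c (x \<otimes>\<^bsub>H\<^esub> y)) mod int p = (\<alpha> x * \<beta> y) mod int p"
    using assms(3) unfolding cup_trivial_def by blast
  have "continuous_map (gtop G) (discrete_topology {0..int p - 1}) (\<lambda>x. c (\<phi> x))"
    using \<phi> c(1) continuous_map_compose[of "gtop G" "gtop H" \<phi> _ c]
    by (simp add: continuous_hom_def o_def)
  moreover have "\<phi> x \<in> carrier H" "\<phi> (x \<otimes>\<^bsub>G\<^esub> y) = \<phi> x \<otimes>\<^bsub>H\<^esub> \<phi> y"
    if "x \<in> carrier G" "y \<in> carrier G" for x y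
    using \<phi> that by (auto simp: continuous_hom_def hom_def)
  ultimately show ?thesis
    unfolding cup_trivial_def using c(2) by (intro exI[of _ "\<lambda>x. c (\<phi> x)"]) simp
qed

section \<open>Trees\<close>

lemma serre_graphD:
  assumes "finite_serre_graph \<Gamma>" "e \<in> edges \<Gamma>"
  shows "d0 \<Gamma> e \<in> verts \<Gamma>" "d1 \<Gamma> e \<in> verts \<Gamma>" "rev_edge \<Gamma> e \<in> edges \<Gamma>"
    and "rev_edge \<Gamma> (rev_edge \<Gamma> e) = e" "rev_edge \<Gamma> e \<noteq> e"
    and "d0 \<Gamma> (rev_edge \<Gamma> e) = d1 \<Gamma> e" "d1 \<Gamma> (rev_edge \<Gamma> e) = d0 \<Gamma> e"
proof -
  have *: "d0 \<Gamma> f \<in> verts \<Gamma> \<and> d1 \<Gamma> f \<in> verts \<Gamma> \<and> rev_edge \<Gamma> f \<in> edges \<Gamma> \<and>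
      rev_edge \<Gamma> (rev_edge \<Gamma> f) = f \<and> rev_edge \<Gamma> f \<noteq> f \<and> d0 \<Gamma> f = d1 \<Gamma> (rev_edge \<Gamma> f)" if "f \<in> edges \<Gamma>" for f
    using assms(1) that unfolding finite_serre_graph_def by blast
  show "d0 \<Gamma> e \<in> verts \<Gamma>" "d1 \<Gamma> e \<in> verts \<Gamma>" "rev_edge \<Gamma> e \<in> edges \<Gamma>"
    "rev_edge \<Gamma> (rev_edge \<Gamma> e) = e" "rev_edge \<Gamma> e \<noteq> e" "d1 \<Gamma> (rev_edge \<Gamma> e) = d0 \<Gamma> e"
    using *[OF assms(2)] by metis+
  then show "d0 \<Gamma> (rev_edge \<Gamma> e) = d1 \<Gamma> e"
    using *[of "rev_edge \<Gamma> e"] by simp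
qed

lemma path_between_verts:
  assumes "finite_serre_graph \<Gamma>" "path_between \<Gamma> u es v"
  shows "u \<in> verts \<Gamma>" "v \<in> verts \<Gamma>"
proof -
  have "u \<in> verts \<Gamma> \<and> v \<in> verts \<Gamma>"
    using assms(2) serre_graphD(1)[OF assms(1)] by (induction es arbitrary: u) auto
  then show "u \<in> verts \<Gamma>" "v \<in> verts \<Gamma>" by auto
qed

lemma path_between_append:
  assumes "finite_serre_graph \<Gamma>"
  shows "path_between \<Gamma> u (es @ fs) v \<longleftrightarrow> (\<exists>w. path_between \<Gamma> u es w \<and> path_between \<Gamma> w fs v)"
  by (induction es arbitrary: u) (use path_between_verts[OF assms] in auto)

lemma reduced_path_iff: "reduced_path \<Gamma> es \<longleftrightarrow> successively (\<lambda>e f. f \<noteq> rev_edge \<Gamma> e) es"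
  by (simp add: reduced_path_def successively_conv_nth)

text \<open>Deleting an edge together with the reversed edge that follows it keeps the ends and
  shortens the path. The bound on \<open>set fs\<close> keeps the reduced path within a region that
  contained the original one.\<close>

lemma path_between_reduced:
  assumes \<Gamma>: "finite_serre_graph \<Gamma>" and es: "path_between \<Gamma> u es v"
  shows "\<exists>fs. path_between \<Gamma> u fs v \<and> reduced_path \<Gamma> fs \<and> set fs \<subseteq> set es"
  using es
proof (induction "length es" arbitrary: es rule: less_induct)
  case less
  show ?case
  proof (cases "reduced_path \<Gamma> es")
    case True
    then show ?thesis using less.prems by blast
  next
    case False
    then obtain i where i: "Suc i < length es" "es ! Suc i = rev_edge \<Gamma> (es ! i)"
      unfolding reduced_path_def by blast
    let ?e = "es ! i"
    have split: "es = take i es @ [?e, rev_edge \<Gamma> ?e] @ drop (Suc (Suc i)) es"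
      using i by (metis Cons_nth_drop_Suc Suc_lessD append_Cons append_Nil append_take_drop_id)
    have "path_between \<Gamma> u (take i es @ [?e, rev_edge \<Gamma> ?e] @ drop (Suc (Suc i)) es) v"
      using less.prems split by simp
    then obtain w where w: "path_between \<Gamma> u (take i es) w" "?e \<in> edges \<Gamma>" "d0 \<Gamma> ?e = w"
      "path_between \<Gamma> (d1 \<Gamma> (rev_edge \<Gamma> ?e)) (drop (Suc (Suc i)) es) v"
      by (auto simp: path_between_append[OF \<Gamma>])
    then have "path_between \<Gamma> u (take i es @ drop (Suc (Suc i)) es) v"
      using serre_graphD(7)[OF \<Gamma> w(2)] by (auto simp: path_between_append[OF \<Gamma>])
    moreover have "length (take i es @ drop (Suc (Suc i)) es) < length es" using i(1) by simp
    ultimately obtain fs where "path_between \<Gamma> u fs v" "reduced_path \<Gamma> fs"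
      "set fs \<subseteq> set (take i es @ drop (Suc (Suc i)) es)"
      using less.hyps by blast
    moreover have "set (take i es @ drop (Suc (Suc i)) es) \<subseteq> set es"
      using set_take_subset set_drop_subset by fastforce
    ultimately show ?thesis by blast
  qed
qed

lemma path_between_leaving_edge:
  assumes "path_between \<Gamma> u es v" "u \<in> W" "v \<notin> W"
  obtains e where "e \<in> set es" "e \<in> edges \<Gamma>" "d0 \<Gamma> e \<in> W" "d1 \<Gamma> e \<notin> W"
proof -
  have "\<exists>e\<in>set es. e \<in> edges \<Gamma> \<and> d0 \<Gamma> e \<in> W \<and> d1 \<Gamma> e \<notin> W"
    using assms(1,2)
  proof (induction es arbitrary: u)
    case Nil
    then show ?case using assms(3) by simp
  next
    case (Cons e es)
    then show ?case by (cases "d1 \<Gamma> e \<in> W") auto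
  qed
  then show ?thesis using that by blast
qed

lemma tree_graph_no_closed_path:
  "tree_graph T \<Longrightarrow> path_between T v es v \<Longrightarrow> reduced_path T es \<Longrightarrow> es = []"
  unfolding tree_graph_def by blast

text \<open>A labelling of one vertex propagates along the edges: a connected set \<open>W\<close> of labelled vertices
  is joined to a new vertex by one edge only, since a second one would close a reduced path.\<close>

lemma tree_labelling_exists:
  assumes T: "finite_serre_graph T" and tree: "tree_graph T" and v: "v \<in> verts T" and a: "A v a"
    and step: "\<And>e x. e \<in> edges T \<Longrightarrow> A (d0 T e) x \<Longrightarrow> \<exists>y. A (d1 T e) y \<and> S e x y"
    and sym: "\<And>e x y. e \<in> edges T \<Longrightarrow> S e x y \<Longrightarrow> S (rev_edge T e) y x"
  shows "\<exists>f. f v = a \<and> (\<forall>w\<in>verts T. A w (f w)) \<and> (\<forall>e\<in>edges T. S e (f (d0 T e)) (f (d1 T e)))"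
proof -
  define inner where "inner W = {e. d0 T e \<in> W \<and> d1 T e \<in> W}" for W
  define conn where "conn W \<longleftrightarrow> (\<forall>x\<in>W. \<forall>y\<in>W. \<exists>es. path_between T x es y \<and> set es \<subseteq> inner W)" for W
  define lab where "lab W f \<longleftrightarrow> f v = a \<and> (\<forall>w\<in>W. A w (f w)) \<and>
      (\<forall>e\<in>edges T \<inter> inner W. S e (f (d0 T e)) (f (d1 T e)))" for W f
  define good where "good W \<longleftrightarrow> W \<subseteq> verts T \<and> v \<in> W \<and> conn W \<and> (\<exists>f. lab W f)" for W
  have no_loop: "d0 T e \<noteq> d1 T e" if e: "e \<in> edges T" for e
  proof
    assume "d0 T e = d1 T e"
    then have "path_between T (d0 T e) [e] (d0 T e)"
      using e serre_graphD(1)[OF T e] by simp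
    moreover have "reduced_path T [e]" by (simp add: reduced_path_def)
    ultimately show False using tree_graph_no_closed_path[OF tree] by blast
  qed
  have inner_edge: "e \<notin> inner {v}" if "e \<in> edges T" for e
    using no_loop[OF that] by (auto simp: inner_def)
  have "good {v}"
    unfolding good_def conn_def lab_def
  proof (intro conjI exI[of _ "\<lambda>_. a"] ballI)
    show "\<exists>es. path_between T x es y \<and> set es \<subseteq> inner {v}" if "x \<in> {v}" "y \<in> {v}" for x y
      using that v by (intro exI[of _ "[]"]) auto
  qed (use v a inner_edge in auto)
  have fin: "finite (Collect good)"
  proof (rule finite_subset)
    show "Collect good \<subseteq> Pow (verts T)" by (auto simp: good_def)
    show "finite (Pow (verts T))" using T by (simp add: finite_serre_graph_def)
  qed
  \<comment> \<open>Maximality replaces an enumeration of the vertices: a good set that misses a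
    vertex is enlarged below by the far end of one edge.\<close>
  then obtain W where W: "good W" "\<And>W'. good W' \<Longrightarrow> W \<subseteq> W' \<Longrightarrow> W' = W"
    using finite_has_maximal[OF fin] \<open>good {v}\<close> by (metis empty_iff mem_Collect_eq)
  then obtain f where f: "lab W f" and sub: "W \<subseteq> verts T" and vW: "v \<in> W" and conn: "conn W"
    by (auto simp: good_def)
  have "W = verts T"
  proof (rule ccontr)
    assume "W \<noteq> verts T"
    then obtain u where u: "u \<in> verts T" "u \<notin> W" using sub by blast
    obtain es where "path_between T v es u"
      using tree v u(1) unfolding tree_graph_def connected_graph_def by blast
    then obtain e where e: "e \<in> edges T" "d0 T e \<in> W" "d1 T e \<notin> W"
      using path_between_leaving_edge[of T v es u W] vW u(2) by blast
    let ?w = "d1 T e"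
    let ?W = "insert ?w W"
    have unique: "g = e" if g: "g \<in> edges T" "d0 T g \<in> W" "d1 T g = ?w" for g
    proof (rule ccontr)
      assume "g \<noteq> e"
      obtain es where "path_between T (d0 T g) es (d0 T e)" "set es \<subseteq> inner W"
        using conn g(2) e(2) unfolding conn_def by blast
      then obtain fs where fs: "path_between T (d0 T g) fs (d0 T e)" "reduced_path T fs" "set fs \<subseteq> inner W"
        using path_between_reduced[OF T] by (meson order_trans)
      \<comment> \<open>Out of \<open>W\<close> along \<open>e\<close>, back into it along the
        reverse of \<open>g\<close>, and home inside \<open>W\<close>.\<close>
      have "path_between T (d0 T e) (e # rev_edge T g # fs) (d0 T e)"
        using fs(1) e(1) g(1,3) serre_graphD[OF T g(1)] by simp
      moreover have "reduced_path T (e # rev_edge T g # fs)"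
      proof -
        have "rev_edge T g \<noteq> rev_edge T e"
          using \<open>g \<noteq> e\<close> serre_graphD(4)[OF T g(1)] serre_graphD(4)[OF T e(1)] by metis
        \<comment> \<open>The only possible backtrack at this place would be \<open>g\<close> right
          after its reverse; but the edges of \<open>fs\<close> have both ends in \<open>W\<close>,
          while \<open>g\<close> ends at \<open>?w\<close>.\<close>
        moreover have "hd fs \<noteq> g" if "fs \<noteq> []"
        proof -
          have "hd fs \<in> inner W" using that fs(3) hd_in_set by blast
          then show ?thesis using g(3) e(3) by (auto simp: inner_def)
        qed
        ultimately show ?thesis
          using fs(2) serre_graphD(4)[OF T g(1)] unfolding reduced_path_iff
          by (cases fs) auto
      qed
      ultimately show False using tree_graph_no_closed_path[OF tree] by blast
    qed
    have Ad0: "A (d0 T e) (f (d0 T e))" using f e(2) by (simp add: lab_def)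
    obtain b where b: "A ?w b" "S e (f (d0 T e)) b" using step[OF e(1) Ad0] by blast
    let ?f = "f(?w := b)"
    have "lab ?W ?f"
      unfolding lab_def
    proof (intro conjI ballI)
      show "?f v = a" using f vW e(3) by (auto simp: lab_def)
      show "A w (?f w)" if "w \<in> ?W" for w using that f b(1) by (auto simp: lab_def)
      show "S g (?f (d0 T g)) (?f (d1 T g))" if g: "g \<in> edges T \<inter> inner ?W" for g
      proof -
        have gT: "g \<in> edges T" using g by blast
        \<comment> \<open>A loop at \<open>?w\<close> is excluded, so an edge with a new end is
          \<open>e\<close> or its reverse; the latter is what the symmetry of \<open>S\<close> is
          for.\<close>
        consider "d0 T g \<in> W" "d1 T g \<in> W" | "d0 T g \<in> W" "d1 T g = ?w" | "d0 T g = ?w" "d1 T g \<in> W"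
          using g no_loop[OF gT] by (auto simp: inner_def)
        then show ?thesis
        proof cases
          case 1
          then have "d0 T g \<noteq> ?w" "d1 T g \<noteq> ?w" using e(3) by auto
          then show ?thesis using 1 f gT by (simp add: lab_def inner_def)
        next
          case 2
          then have "g = e" using unique[OF gT] by blast
          moreover have "d0 T e \<noteq> ?w" using e by auto
          ultimately show ?thesis using b(2) by simp
        next
          case 3
          have "rev_edge T g = e"
            using unique[of "rev_edge T g"] 3 serre_graphD[OF T gT] by simp
          then have "g = rev_edge T e" using serre_graphD(4)[OF T gT] by simp
          moreover have "d0 T e \<noteq> ?w" using e by auto
          ultimately show ?thesis
            using sym[OF e(1) b(2)] serre_graphD(6,7)[OF T e(1)] by simp
        qed
      qed
    qed
    moreover have "conn ?W"
      unfolding conn_def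
    proof (intro ballI)
      fix x y assume xy: "x \<in> ?W" "y \<in> ?W"
      have mono: "inner W \<subseteq> inner ?W" by (auto simp: inner_def)
      have e_in: "e \<in> inner ?W" "rev_edge T e \<in> inner ?W"
        using e serre_graphD(6,7)[OF T e(1)] by (auto simp: inner_def)
      consider "x \<in> W" "y \<in> W" | "x \<in> W" "y = ?w" | "x = ?w" "y \<in> W" | "x = ?w" "y = ?w" using xy by blast
      then show "\<exists>es. path_between T x es y \<and> set es \<subseteq> inner ?W"
      proof cases
        case 1
        then show ?thesis using conn mono unfolding conn_def by (meson order_trans)
      next
        case 2
        then obtain es where "path_between T x es (d0 T e)" "set es \<subseteq> inner W"
          using conn e(2) unfolding conn_def by blast
        then show ?thesis
          using 2 e(1) mono e_in serre_graphD(2)[OF T e(1)]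
          by (intro exI[of _ "es @ [e]"]) (auto simp: path_between_append[OF T])
      next
        case 3
        then obtain es where "path_between T (d0 T e) es y" "set es \<subseteq> inner W"
          using conn e(2) unfolding conn_def by blast
        then show ?thesis
          using 3 e(1) mono e_in serre_graphD[OF T e(1)]
          by (intro exI[of _ "rev_edge T e # es"]) auto
      next
        case 4
        then show ?thesis using serre_graphD(2)[OF T e(1)] by (intro exI[of _ "[]"]) simp
      qed
    qed
    ultimately have "good ?W"
      using sub vW serre_graphD(2)[OF T e(1)] by (auto simp: good_def)
    then have "?W = W" using W(2)[of ?W] by blast
    then show False using e(3) by blast
  qed
  moreover have "edges T \<subseteq> inner (verts T)"
    using serre_graphD(1,2)[OF T] by (auto simp: inner_def)
  ultimately show ?thesis using f by (intro exI[of _ f]) (auto simp: lab_def)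
qed

section \<open>Maximal subtrees span a connected graph\<close>

lemma path_between_subgraph:
  assumes "subgraph T \<Gamma>" "path_between T u es v"
  shows "path_between \<Gamma> u es v"
  using assms(2) by (induction es arbitrary: u) (use assms(1) in \<open>auto simp: subgraph_def\<close>)

text \<open>A tree gains a vertex by an edge that leaves it: a reduced path between vertices of the old tree
  cannot visit the new vertex.\<close>

lemma tree_graph_add_edge:
  assumes T: "finite_serre_graph T" "tree_graph T" and \<Gamma>: "finite_serre_graph \<Gamma>" and sub: "subgraph T \<Gamma>"
    and e: "e \<in> edges \<Gamma>" "d0 \<Gamma> e \<in> verts T" "d1 \<Gamma> e \<notin> verts T"
    and T': "T' = T\<lparr>verts := insert (d1 \<Gamma> e) (verts T), edges := edges T \<union> {e, rev_edge \<Gamma> e}\<rparr>"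
  shows "subgraph T' \<Gamma>" "subgraph T T'" "tree_graph T'"
proof -
  let ?w = "d1 \<Gamma> e" and ?r = "rev_edge \<Gamma> e"
  have d: "d0 T = d0 \<Gamma>" "d1 T = d1 \<Gamma>" "rev_edge T = rev_edge \<Gamma>" "verts T \<subseteq> verts \<Gamma>" "edges T \<subseteq> edges \<Gamma>"
    using sub by (simp_all add: subgraph_def)
  have T'_simps [simp]: "d0 T' = d0 \<Gamma>" "d1 T' = d1 \<Gamma>" "rev_edge T' = rev_edge \<Gamma>"
    "verts T' = insert ?w (verts T)" "edges T' = edges T \<union> {e, ?r}"
    using T' d by simp_all
  note eD = serre_graphD[OF \<Gamma> e(1)]
  have TD: "d0 \<Gamma> f \<in> verts T" "d1 \<Gamma> f \<in> verts T" "rev_edge \<Gamma> f \<in> edges T" if "f \<in> edges T" for f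
    using serre_graphD(1-3)[OF T(1) that] d by simp_all
  have edge_T': "f \<in> edges \<Gamma>" if "f \<in> edges T'" for f
    using that d(5) e(1) eD(3) by auto
  have fin: "finite_serre_graph T'"
    unfolding finite_serre_graph_def
  proof (intro conjI ballI)
    show "finite (verts T')" "finite (edges T')" using T(1) by (simp_all add: finite_serre_graph_def)
    fix f assume f: "f \<in> edges T'"
    note fD = serre_graphD[OF \<Gamma> edge_T'[OF f]]
    show "d0 T' f \<in> verts T'" "d1 T' f \<in> verts T'" "rev_edge T' f \<in> edges T'"
      using f TD e(2) eD by auto
    show "rev_edge T' (rev_edge T' f) = f" "rev_edge T' f \<noteq> f" "d0 T' f = d1 T' (rev_edge T' f)"
      using fD by simp_all
  qed
  show "subgraph T' \<Gamma>"
    using fin d e(1) eD by (simp add: subgraph_def)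
  show sub': "subgraph T T'"
    using T(1) d by (auto simp: subgraph_def)
  have conn_T: "\<exists>es. path_between T' x es y" if "x \<in> verts T" "y \<in> verts T" for x y
    using T(2) that path_between_subgraph[OF sub'] unfolding tree_graph_def connected_graph_def by blast
  have "connected_graph T'"
    unfolding connected_graph_def
  proof (intro ballI)
    fix x y assume xy: "x \<in> verts T'" "y \<in> verts T'"
    consider "x \<in> verts T" "y \<in> verts T" | "x \<in> verts T" "y = ?w" | "x = ?w" "y \<in> verts T" | "x = ?w" "y = ?w"
      using xy by auto
    then show "\<exists>es. path_between T' x es y"
    proof cases
      case 1
      then show ?thesis by (rule conn_T)
    next
      case 2
      obtain es where "path_between T' x es (d0 \<Gamma> e)" using conn_T[OF 2(1) e(2)] ..
      then show ?thesis
        using 2 by (intro exI[of _ "es @ [e]"]) (auto simp: path_between_append[OF fin])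
    next
      case 3
      obtain es where "path_between T' (d0 \<Gamma> e) es y" using conn_T[OF e(2) 3(2)] ..
      then show ?thesis using 3 eD by (intro exI[of _ "?r # es"]) simp
    next
      case 4
      then show ?thesis by (intro exI[of _ "[]"]) simp
    qed
  qed
  moreover have in_T: "path_between T u es z"
    if "path_between T' u es z" "reduced_path T' es" "u \<in> verts T" "z \<in> verts T" for u es z
    using that
  proof (induction es arbitrary: u)
    case Nil
    then show ?case by simp
  next
    case (Cons f es)
    have red: "reduced_path T' es"
      using Cons.prems(2) by (cases es) (auto simp: reduced_path_iff)
    have p: "path_between T' (d1 \<Gamma> f) es z" "d0 \<Gamma> f = u" "f \<in> edges T \<union> {e, ?r}"
      using Cons.prems(1) by simp_all
    have "f \<noteq> ?r" using p(2) Cons.prems(3) e(3) eD(6) by auto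
    \<comment> \<open>After \<open>e\<close> the path stands at the new vertex, which is not its end
      \<open>z\<close>. The only edge leaving that vertex is \<open>?r\<close>, and taking it would
      be a backtrack.\<close>
    moreover have "f \<noteq> e"
    proof
      assume f: "f = e"
      then have "es \<noteq> []" using p(1) Cons.prems(4) e(3) by auto
      then obtain g gs where g: "es = g # gs" by (cases es) auto
      then have "d0 \<Gamma> g = ?w" "g \<in> edges T \<union> {e, ?r}" using p(1) f by simp_all
      then have "g = ?r" using TD(1)[of g] e(2,3) by (metis UnE insertE singletonD)
      then show False using Cons.prems(2) f g by (simp add: reduced_path_iff)
    qed
    ultimately have f: "f \<in> edges T" using p(3) by blast
    have "path_between T (d1 \<Gamma> f) es z"
      using Cons.IH[OF p(1) red TD(2)[OF f] Cons.prems(4)] .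
    then show ?case using f p(2) d by simp
  qed
  moreover have "es = []" if es: "path_between T' v es v" "reduced_path T' es" for v es
  proof (cases "v \<in> verts T")
    case True
    have "reduced_path T es" using es(2) d(3) by (simp add: reduced_path_def)
    then show ?thesis
      using tree_graph_no_closed_path[OF T(2) in_T[OF es True True]] by blast
  next
    \<comment> \<open>A closed path may be reduced and still begin and end with mutually reverse
      edges, so this case needs an argument. The path begins with \<open>?r\<close> and ends with
      \<open>e\<close>; what lies between is a reduced closed path in the old tree, hence empty, and
      \<open>?r\<close> followed by \<open>e\<close> is a backtrack.\<close>
    case False
    show ?thesis
    proof (rule ccontr)
      assume "es \<noteq> []"
      then obtain f fs where f: "es = f # fs" by (cases es) auto
      have v: "v = ?w" using path_between_verts(1)[OF fin es(1)] False by simp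
      have "d0 \<Gamma> f = ?w" "f \<in> edges T \<union> {e, ?r}" using es(1) f v by simp_all
      then have fe: "f = ?r" using TD(1)[of f] e(2,3) by (metis UnE insertE singletonD)
      have fs: "path_between T' (d0 \<Gamma> e) fs ?w" using es(1) f v fe eD by simp
      then have "fs \<noteq> []" using e(2,3) by auto
      then obtain gs g where g: "fs = gs @ [g]" by (metis rev_exhaust)
      obtain x where x: "path_between T' (d0 \<Gamma> e) gs x" "path_between T' x [g] ?w"
        using fs unfolding g path_between_append[OF fin] by blast
      then have "g \<in> edges T \<union> {e, ?r}" "d1 \<Gamma> g = ?w" by simp_all
      then have "g = e" using TD(2)[of g] e(2,3) eD(7) by (metis UnE insertE singletonD)
      then have gs: "path_between T' (d0 \<Gamma> e) gs (d0 \<Gamma> e)" using x by simp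
      have red: "reduced_path T' (?r # gs @ [e])" using es(2) f fe g \<open>g = e\<close> by simp
      then have "reduced_path T' gs"
        unfolding reduced_path_iff by (metis append_Cons append_Nil successively_append_iff)
      then have "path_between T (d0 \<Gamma> e) gs (d0 \<Gamma> e)" "reduced_path T gs"
        using in_T[OF gs _ e(2) e(2)] d(3) by (simp_all add: reduced_path_def)
      then have "gs = []" using tree_graph_no_closed_path[OF T(2)] by blast
      then show False using red eD(4) by (simp add: reduced_path_iff)
    qed
  qed
  ultimately show "tree_graph T'" unfolding tree_graph_def by blast
qed

text \<open>If a vertex were missed, a path to it would leave the tree along some edge, and adding
  that edge would give a larger subtree.\<close>

lemma maximal_subtree_spanning:
  assumes \<Gamma>: "finite_serre_graph \<Gamma>" "connected_graph \<Gamma>" and T: "maximal_subtree T \<Gamma>"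
  shows "verts T = verts \<Gamma>"
proof (rule ccontr)
  have sub: "subgraph T \<Gamma>" and tree: "tree_graph T"
    and max: "\<And>T'. subgraph T' \<Gamma> \<Longrightarrow> tree_graph T' \<Longrightarrow> subgraph T T' \<Longrightarrow> T' = T"
    using T by (auto simp: maximal_subtree_def)
  have fin: "finite_serre_graph T" and d: "d0 T = d0 \<Gamma>" "verts T \<subseteq> verts \<Gamma>" "d1 T = d1 \<Gamma>" "rev_edge T = rev_edge \<Gamma>"
    using sub by (auto simp: subgraph_def)
  assume "verts T \<noteq> verts \<Gamma>"
  then obtain u where u: "u \<in> verts \<Gamma>" "u \<notin> verts T" using d(2) by blast
  show False
  proof (cases "verts T = {}")
    \<comment> \<open>The empty graph satisfies the definition of a tree, so it is ruled out
      separately: a single vertex would enlarge it.\<close>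
    case True
    have no_edges: "edges T = {}" using serre_graphD(1)[OF fin] True by auto
    let ?T' = "T\<lparr>verts := {u}\<rparr>"
    have "path_between ?T' v es w \<longleftrightarrow> es = [] \<and> v = u \<and> w = u" for v es w
      using no_edges by (cases es) auto
    then have "tree_graph ?T'" by (auto simp: tree_graph_def connected_graph_def)
    moreover have "subgraph ?T' \<Gamma>" "subgraph T ?T'"
      using no_edges u(1) d True by (auto simp: subgraph_def finite_serre_graph_def)
    ultimately have "?T' = T" by (intro max)
    then have "verts ?T' = verts T" by simp
    then show False using True by simp
  next
    case False
    then obtain v where v: "v \<in> verts T" by blast
    then obtain es where "path_between \<Gamma> v es u"
      using \<Gamma>(2) u(1) d(2) unfolding connected_graph_def by blast
    then obtain e where e: "e \<in> edges \<Gamma>" "d0 \<Gamma> e \<in> verts T" "d1 \<Gamma> e \<notin> verts T"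
      using path_between_leaving_edge[of \<Gamma> v es u "verts T"] v u(2) by blast
    let ?T' = "T\<lparr>verts := insert (d1 \<Gamma> e) (verts T), edges := edges T \<union> {e, rev_edge \<Gamma> e}\<rparr>"
    have "?T' = T"
      using tree_graph_add_edge[OF fin tree \<Gamma>(1) sub e refl] by (intro max)
    then have "verts ?T' = verts T" by simp
    then show False using e(3) by auto
  qed
qed

section \<open>Quotients and the fundamental group\<close>

lemma pro_p_group_cohomology_context:
  assumes "prime p" "pro_p_group p G"
  shows "cohomology_context G p"
  using assms prime_gt_1_nat[OF assms(1)]
  by (simp add: cohomology_context_def cohomology_context_axioms_def pro_p_group_def profinite_group_def topological_group_def)

lemma continuous_hom_compose:
  assumes "f \<in> continuous_hom G H" "g \<in> continuous_hom H K"
  shows "(\<lambda>x. g (f x)) \<in> continuous_hom G K"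
proof -
  have "g \<circ> f \<in> hom G K" using assms by (auto simp: continuous_hom_def intro: hom_compose)
  moreover have "continuous_map (gtop G) (gtop K) (g \<circ> f)"
    using assms by (auto simp: continuous_hom_def intro: continuous_map_compose)
  ultimately show ?thesis by (simp add: continuous_hom_def o_def)
qed

lemma finite_p_group_Fp: 
  assumes "prime p" shows "finite_p_group p (add_monoid (Fp p))"
proof -
  interpret F: cring "Fp p" using assms by (intro Fp_cring prime_gt_1_nat)
  have "order (add_monoid (Fp p)) = p ^ 1" by (simp add: order_def)
  moreover have "group (add_monoid (Fp p))" by (rule F.a_group)
  moreover have "finite (carrier (add_monoid (Fp p)))" by simp
  ultimately show ?thesis unfolding finite_p_group_def by blast
qed

section \<open>Closed normal closures and characters of quotients\<close>

context cohomology_context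
begin

lemma carrier_closed: "closedin (gtop G) (carrier G)"
  using closedin_topspace[of "gtop G"] by (simp only: topspace_G)


lemma closed_normal_closure_normal:
  assumes S: "S \<subseteq> carrier G"
  shows "closed_normal_closure G S \<lhd> G"
proof -
  define \<N> where "\<N> = {N. N \<lhd> G \<and> closedin (gtop G) N \<and> S \<subseteq> N}"
  have sub: "subgroup (carrier G) G" by (rule subgroup_self)
  have "carrier G \<lhd> G"
    by (rule normal_invI[OF sub]) simp
  then have ne: "carrier G \<in> \<N>"
    using carrier_closed S by (simp add: \<N>_def)
  have "subgroup (\<Inter>\<N>) G"
    using ne by (intro subgroups_Inter) (auto simp: \<N>_def normal_def)
  then have "\<Inter>\<N> \<lhd> G"
  proof (rule normal_invI)
    fix x h assume x: "x \<in> carrier G" and h: "h \<in> \<Inter>\<N>"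
    show "x \<otimes> h \<otimes> inv x \<in> \<Inter>\<N>"
    proof
      fix N assume N: "N \<in> \<N>"
      then have "N \<lhd> G" by (simp add: \<N>_def)
      then show "x \<otimes> h \<otimes> inv x \<in> N"
        using normal.inv_op_closed2[of N G x h] x h N by blast
    qed
  qed
  then show ?thesis by (simp add: closed_normal_closure_def \<N>_def)
qed

lemma character_zero: 
  assumes "character p G \<eta>" shows "\<eta> \<one> = 0"
proof -
  have "\<eta> \<one> = (\<eta> \<one> + \<eta> \<one>) mod int p" "\<eta> \<one> \<in> {0..int p - 1}"
    using characterD(3)[OF assms, of \<one> \<one>] characterD(2)[OF assms, of \<one>] by simp_all
  then show ?thesis
    by (smt (verit) atLeastAtMost_iff mod_pos_pos_trivial mod_add_self2 minus_mod_self2)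
qed

lemma character_conj: 
  assumes "character p G \<eta>" "x \<in> carrier G" "h \<in> carrier G" "\<eta> h = 0"
  shows "\<eta> (x \<otimes> h \<otimes> inv x) = 0"
proof -
  note \<eta> = characterD(3)[OF assms(1)]
  have "\<eta> (x \<otimes> h) = \<eta> (x \<otimes> \<one>)"
    using \<eta>[OF assms(2,3)] \<eta>[OF assms(2) one_closed] assms(4) character_zero[OF assms(1)] by simp
  then have "\<eta> (x \<otimes> h \<otimes> inv x) = \<eta> (x \<otimes> inv x)"
    using \<eta>[of "x \<otimes> h" "inv x"] \<eta>[of x "inv x"] assms by simp
  then show ?thesis using assms(2) character_zero[OF assms(1)] by simp
qed

lemma character_kernel_closed_normal:
  assumes \<eta>: "character p G \<eta>"
  shows "{x \<in> carrier G. \<eta> x = 0} \<lhd> G" "closedin (gtop G) {x \<in> carrier G. \<eta> x = 0}"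
proof -
  let ?K = "{x \<in> carrier G. \<eta> x = 0}"
  have inv: "\<eta> (inv x) = 0" if x: "x \<in> ?K" for x
  proof -
    have "\<eta> (inv x) = (\<eta> x + \<eta> (inv x)) mod int p"
      using x cont_range_mod[OF characterD(1)[OF \<eta>], of "inv x"] by simp
    also have "\<dots> = \<eta> (x \<otimes> inv x)" using characterD(3)[OF \<eta>, of x "inv x"] x by simp
    finally show ?thesis using x character_zero[OF \<eta>] by simp
  qed
  have "subgroup ?K G"
  proof (rule subgroupI)
    show "?K \<noteq> {}" using character_zero[OF \<eta>] one_closed by blast
    show "inv x \<in> ?K" if "x \<in> ?K" for x using that inv by simp
    show "x \<otimes> y \<in> ?K" if "x \<in> ?K" "y \<in> ?K" for x y
      using that characterD(3)[OF \<eta>] by simp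
  qed blast
  then show "?K \<lhd> G"
    by (rule normal_invI) (use character_conj[OF \<eta>] in simp)
  have "closedin (gtop G) {x \<in> topspace (gtop G). \<eta> x \<in> {0}}"
    using p_gt_1 by (intro closedin_continuous_map_preimage[OF characterD(1)[OF \<eta>]]) simp
  then show "closedin (gtop G) ?K" by (simp add: topspace_G)
qed

text \<open>The kernel of a continuous character is one of the closed normal subgroups over which
  the closure is an intersection.\<close>

lemma closed_normal_closure_character_zero:
  assumes "character p G \<eta>" "S \<subseteq> carrier G" "\<And>s. s \<in> S \<Longrightarrow> \<eta> s = 0" "x \<in> closed_normal_closure G S"
  shows "\<eta> x = 0"
proof -
  have "{x \<in> carrier G. \<eta> x = 0} \<in> {N. N \<lhd> G \<and> closedin (gtop G) N \<and> S \<subseteq> N}"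
    using character_kernel_closed_normal[OF assms(1)] assms(2,3) by blast
  then have "closed_normal_closure G S \<subseteq> {x \<in> carrier G. \<eta> x = 0}"
    unfolding closed_normal_closure_def by (rule Inter_lower)
  then show ?thesis using assms(4) by blast
qed

lemma quotient_group_cohomology_context:
  assumes N: "N \<lhd> G"
  shows "cohomology_context (quotient_group G N) p"
    and "(\<lambda>x. N #> x) \<in> continuous_hom G (quotient_group G N)"
proof -
  interpret N: normal N G by (rule N)
  let ?Q = "quotient_group G N"
  have car: "carrier ?Q = carrier (G Mod N)" and mult: "monoid.mult ?Q = monoid.mult (G Mod N)"
    and one: "one ?Q = one (G Mod N)"
    by (simp_all add: quotient_group_def)
  have "group ?Q"
    using N.factorgroup_is_group car mult one
    by (simp add: group_def group_axioms_def monoid_def Units_def)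
  have rcos: "N #> x \<in> carrier ?Q" if "x \<in> carrier G" for x
    using that by (auto simp: car carrier_FactGroup)
  have "{x \<in> carrier G. N #> x \<in> carrier (G Mod N)} = topspace (gtop G)"
    using rcos by (auto simp: topspace_G car)
  then have "openin (gtop ?Q) (carrier ?Q)"
    by (simp add: openin_quotient_group car)
  moreover have "topspace (gtop ?Q) \<subseteq> carrier ?Q"
    using openin_topspace[of "gtop ?Q"] unfolding openin_quotient_group car by blast
  ultimately have top: "topspace (gtop ?Q) = carrier ?Q"
    using openin_subset by blast
  show "cohomology_context ?Q p"
    using \<open>group ?Q\<close> top p_gt_1 by (simp add: cohomology_context_def cohomology_context_axioms_def)
  have "(\<lambda>x. N #> x) \<in> hom G ?Q"
    using rcos N.rcos_sum by (intro homI) (simp_all add: mult)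
  moreover have "continuous_map (gtop G) (gtop ?Q) (\<lambda>x. N #> x)"
    unfolding continuous_map_def
    using rcos by (auto simp: topspace_G top openin_quotient_group)
  ultimately show "(\<lambda>x. N #> x) \<in> continuous_hom G ?Q" by (simp add: continuous_hom_def)
qed

lemma quotient_group_character:
  assumes N: "N \<lhd> G" and \<eta>: "character p G \<eta>" and zero: "\<And>x. x \<in> N \<Longrightarrow> \<eta> x = 0"
  obtains \<xi> where "character p (quotient_group G N) \<xi>" "\<And>x. x \<in> carrier G \<Longrightarrow> \<xi> (N #> x) = \<eta> x"
proof -
  interpret N: normal N G by (rule N)
  let ?Q = "quotient_group G N"
  interpret Q: cohomology_context ?Q p by (rule quotient_group_cohomology_context[OF N])
  have hom: "(\<lambda>x. N #> x) \<in> hom G ?Q"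
    using quotient_group_cohomology_context(2)[OF N] by (simp add: continuous_hom_def)
  have car: "carrier ?Q = carrier (G Mod N)" by (simp add: quotient_group_def)
  \<comment> \<open>Any representative will do, as a character that vanishes on \<open>N\<close> is
    constant on its cosets. Continuity holds because preimages under \<open>\<xi>\<close> pull back
    to preimages under \<open>\<eta>\<close>.\<close>
  define \<xi> where "\<xi> A = \<eta> (SOME x. x \<in> A)" for A
  have \<xi>: "\<xi> (N #> x) = \<eta> x" if x: "x \<in> carrier G" for x
  proof -
    have "x \<in> N #> x" by (rule rcos_self[OF x N.subgroup_axioms])
    then have "(SOME y. y \<in> N #> x) \<in> N #> x" by (rule someI)
    then obtain n where n: "n \<in> N" "(SOME y. y \<in> N #> x) = n \<otimes> x"
      by (auto simp: r_coset_def)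
    have "\<eta> (n \<otimes> x) = (\<eta> n + \<eta> x) mod int p"
      using characterD(3)[OF \<eta>, of n x] x n(1) N.subset by blast
    then show ?thesis
      using n zero[OF n(1)] cont_range_mod[OF characterD(1)[OF \<eta>] x] by (simp add: \<xi>_def)
  qed
  have rep: "\<exists>x\<in>carrier G. A = N #> x" if "A \<in> carrier ?Q" for A
    using that by (auto simp: car carrier_FactGroup)
  have range: "\<xi> A \<in> {0..int p - 1}" if "A \<in> carrier ?Q" for A
    using rep[OF that] \<xi> characterD(2)[OF \<eta>] by metis
  have "continuous_map (gtop ?Q) (discrete_topology {0..int p - 1}) \<xi>"
    unfolding continuous_map_def
  proof (intro conjI allI impI)
    show "\<xi> \<in> topspace (gtop ?Q) \<rightarrow> topspace (discrete_topology {0..int p - 1})"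
      using range unfolding Q.topspace_G topspace_discrete_topology by (rule funcsetI)
    fix U assume "openin (discrete_topology {0..int p - 1}) U"
    then have "openin (gtop G) {x \<in> topspace (gtop G). \<eta> x \<in> U}"
      by (rule openin_continuous_map_preimage[OF characterD(1)[OF \<eta>]])
    moreover have "{x \<in> carrier G. N #> x \<in> {A \<in> carrier ?Q. \<xi> A \<in> U}} = {x \<in> topspace (gtop G). \<eta> x \<in> U}"
      using \<xi> hom_in_carrier[OF hom] by (auto simp: topspace_G)
    ultimately show "openin (gtop ?Q) {A \<in> topspace (gtop ?Q). \<xi> A \<in> U}"
      unfolding openin_quotient_group Q.topspace_G by (simp add: car)
  qed
  moreover have "\<xi> (A \<otimes>\<^bsub>?Q\<^esub> B) = (\<xi> A + \<xi> B) mod int p" if AB: "A \<in> carrier ?Q" "B \<in> carrier ?Q" for A B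
  proof -
    obtain x y where xy: "x \<in> carrier G" "A = N #> x" "y \<in> carrier G" "B = N #> y"
      using rep AB by blast
    then show ?thesis
      using hom_mult[OF hom xy(1,3), symmetric] \<xi> characterD(3)[OF \<eta> xy(1,3)] by simp
  qed
  ultimately have "character p ?Q \<xi>" by (intro characterI Q.topspace_G)
  then show ?thesis using \<xi> that by blast
qed

end

section \<open>Relations and characters of the fundamental group\<close>

lemma free_basis_in_carrier:
  assumes "x \<in> X"
  shows "free_basis p X x \<in> carrier (free_pro_p_group p X)"
  unfolding free_basis_def free_pro_p_group_def universal_construction.carrier_U
  by (rule universal_construction.gen_in_C[OF assms])

text \<open>Used for two pairs: \<open>\<Gamma>\<close> with its maximal subtree, and
  \<open>T\<close> with itself, which yields the group of the restriction to
  \<open>T\<close>.\<close>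

locale fundamental_group_context =
  fixes p :: nat and \<G> :: "('v, 'e, 'g, 'h) graph_groups" and \<Gamma> T :: "('v, 'e) serre_graph"
  assumes p: "prime p"
    and vertex_group: "\<And>v. v \<in> verts \<Gamma> \<Longrightarrow> pro_p_group p (vgrp \<G> v)"
    and edge_ends: "\<And>e. e \<in> edges \<Gamma> \<Longrightarrow> d0 \<Gamma> e \<in> verts \<Gamma>" "\<And>e. e \<in> edges \<Gamma> \<Longrightarrow> d1 \<Gamma> e \<in> verts \<Gamma>"
    and rev_edge: "\<And>e. e \<in> edges \<Gamma> \<Longrightarrow> rev_edge \<Gamma> e \<in> edges \<Gamma>"
    and bd0_hom: "\<And>e. e \<in> edges \<Gamma> \<Longrightarrow> bd0 \<G> e \<in> continuous_hom (egrp \<G> e) (vgrp \<G> (d0 \<Gamma> e))"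
    and bd1_hom: "\<And>e. e \<in> edges \<Gamma> \<Longrightarrow> bd1 \<G> e \<in> continuous_hom (egrp \<G> e) (vgrp \<G> (d1 \<Gamma> e))"
    and subtree: "edges T \<subseteq> edges \<Gamma>"
begin

abbreviation "F \<equiv> edge_free_group p \<Gamma>"
abbreviation "V \<equiv> vertex_free_product p \<G> \<Gamma>"
abbreviation "P \<equiv> big_product p \<G> \<Gamma>"
abbreviation "N \<equiv> fundamental_kernel p \<G> \<Gamma> T"
abbreviation "FG \<equiv> fundamental_group p \<G> \<Gamma> T"
abbreviation "t \<equiv> stable_letter p \<G> \<Gamma>"
abbreviation "\<iota> \<equiv> vertex_incl p \<G> \<Gamma>"
abbreviation "\<kappa> \<equiv> canonical_map p \<G> \<Gamma> T"
abbreviation "\<tau> e \<equiv> N #>\<^bsub>P\<^esub> t e"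

lemma F_context: "cohomology_context F p" and V_context: "cohomology_context V p" and P_context: "cohomology_context P p"
  unfolding big_product_def
  by (rule pro_p_group_cohomology_context[OF p pro_p_group_free_constructions(1)[OF p]],
      rule pro_p_group_cohomology_context[OF p pro_p_group_free_constructions(2)[OF p]],
      rule pro_p_group_cohomology_context[OF p pro_p_group_free_constructions(3)[OF p]])

lemma F_topological: "topological_group F" and V_topological: "topological_group V"
  using pro_p_group_free_constructions(1)[OF p, where X = "edges \<Gamma>"]
    pro_p_group_free_constructions(2)[OF p, where I = "verts \<Gamma>" and G = "vgrp \<G>"]
  unfolding pro_p_group_def profinite_group_def by blast+

lemma vertex_topological: "v \<in> verts \<Gamma> \<Longrightarrow> topological_group (vgrp \<G> v)"
  using vertex_group by (simp add: pro_p_group_def profinite_group_def)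

lemma vertex_context: "v \<in> verts \<Gamma> \<Longrightarrow> cohomology_context (vgrp \<G> v) p"
  using vertex_group by (rule pro_p_group_cohomology_context[OF p])

lemma stable_letter_closed: "e \<in> edges \<Gamma> \<Longrightarrow> t e \<in> carrier P"
proof -
  assume "e \<in> edges \<Gamma>"
  then have "free_basis p (edges \<Gamma>) e \<in> carrier F" by (rule free_basis_in_carrier)
  moreover have "free_product2_inl p F V \<in> hom F P"
    using free_product2_continuous_hom(1)[OF F_topological V_topological, of p]
    unfolding big_product_def continuous_hom_def by blast
  ultimately show ?thesis unfolding stable_letter_def by (rule hom_in_carrier[rotated])
qed

lemma vertex_incl_hom: "v \<in> verts \<Gamma> \<Longrightarrow> \<iota> v \<in> continuous_hom (vgrp \<G> v) P"
  using continuous_hom_compose[OF free_product_incl_continuous_hom[of "vgrp \<G>" v "verts \<Gamma>" p]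
      free_product2_continuous_hom(2)[OF F_topological V_topological, of p]] vertex_topological
  unfolding big_product_def vertex_incl_def[abs_def] by simp

lemma vertex_incl_closed: "v \<in> verts \<Gamma> \<Longrightarrow> x \<in> carrier (vgrp \<G> v) \<Longrightarrow> \<iota> v x \<in> carrier P"
  using vertex_incl_hom[of v] by (auto simp: continuous_hom_def intro: hom_in_carrier)

lemma bd_closed:
  assumes "e \<in> edges \<Gamma>" "x \<in> carrier (egrp \<G> e)"
  shows "bd0 \<G> e x \<in> carrier (vgrp \<G> (d0 \<Gamma> e))" "bd1 \<G> e x \<in> carrier (vgrp \<G> (d1 \<Gamma> e))"
  using bd0_hom[OF assms(1)] bd1_hom[OF assms(1)] assms(2)
  by (auto simp: continuous_hom_def intro: hom_in_carrier)

lemma relators_cases: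
  assumes "r \<in> relators p \<G> \<Gamma> T"
  obtains e where "e \<in> edges T" "r = t e"
  | e where "e \<in> edges \<Gamma>" "r = t (rev_edge \<Gamma> e) \<otimes>\<^bsub>P\<^esub> t e"
  | e x where "e \<in> edges \<Gamma>" "x \<in> carrier (egrp \<G> e)"
    "r = inv\<^bsub>P\<^esub> (\<iota> (d0 \<Gamma> e) (bd0 \<G> e x)) \<otimes>\<^bsub>P\<^esub> t e \<otimes>\<^bsub>P\<^esub> \<iota> (d1 \<Gamma> e) (bd1 \<G> e x) \<otimes>\<^bsub>P\<^esub> inv\<^bsub>P\<^esub> (t e)"
  using assms unfolding relators_def Let_def by blast

text \<open>Moving the inverses of the relator to the other side leaves an equation of products, to
  which a homomorphism can be applied directly.\<close>

lemma edge_relator: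
  assumes "e \<in> edges \<Gamma>" "x \<in> carrier (egrp \<G> e)"
    and "r = inv\<^bsub>P\<^esub> (\<iota> (d0 \<Gamma> e) (bd0 \<G> e x)) \<otimes>\<^bsub>P\<^esub> t e \<otimes>\<^bsub>P\<^esub> \<iota> (d1 \<Gamma> e) (bd1 \<G> e x) \<otimes>\<^bsub>P\<^esub> inv\<^bsub>P\<^esub> (t e)"
  shows "r \<in> carrier P"
    and "\<iota> (d0 \<Gamma> e) (bd0 \<G> e x) \<otimes>\<^bsub>P\<^esub> r \<otimes>\<^bsub>P\<^esub> t e = t e \<otimes>\<^bsub>P\<^esub> \<iota> (d1 \<Gamma> e) (bd1 \<G> e x)"
proof -
  interpret P: cohomology_context P p by (rule P_context)
  have closed: "t e \<in> carrier P" "\<iota> (d0 \<Gamma> e) (bd0 \<G> e x) \<in> carrier P" "\<iota> (d1 \<Gamma> e) (bd1 \<G> e x) \<in> carrier P"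
    using stable_letter_closed[OF assms(1)] vertex_incl_closed edge_ends bd_closed assms(1,2) by auto
  then show "r \<in> carrier P" using assms(3) by simp
  show "\<iota> (d0 \<Gamma> e) (bd0 \<G> e x) \<otimes>\<^bsub>P\<^esub> r \<otimes>\<^bsub>P\<^esub> t e = t e \<otimes>\<^bsub>P\<^esub> \<iota> (d1 \<Gamma> e) (bd1 \<G> e x)"
    unfolding assms(3) using closed
    by (simp add: P.m_assoc P.l_inv) (simp add: P.m_assoc[symmetric])
qed

lemma relators_closed: "relators p \<G> \<Gamma> T \<subseteq> carrier P"
proof
  interpret P: cohomology_context P p by (rule P_context)
  fix r assume "r \<in> relators p \<G> \<Gamma> T"
  then show "r \<in> carrier P"
  proof (cases rule: relators_cases)
    case (1 e)
    then show ?thesis using stable_letter_closed subtree by blast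
  next
    case (2 e)
    then show ?thesis using stable_letter_closed rev_edge by simp
  next
    case (3 e x)
    then show ?thesis by (rule edge_relator(1))
  qed
qed

lemma kernel_normal: "N \<lhd> P"
  unfolding fundamental_kernel_def
  by (rule cohomology_context.closed_normal_closure_normal[OF P_context relators_closed])

lemma relators_in_kernel: "relators p \<G> \<Gamma> T \<subseteq> N"
  unfolding fundamental_kernel_def closed_normal_closure_def by blast

lemma FG_context: "cohomology_context FG p"
  and quotient_map: "(\<lambda>x. N #>\<^bsub>P\<^esub> x) \<in> continuous_hom P FG"
  unfolding fundamental_group_def
  using cohomology_context.quotient_group_cohomology_context[OF P_context kernel_normal] by auto

lemma quotient_hom: "(\<lambda>x. N #>\<^bsub>P\<^esub> x) \<in> hom P FG"
  using quotient_map by (simp add: continuous_hom_def)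

lemma quotient_mult: "x \<in> carrier P \<Longrightarrow> y \<in> carrier P \<Longrightarrow>
    N #>\<^bsub>P\<^esub> (x \<otimes>\<^bsub>P\<^esub> y) = (N #>\<^bsub>P\<^esub> x) \<otimes>\<^bsub>FG\<^esub> (N #>\<^bsub>P\<^esub> y)"
  by (rule hom_mult[OF quotient_hom])

lemma canonical_map_hom: "v \<in> verts \<Gamma> \<Longrightarrow> \<kappa> v \<in> continuous_hom (vgrp \<G> v) FG"
  using continuous_hom_compose[OF vertex_incl_hom quotient_map] by (simp add: canonical_map_def[abs_def])

lemma canonical_map_closed: "v \<in> verts \<Gamma> \<Longrightarrow> x \<in> carrier (vgrp \<G> v) \<Longrightarrow> \<kappa> v x \<in> carrier FG"
  using canonical_map_hom[of v] by (auto simp: continuous_hom_def intro: hom_in_carrier)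

lemma \<tau>_closed: "e \<in> edges \<Gamma> \<Longrightarrow> \<tau> e \<in> carrier FG"
  by (rule hom_in_carrier[OF quotient_hom stable_letter_closed])

lemma quotient_relator:
  assumes "r \<in> relators p \<G> \<Gamma> T"
  shows "N #>\<^bsub>P\<^esub> r = \<one>\<^bsub>FG\<^esub>"
proof -
  interpret P: cohomology_context P p by (rule P_context)
  interpret N: normal N P by (rule kernel_normal)
  have "N #>\<^bsub>P\<^esub> r = N"
    using relators_in_kernel assms by (intro P.coset_join2 N.subgroup_axioms) (use relators_closed in blast)+
  then show ?thesis by (simp add: fundamental_group_def quotient_group_def)
qed

lemma \<tau>_tree: "e \<in> edges T \<Longrightarrow> \<tau> e = \<one>\<^bsub>FG\<^esub>"
  by (rule quotient_relator) (auto simp: relators_def Let_def)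

lemma \<tau>_conj:
  assumes e: "e \<in> edges \<Gamma>" and x: "x \<in> carrier (egrp \<G> e)"
  shows "\<kappa> (d0 \<Gamma> e) (bd0 \<G> e x) \<otimes>\<^bsub>FG\<^esub> \<tau> e = \<tau> e \<otimes>\<^bsub>FG\<^esub> \<kappa> (d1 \<Gamma> e) (bd1 \<G> e x)"
proof -
  interpret P: cohomology_context P p by (rule P_context)
  interpret Q: cohomology_context FG p by (rule FG_context)
  define r where "r = inv\<^bsub>P\<^esub> (\<iota> (d0 \<Gamma> e) (bd0 \<G> e x)) \<otimes>\<^bsub>P\<^esub> t e \<otimes>\<^bsub>P\<^esub> \<iota> (d1 \<Gamma> e) (bd1 \<G> e x) \<otimes>\<^bsub>P\<^esub> inv\<^bsub>P\<^esub> (t e)"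
  note r = edge_relator[OF e x r_def]
  have "r \<in> relators p \<G> \<Gamma> T" using e x unfolding relators_def Let_def r_def by blast
  note rel = quotient_relator[OF this]
  have closed: "t e \<in> carrier P" "\<iota> (d0 \<Gamma> e) (bd0 \<G> e x) \<in> carrier P" "\<iota> (d1 \<Gamma> e) (bd1 \<G> e x) \<in> carrier P"
    using stable_letter_closed[OF e] vertex_incl_closed edge_ends bd_closed e x by auto
  have "\<kappa> (d0 \<Gamma> e) (bd0 \<G> e x) \<otimes>\<^bsub>FG\<^esub> \<tau> e = N #>\<^bsub>P\<^esub> (\<iota> (d0 \<Gamma> e) (bd0 \<G> e x) \<otimes>\<^bsub>P\<^esub> r \<otimes>\<^bsub>P\<^esub> t e)"
    using closed r(1) rel canonical_map_closed[OF edge_ends(1)[OF e] bd_closed(1)[OF e x]]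
    by (simp add: quotient_mult canonical_map_def)
  also have "\<dots> = \<tau> e \<otimes>\<^bsub>FG\<^esub> \<kappa> (d1 \<Gamma> e) (bd1 \<G> e x)"
    unfolding r(2) using closed by (simp add: quotient_mult canonical_map_def)
  finally show ?thesis .
qed

text \<open>The stable letter of a tree edge is trivial, so its relation identifies the two images
  of the edge group. Hence any function on the group, not only a character, has matching
  restrictions along tree edges; this is applied below to a cochain.\<close>

lemma canonical_map_tree:
  assumes e: "e \<in> edges T" and x: "x \<in> carrier (egrp \<G> e)"
  shows "\<kappa> (d0 \<Gamma> e) (bd0 \<G> e x) = \<kappa> (d1 \<Gamma> e) (bd1 \<G> e x)"
proof -
  interpret Q: cohomology_context FG p by (rule FG_context)
  have e\<Gamma>: "e \<in> edges \<Gamma>" using e subtree by blast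
  show ?thesis
    using \<tau>_conj[OF e\<Gamma> x] \<tau>_tree[OF e] canonical_map_closed edge_ends[OF e\<Gamma>] bd_closed[OF e\<Gamma> x] by simp
qed

text \<open>The universal properties with target F_p give a character of the big free product that
  is 0 on the free factor and \<open>\<eta> v\<close> on each vertex group. As F_p is abelian, its
  value on an edge relator is the difference of the two restrictions to the edge group, which is 0
  by compatibility.\<close>

lemma fundamental_group_character_exists:
  assumes \<eta>: "\<And>v. v \<in> verts \<Gamma> \<Longrightarrow> character p (vgrp \<G> v) (\<eta> v)"
    and compat: "\<And>e x. e \<in> edges \<Gamma> \<Longrightarrow> x \<in> carrier (egrp \<G> e) \<Longrightarrow>
      \<eta> (d0 \<Gamma> e) (bd0 \<G> e x) = \<eta> (d1 \<Gamma> e) (bd1 \<G> e x)"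
  obtains \<xi> where "character p FG \<xi>" 
    "\<And>v x. v \<in> verts \<Gamma> \<Longrightarrow> x \<in> carrier (vgrp \<G> v) \<Longrightarrow> \<xi> (\<kappa> v x) = \<eta> v x"
proof -
  interpret P: cohomology_context P p by (rule P_context)
  interpret F: cohomology_context F p by (rule F_context)
  obtain g where g: "character p V g"
    "\<And>v x. v \<in> verts \<Gamma> \<Longrightarrow> x \<in> carrier (vgrp \<G> v) \<Longrightarrow> g (free_product_incl p (verts \<Gamma>) (vgrp \<G>) v x) = \<eta> v x"
    using free_pro_p_product_universal[where I = "verts \<Gamma>" and G = "vgrp \<G>" and \<psi> = \<eta>,
        OF vertex_topological finite_p_group_Fp[OF p] \<eta>] by blast
  obtain f where f: "character p P f"
    "\<And>x. x \<in> carrier F \<Longrightarrow> f (free_product2_inl p F V x) = 0"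
    "\<And>y. y \<in> carrier V \<Longrightarrow> f (free_product2_inr p F V y) = g y"
    using free_pro_p_product2_universal[OF F_topological V_topological finite_p_group_Fp[OF p] F.zero_character g(1)]
    unfolding big_product_def[symmetric] by blast
  have ft: "f (t e) = 0" if "e \<in> edges \<Gamma>" for e
    unfolding stable_letter_def using free_basis_in_carrier[OF that] by (rule f(2))
  have f\<iota>: "f (\<iota> v x) = \<eta> v x" if "v \<in> verts \<Gamma>" "x \<in> carrier (vgrp \<G> v)" for v x
  proof -
    have "free_product_incl p (verts \<Gamma>) (vgrp \<G>) v x \<in> carrier V"
      using free_product_incl_continuous_hom[of "vgrp \<G>" v, OF vertex_topological[OF that(1)] that(1)] that(2)
      by (auto simp: continuous_hom_def intro: hom_in_carrier)
    then show ?thesis unfolding vertex_incl_def using f(3) g(2)[OF that] by simp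
  qed
  have "f r = 0" if "r \<in> relators p \<G> \<Gamma> T" for r
    using that
  proof (cases rule: relators_cases)
    case (1 e)
    then show ?thesis using ft subtree by blast
  next
    case (2 e)
    then show ?thesis using ft rev_edge characterD(3)[OF f(1)] stable_letter_closed by simp
  next
    case (3 e x)
    let ?a = "\<iota> (d0 \<Gamma> e) (bd0 \<G> e x)" and ?b = "\<iota> (d1 \<Gamma> e) (bd1 \<G> e x)"
    note r = edge_relator[OF 3]
    have closed: "t e \<in> carrier P" "?a \<in> carrier P" "?b \<in> carrier P"
      using stable_letter_closed[OF 3(1)] vertex_incl_closed edge_ends bd_closed 3(1,2) by auto
    have "f ?a = f ?b"
      using f\<iota> edge_ends[OF 3(1)] bd_closed[OF 3(1,2)] compat[OF 3(1,2)] by simp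
    \<comment> \<open>Both sides of the rearranged relation are evaluated, and
      \<open>f ?a = f ?b\<close> is cancelled.\<close>
    moreover have "f (?a \<otimes>\<^bsub>P\<^esub> r \<otimes>\<^bsub>P\<^esub> t e) = (f ?a + f r) mod int p"
      using characterD(3)[OF f(1)] closed r(1) ft[OF 3(1)] by simp
    moreover have "f (t e \<otimes>\<^bsub>P\<^esub> ?b) = f ?b"
      using characterD(3)[OF f(1)] closed ft[OF 3(1)] P.cont_range_mod[OF characterD(1)[OF f(1)]] by simp
    ultimately have "(f ?b + f r) mod int p = f ?b mod int p"
      using r(2) P.cont_range_mod[OF characterD(1)[OF f(1)] closed(3)] by simp
    then have "f r mod int p = 0" by (simp add: mod_eq_dvd_iff)
    then show ?thesis using P.cont_range_mod[OF characterD(1)[OF f(1)] r(1)] by simp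
  qed
  then have "f x = 0" if "x \<in> N" for x
    using P.closed_normal_closure_character_zero[OF f(1) relators_closed] that
    unfolding fundamental_kernel_def by blast
  then obtain \<xi> where \<xi>: "character p FG \<xi>" "\<And>x. x \<in> carrier P \<Longrightarrow> \<xi> (N #>\<^bsub>P\<^esub> x) = f x"
    using P.quotient_group_character[OF kernel_normal f(1)] unfolding fundamental_group_def by blast
  show ?thesis
  proof (rule that[OF \<xi>(1)])
    fix v x assume "v \<in> verts \<Gamma>" "x \<in> carrier (vgrp \<G> v)"
    then show "\<xi> (\<kappa> v x) = \<eta> v x"
      using \<xi>(2)[OF vertex_incl_closed] f\<iota> by (simp add: canonical_map_def)
  qed
qed

text \<open>Uniqueness in the three universal properties, each time against the zero character: on
  the free group, on the product of the vertex groups, and on the product of these two.\<close>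

lemma fundamental_group_character_zero:
  assumes \<xi>: "character p FG \<xi>"
    and vertex: "\<And>v x. v \<in> verts \<Gamma> \<Longrightarrow> x \<in> carrier (vgrp \<G> v) \<Longrightarrow> \<xi> (\<kappa> v x) = 0"
    and stable: "\<And>e. e \<in> edges \<Gamma> \<Longrightarrow> \<xi> (\<tau> e) = 0"
    and A: "A \<in> carrier FG"
  shows "\<xi> A = 0"
proof -
  interpret P: cohomology_context P p by (rule P_context)
  interpret F: cohomology_context F p by (rule F_context)
  interpret V: cohomology_context V p by (rule V_context)
  have Fp: "group (add_monoid (Fp p))" using finite_p_group_Fp[OF p] by (simp add: finite_p_group_def)
  define f where "f x = \<xi> (N #>\<^bsub>P\<^esub> x)" for x
  have f: "character p P f"
    unfolding f_def by (rule cohomology_map_character(1)[OF P_context FG_context quotient_map \<xi>])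
  note inl = free_product2_continuous_hom(1)[OF F_topological V_topological, of p, folded big_product_def]
  note inr = free_product2_continuous_hom(2)[OF F_topological V_topological, of p, folded big_product_def]
  have fF: "f (free_product2_inl p F V x) = 0" if "x \<in> carrier F" for x
  proof (rule free_pro_p_group_unique[OF Fp _ F.zero_character _ that])
    show "character p F (\<lambda>x. f (free_product2_inl p F V x))"
      by (rule cohomology_map_character(1)[OF F_context P_context inl f])
    show "f (free_product2_inl p F V (free_basis p (edges \<Gamma>) e)) = 0" if "e \<in> edges \<Gamma>" for e
      using stable[OF that] by (simp add: f_def stable_letter_def)
  qed
  have fV: "f (free_product2_inr p F V x) = 0" if "x \<in> carrier V" for x
  proof (rule free_pro_p_product_unique[OF Fp _ V.zero_character _ that])
    show "character p V (\<lambda>x. f (free_product2_inr p F V x))"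
      by (rule cohomology_map_character(1)[OF V_context P_context inr f])
    show "f (free_product2_inr p F V (free_product_incl p (verts \<Gamma>) (vgrp \<G>) v x)) = 0"
      if "v \<in> verts \<Gamma>" "x \<in> carrier (vgrp \<G> v)" for v x
      using vertex[OF that] by (simp add: f_def canonical_map_def vertex_incl_def)
  qed
  have "f x = 0" if "x \<in> carrier P" for x
    using free_pro_p_product2_unique[OF Fp f[unfolded big_product_def] P.zero_character[unfolded big_product_def] fF fV]
      that by (simp add: big_product_def)
  moreover obtain x where "x \<in> carrier P" "A = N #>\<^bsub>P\<^esub> x"
    using A by (auto simp: fundamental_group_def quotient_group_def carrier_FactGroup)
  ultimately show ?thesis by (simp add: f_def)
qed

end

section \<open>The cup radical of the fundamental group\<close>

theorem theorem4p12:
  fixes p :: nat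
    and \<G> :: "('v, 'e, 'g, 'h) graph_groups"
    and \<Gamma> T :: "('v, 'e) serre_graph"
  assumes "prime p"
    and "graph_of_pro_p_groups p \<G> \<Gamma>"
    and "maximal_subtree T \<Gamma>"
    and "proper_graph_of_groups p \<G> \<Gamma> T"
    and vertex_radical: "\<And>v. v \<in> verts \<Gamma> \<Longrightarrow>
      cup_radical p (vgrp \<G> v) = {\<one>\<^bsub>cohomology p 1 (vgrp \<G> v)\<^esub>}"
    and tree_restriction0: "\<And>e. e \<in> edges T \<Longrightarrow>
      cohomology_map p 1 (egrp \<G> e) (bd0 \<G> e) ` carrier (cohomology p 1 (vgrp \<G> (d0 \<Gamma> e)))
        = carrier (cohomology p 1 (egrp \<G> e))"
    and tree_restriction1: "\<And>e. e \<in> edges T \<Longrightarrow>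
      cohomology_map p 1 (egrp \<G> e) (bd1 \<G> e) ` carrier (cohomology p 1 (vgrp \<G> (d1 \<Gamma> e)))
        = carrier (cohomology p 1 (egrp \<G> e))"
    and square: "\<And>e \<alpha>. e \<in> edges \<Gamma> - edges T \<Longrightarrow>
      \<alpha> \<in> carrier (cohomology p 1 (fundamental_group p \<G> T T)) \<Longrightarrow>
      cohomology_map p 1 (egrp \<G> e) (bd0 \<G> e)
          (cohomology_map p 1 (vgrp \<G> (d0 \<Gamma> e)) (canonical_map p \<G> T T (d0 \<Gamma> e)) \<alpha>)
        = cohomology_map p 1 (egrp \<G> e) (bd1 \<G> e)
            (cohomology_map p 1 (vgrp \<G> (d1 \<Gamma> e)) (canonical_map p \<G> T T (d1 \<Gamma> e)) \<alpha>)"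
    and square_surj: "\<And>e. e \<in> edges \<Gamma> - edges T \<Longrightarrow>
      (cohomology_map p 1 (egrp \<G> e) (bd0 \<G> e) \<circ>
         cohomology_map p 1 (vgrp \<G> (d0 \<Gamma> e)) (canonical_map p \<G> T T (d0 \<Gamma> e)))
        ` carrier (cohomology p 1 (fundamental_group p \<G> T T))
        = carrier (cohomology p 1 (egrp \<G> e))"
    (* Not stated in the paper, but the conclusion fails for every graph of groups with a trivial
       edge group outside T: then t_e splits off a free pro-p factor Z_p, and the class dual to t_e
       is a nonzero element of the radical (e.g. one vertex, one loop, all groups trivial). *)
    and edge_nontrivial: "\<And>e. e \<in> edges \<Gamma> - edges T \<Longrightarrow>
      carrier (egrp \<G> e) \<noteq> {\<one>\<^bsub>egrp \<G> e\<^esub>}"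
  shows "cup_radical p (fundamental_group p \<G> \<Gamma> T)
           = {\<one>\<^bsub>cohomology p 1 (fundamental_group p \<G> \<Gamma> T)\<^esub>}"
proof -
  note p = \<open>prime p\<close>
  have gog: "graph_of_pro_p_groups p \<G> \<Gamma>" and max: "maximal_subtree T \<Gamma>" by fact+
  have \<Gamma>: "finite_serre_graph \<Gamma>" "connected_graph \<Gamma>"
    and vgrp: "\<And>v. v \<in> verts \<Gamma> \<Longrightarrow> pro_p_group p (vgrp \<G> v)"
    and edge: "\<And>e. e \<in> edges \<Gamma> \<Longrightarrow> pro_p_group p (egrp \<G> e) \<and> egrp \<G> (rev_edge \<Gamma> e) = egrp \<G> e \<and>
        bd0 \<G> e \<in> continuous_hom (egrp \<G> e) (vgrp \<G> (d0 \<Gamma> e)) \<and>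
        bd1 \<G> e \<in> continuous_hom (egrp \<G> e) (vgrp \<G> (d1 \<Gamma> e)) \<and>
        (\<forall>x\<in>carrier (egrp \<G> e). bd0 \<G> e x = bd1 \<G> (rev_edge \<Gamma> e) x)"
    using gog unfolding graph_of_pro_p_groups_def by blast+
  have T: "finite_serre_graph T" "tree_graph T" "edges T \<subseteq> edges \<Gamma>"
    and dT: "d0 T = d0 \<Gamma>" "d1 T = d1 \<Gamma>" "rev_edge T = rev_edge \<Gamma>"
    using max unfolding maximal_subtree_def subgraph_def by blast+
  have verts_T: "verts T = verts \<Gamma>" by (rule maximal_subtree_spanning[OF \<Gamma> max])
  interpret G: fundamental_group_context p \<G> \<Gamma> T
    using p vgrp edge serre_graphD(1-3)[OF \<Gamma>(1)] T(3) by unfold_locales blast+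
  interpret S: fundamental_group_context p \<G> T T
    using p vgrp edge serre_graphD(1-3)[OF T(1)] T(3) unfolding verts_T dT by unfold_locales (auto simp: verts_T dT)
  interpret GC: cohomology_context G.FG p by (rule G.FG_context)
  interpret SC: cohomology_context S.FG p by (rule S.FG_context)
  have egrp_context: "cohomology_context (egrp \<G> e) p" if "e \<in> edges \<Gamma>" for e
    using edge[OF that] by (intro pro_p_group_cohomology_context p) blast
  have bd: "bd0 \<G> e \<in> continuous_hom (egrp \<G> e) (vgrp \<G> (d0 \<Gamma> e))"
    "bd1 \<G> e \<in> continuous_hom (egrp \<G> e) (vgrp \<G> (d1 \<Gamma> e))" if "e \<in> edges \<Gamma>" for e
    using edge[OF that] by blast+

  have vertex_zero: "\<alpha> x = 0"
    if v: "v \<in> verts \<Gamma>" and "character p (vgrp \<G> v) \<alpha>"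
      "\<And>\<beta>. character p (vgrp \<G> v) \<beta> \<Longrightarrow> cup_trivial p (vgrp \<G> v) \<alpha> \<beta>" "x \<in> carrier (vgrp \<G> v)" for v \<alpha> x
    using cohomology_context.cup_radical_trivial_iff[OF G.vertex_context[OF v]] vertex_radical[OF v] that by blast

  \<comment> \<open>By (2) at the end \<open>d1\<close>, the restriction of \<open>a\<close> to the
    edge group comes from a character of the other vertex group. Passage in the opposite direction
    is the same statement for the reversed edge.\<close>
  have extend_edge: "\<exists>b. character p (vgrp \<G> (d1 \<Gamma> e)) b \<and> (\<forall>x\<in>carrier (egrp \<G> e). a (bd0 \<G> e x) = b (bd1 \<G> e x))"
    if e: "e \<in> edges T" and a: "character p (vgrp \<G> (d0 \<Gamma> e)) a" for e a
  proof -
    have e\<Gamma>: "e \<in> edges \<Gamma>" using e T(3) by blast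
    note ec = egrp_context[OF e\<Gamma>] and vc = G.vertex_context[OF G.edge_ends(2)[OF e\<Gamma>]]
    have "character p (egrp \<G> e) (\<lambda>x. a (bd0 \<G> e x))"
      by (rule cohomology_map_character(1)[OF ec G.vertex_context[OF G.edge_ends(1)[OF e\<Gamma>]] bd(1)[OF e\<Gamma>] a])
    then have "{cochain1 (egrp \<G> e) (\<lambda>x. a (bd0 \<G> e x))} \<in> carrier (cohomology p 1 (egrp \<G> e))"
      unfolding cohomology_context.carrier_cohomology1[OF ec] by blast
    then obtain b where b: "character p (vgrp \<G> (d1 \<Gamma> e)) b"
      "{cochain1 (egrp \<G> e) (\<lambda>x. a (bd0 \<G> e x))} =
        cohomology_map p 1 (egrp \<G> e) (bd1 \<G> e) {cochain1 (vgrp \<G> (d1 \<Gamma> e)) b}"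
      unfolding tree_restriction1[OF e, symmetric] cohomology_context.carrier_cohomology1[OF vc] by blast
    then have "cochain1 (egrp \<G> e) (\<lambda>x. a (bd0 \<G> e x)) = cochain1 (egrp \<G> e) (\<lambda>x. b (bd1 \<G> e x))"
      unfolding cohomology_map_character(2)[OF ec vc bd(2)[OF e\<Gamma>] b(1)] by simp
    then show ?thesis
      using b(1) unfolding cohomology_context.cochain1_eq_iff[OF ec] by blast
  qed

  have restrict_T: "character p (vgrp \<G> v) (\<lambda>x. \<xi> (S.\<kappa> v x))"
    "cohomology_map p 1 (vgrp \<G> v) (S.\<kappa> v) {cochain1 S.FG \<xi>} = {cochain1 (vgrp \<G> v) (\<lambda>x. \<xi> (S.\<kappa> v x))}"
    if "v \<in> verts \<Gamma>" "character p S.FG \<xi>" for v \<xi>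
    using cohomology_map_character[OF G.vertex_context[OF that(1)] S.FG_context _ that(2)]
      S.canonical_map_hom that(1) unfolding verts_T by blast+
  have restrict_edge:
    "cohomology_map p 1 (egrp \<G> e) (bd0 \<G> e) (cohomology_map p 1 (vgrp \<G> (d0 \<Gamma> e)) (S.\<kappa> (d0 \<Gamma> e)) {cochain1 S.FG \<xi>})
      = {cochain1 (egrp \<G> e) (\<lambda>x. \<xi> (S.\<kappa> (d0 \<Gamma> e) (bd0 \<G> e x)))}"
    "cohomology_map p 1 (egrp \<G> e) (bd1 \<G> e) (cohomology_map p 1 (vgrp \<G> (d1 \<Gamma> e)) (S.\<kappa> (d1 \<Gamma> e)) {cochain1 S.FG \<xi>})
      = {cochain1 (egrp \<G> e) (\<lambda>x. \<xi> (S.\<kappa> (d1 \<Gamma> e) (bd1 \<G> e x)))}"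
    if e: "e \<in> edges \<Gamma>" and \<xi>: "character p S.FG \<xi>" for e \<xi>
    using cohomology_map_character(2)[OF egrp_context[OF e] G.vertex_context bd(1)[OF e] restrict_T(1)[OF _ \<xi>]]
      cohomology_map_character(2)[OF egrp_context[OF e] G.vertex_context bd(2)[OF e] restrict_T(1)[OF _ \<xi>]]
      restrict_T(2)[OF _ \<xi>] G.edge_ends[OF e] by simp_all
  \<comment> \<open>Inside \<open>T\<close> the two images coincide in the group of \<open>T\<close>
    already; outside \<open>T\<close> the equality is the commuting square of (3). So characters of
    the group of \<open>T\<close> are compatible along every edge of
    \<open>\<Gamma>\<close>.\<close>
  have compat: "\<xi> (S.\<kappa> (d0 \<Gamma> e) (bd0 \<G> e x)) = \<xi> (S.\<kappa> (d1 \<Gamma> e) (bd1 \<G> e x))"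
    if e: "e \<in> edges \<Gamma>" and x: "x \<in> carrier (egrp \<G> e)" and \<xi>: "character p S.FG \<xi>" for e x \<xi>
  proof (cases "e \<in> edges T")
    case True
    then show ?thesis using S.canonical_map_tree[OF True x] by (simp add: dT)
  next
    case False
    have "{cochain1 S.FG \<xi>} \<in> carrier (cohomology p 1 S.FG)"
      using \<xi> unfolding SC.carrier_cohomology1 by blast
    then have "{cochain1 (egrp \<G> e) (\<lambda>x. \<xi> (S.\<kappa> (d0 \<Gamma> e) (bd0 \<G> e x)))} =
        {cochain1 (egrp \<G> e) (\<lambda>x. \<xi> (S.\<kappa> (d1 \<Gamma> e) (bd1 \<G> e x)))}"
      using square[of e] e False unfolding restrict_edge[OF e \<xi>, symmetric] by blast
    then show ?thesis
      using x by (simp add: cohomology_context.cochain1_eq_iff[OF egrp_context[OF e]])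
  qed
  have lift: "\<exists>\<beta>. character p G.FG \<beta> \<and>
      (\<forall>v\<in>verts \<Gamma>. \<forall>x\<in>carrier (vgrp \<G> v). \<beta> (G.\<kappa> v x) = \<xi> (S.\<kappa> v x))"
    if \<xi>: "character p S.FG \<xi>" for \<xi>
    using G.fundamental_group_character_exists[of "\<lambda>v x. \<xi> (S.\<kappa> v x)", OF restrict_T(1)[OF _ \<xi>] compat[OF _ _ \<xi>]]
    by metis

  show ?thesis
    unfolding GC.cup_radical_trivial_iff
  proof (intro allI impI ballI)
    fix \<alpha> A
    assume "character p G.FG \<alpha> \<and> (\<forall>\<beta>. character p G.FG \<beta> \<longrightarrow> cup_trivial p G.FG \<alpha> \<beta>)"
      and A: "A \<in> carrier G.FG"
    then have \<alpha>: "character p G.FG \<alpha>" and rad: "\<And>\<beta>. character p G.FG \<beta> \<Longrightarrow> cup_trivial p G.FG \<alpha> \<beta>" by blast+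
    have \<alpha>_vertex: "\<alpha> (G.\<kappa> v x) = 0" if v: "v \<in> verts \<Gamma>" and x: "x \<in> carrier (vgrp \<G> v)" for v x
    proof (rule vertex_zero[OF v _ _ x])
      note \<kappa>v = G.canonical_map_hom[OF v]
      show "character p (vgrp \<G> v) (\<lambda>x. \<alpha> (G.\<kappa> v x))"
        by (rule cohomology_map_character(1)[OF G.vertex_context[OF v] G.FG_context \<kappa>v \<alpha>])
      fix \<beta>v assume \<beta>v: "character p (vgrp \<G> v) \<beta>v"
      \<comment> \<open>The labels are characters of the vertex groups, and the two labels at an
        edge are related if they agree on the edge group.\<close>
      have "\<exists>f. f v = \<beta>v \<and> (\<forall>w\<in>verts T. character p (vgrp \<G> w) (f w)) \<and>
          (\<forall>e\<in>edges T. \<forall>x\<in>carrier (egrp \<G> e). f (d0 T e) (bd0 \<G> e x) = f (d1 T e) (bd1 \<G> e x))"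
      proof (rule tree_labelling_exists[OF T(1,2), where A = "\<lambda>w. character p (vgrp \<G> w)"
            and S = "\<lambda>e a b. \<forall>x\<in>carrier (egrp \<G> e). a (bd0 \<G> e x) = b (bd1 \<G> e x)"])
        show "v \<in> verts T" using v verts_T by simp
        show "character p (vgrp \<G> v) \<beta>v" by (rule \<beta>v)
        show "\<exists>y. character p (vgrp \<G> (d1 T e)) y \<and> (\<forall>z\<in>carrier (egrp \<G> e). x (bd0 \<G> e z) = y (bd1 \<G> e z))"
          if "e \<in> edges T" "character p (vgrp \<G> (d0 T e)) x" for e x
          using extend_edge that unfolding dT by blast
        \<comment> \<open>Reversing an edge keeps its group and exchanges the two boundary
          maps.\<close>
        show "\<forall>x\<in>carrier (egrp \<G> (rev_edge T e)). b (bd0 \<G> (rev_edge T e) x) = a (bd1 \<G> (rev_edge T e) x)"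
          if e: "e \<in> edges T" and ab: "\<forall>x\<in>carrier (egrp \<G> e). a (bd0 \<G> e x) = b (bd1 \<G> e x)" for e a b
        proof
          fix x assume x: "x \<in> carrier (egrp \<G> (rev_edge T e))"
          have e\<Gamma>: "e \<in> edges \<Gamma>" using e T(3) by blast
          have xe: "x \<in> carrier (egrp \<G> e)" using x edge[OF e\<Gamma>] unfolding dT by simp
          have "bd0 \<G> (rev_edge \<Gamma> e) x = bd1 \<G> e x"
            using edge[OF serre_graphD(3)[OF \<Gamma>(1) e\<Gamma>]] serre_graphD(4)[OF \<Gamma>(1) e\<Gamma>] x unfolding dT by auto
          moreover have "bd1 \<G> (rev_edge \<Gamma> e) x = bd0 \<G> e x" using edge[OF e\<Gamma>] xe by simp
          ultimately show "b (bd0 \<G> (rev_edge T e) x) = a (bd1 \<G> (rev_edge T e) x)"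
            using ab xe unfolding dT by simp
        qed
      qed
      then obtain f where f: "f v = \<beta>v" "\<And>w. w \<in> verts T \<Longrightarrow> character p (vgrp \<G> w) (f w)"
        "\<And>e x. e \<in> edges T \<Longrightarrow> x \<in> carrier (egrp \<G> e) \<Longrightarrow> f (d0 T e) (bd0 \<G> e x) = f (d1 T e) (bd1 \<G> e x)"
        by blast
      obtain \<xi> where \<xi>: "character p S.FG \<xi>"
        "\<And>w x. w \<in> verts T \<Longrightarrow> x \<in> carrier (vgrp \<G> w) \<Longrightarrow> \<xi> (S.\<kappa> w x) = f w x"
        using S.fundamental_group_character_exists[OF f(2,3)] by blast
      obtain \<beta> where \<beta>: "character p G.FG \<beta>"
        "\<And>w x. w \<in> verts \<Gamma> \<Longrightarrow> x \<in> carrier (vgrp \<G> w) \<Longrightarrow> \<beta> (G.\<kappa> w x) = \<xi> (S.\<kappa> w x)"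
        using lift[OF \<xi>(1)] by blast
      have eq: "\<beta> (G.\<kappa> v x) = \<beta>v x" if "x \<in> carrier (vgrp \<G> v)" for x
        using \<beta>(2)[OF v that] \<xi>(2)[of v x] f(1) v that verts_T by simp
      have "cup_trivial p (vgrp \<G> v) (\<lambda>x. \<alpha> (G.\<kappa> v x)) (\<lambda>x. \<beta> (G.\<kappa> v x))"
        by (rule cup_trivial_pullback[OF G.vertex_context[OF v] \<kappa>v rad[OF \<beta>(1)]])
      then show "cup_trivial p (vgrp \<G> v) (\<lambda>x. \<alpha> (G.\<kappa> v x)) \<beta>v"
        unfolding cup_trivial_def using eq by simp
    qed
    have \<alpha>_stable: "\<alpha> (G.\<tau> e) = 0" if e: "e \<in> edges \<Gamma>" for e
    proof (cases "e \<in> edges T")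
      case True
      then show ?thesis using G.\<tau>_tree GC.character_zero[OF \<alpha>] by simp
    next
      case False
      then have eT: "e \<in> edges \<Gamma> - edges T" using e by blast
      note ec = egrp_context[OF e]
      obtain \<psi> x where \<psi>: "character p (egrp \<G> e) \<psi>" "x \<in> carrier (egrp \<G> e)" "\<psi> x \<noteq> 0"
        using pro_p_group_nontrivial_character[OF p _ edge_nontrivial[OF eT]] edge[OF e] by blast
      have "{cochain1 (egrp \<G> e) \<psi>} \<in> carrier (cohomology p 1 (egrp \<G> e))"
        using \<psi>(1) unfolding cohomology_context.carrier_cohomology1[OF ec] by blast
      then obtain \<xi> where \<xi>: "character p S.FG \<xi>"
        "{cochain1 (egrp \<G> e) \<psi>} = {cochain1 (egrp \<G> e) (\<lambda>x. \<xi> (S.\<kappa> (d0 \<Gamma> e) (bd0 \<G> e x)))}"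
        unfolding square_surj[OF eT, symmetric] SC.carrier_cohomology1 using restrict_edge(1)[OF e] by auto
      \<comment> \<open>(3) realizes \<open>\<psi>\<close> through the end \<open>d0\<close>;
        compatibility carries it to the end \<open>d1\<close>, where the edge relation uses
        it.\<close>
      have \<xi>_\<psi>: "\<xi> (S.\<kappa> (d1 \<Gamma> e) (bd1 \<G> e x)) = \<psi> x"
        using \<xi>(2) compat[OF e \<psi>(2) \<xi>(1)] \<psi>(2) by (simp add: cohomology_context.cochain1_eq_iff[OF ec])
      obtain \<beta> where \<beta>: "character p G.FG \<beta>"
        "\<And>w x. w \<in> verts \<Gamma> \<Longrightarrow> x \<in> carrier (vgrp \<G> w) \<Longrightarrow> \<beta> (G.\<kappa> w x) = \<xi> (S.\<kappa> w x)"
        using lift[OF \<xi>(1)] by blast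
      obtain c where c: "GC.cont c"
        "\<And>A B. A \<in> carrier G.FG \<Longrightarrow> B \<in> carrier G.FG \<Longrightarrow>
          (c A + c B - c (A \<otimes>\<^bsub>G.FG\<^esub> B)) mod int p = (\<alpha> A * \<beta> B) mod int p"
        using rad[OF \<beta>(1)] unfolding cup_trivial_def by blast
      \<comment> \<open>The failure of \<open>c\<close> to be additive is the product of
        \<open>\<alpha>\<close> on the left factor and \<open>\<beta>\<close> on the right one, and
        \<open>\<alpha>\<close> vanishes on vertex groups.\<close>
      have c_vertex: "character p (vgrp \<G> v) (\<lambda>x. c (G.\<kappa> v x))" if v: "v \<in> verts \<Gamma>" for v
      proof (rule characterI)
        have \<kappa>: "G.\<kappa> v \<in> hom (vgrp \<G> v) G.FG" "continuous_map (gtop (vgrp \<G> v)) (gtop G.FG) (G.\<kappa> v)"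
          using G.canonical_map_hom[OF v] by (simp_all add: continuous_hom_def)
        show "continuous_map (gtop (vgrp \<G> v)) (discrete_topology {0..int p - 1}) (\<lambda>x. c (G.\<kappa> v x))"
          using continuous_map_compose[OF \<kappa>(2) c(1)] by (simp add: o_def)
        show "topspace (gtop (vgrp \<G> v)) = carrier (vgrp \<G> v)"
          by (rule cohomology_context.topspace_G[OF G.vertex_context[OF v]])
        fix x y assume xy: "x \<in> carrier (vgrp \<G> v)" "y \<in> carrier (vgrp \<G> v)"
        note closed = G.canonical_map_closed[OF v xy(1)] G.canonical_map_closed[OF v xy(2)]
        have "int p dvd c (G.\<kappa> v x) + c (G.\<kappa> v y) - c (G.\<kappa> v x \<otimes>\<^bsub>G.FG\<^esub> G.\<kappa> v y)"
          using c(2)[OF closed] \<alpha>_vertex[OF v xy(1)] by (simp add: mod_0_imp_dvd)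
        then have "(c (G.\<kappa> v x) + c (G.\<kappa> v y)) mod int p = c (G.\<kappa> v x \<otimes>\<^bsub>G.FG\<^esub> G.\<kappa> v y) mod int p"
          by (simp add: mod_eq_dvd_iff)
        also have "\<dots> = c (G.\<kappa> v x \<otimes>\<^bsub>G.FG\<^esub> G.\<kappa> v y)"
          using closed by (intro GC.cont_range_mod[OF c(1)]) simp
        finally show "c (G.\<kappa> v (x \<otimes>\<^bsub>vgrp \<G> v\<^esub> y)) = (c (G.\<kappa> v x) + c (G.\<kappa> v y)) mod int p"
          using hom_mult[OF \<kappa>(1) xy] by simp
      qed
      \<comment> \<open>(3) speaks of characters of the group of \<open>T\<close>, whereas
        \<open>c\<close> is only a cochain on the full group; \<open>\<zeta>\<close> is the
        character with the same restrictions to the vertex groups.\<close>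
      obtain \<zeta> where \<zeta>: "character p S.FG \<zeta>"
        "\<And>w x. w \<in> verts T \<Longrightarrow> x \<in> carrier (vgrp \<G> w) \<Longrightarrow> \<zeta> (S.\<kappa> w x) = c (G.\<kappa> w x)"
      proof (rule S.fundamental_group_character_exists[of "\<lambda>v x. c (G.\<kappa> v x)"])
        show "character p (vgrp \<G> v) (\<lambda>x. c (G.\<kappa> v x))" if "v \<in> verts T" for v
          using c_vertex that verts_T by simp
        show "c (G.\<kappa> (d0 T e) (bd0 \<G> e x)) = c (G.\<kappa> (d1 T e) (bd1 \<G> e x))"
          if "e \<in> edges T" "x \<in> carrier (egrp \<G> e)" for e x
          using G.canonical_map_tree[OF that] unfolding dT by simp
      qed (use that in blast)
      let ?A = "G.\<kappa> (d0 \<Gamma> e) (bd0 \<G> e x)" and ?B = "G.\<kappa> (d1 \<Gamma> e) (bd1 \<G> e x)"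
      note bd_x = G.bd_closed[OF e \<psi>(2)]
      have closed: "?A \<in> carrier G.FG" "?B \<in> carrier G.FG" "G.\<tau> e \<in> carrier G.FG"
        using G.canonical_map_closed G.edge_ends[OF e] bd_x G.\<tau>_closed[OF e] by blast+
      have "c ?A = c ?B"
        using compat[OF e \<psi>(2) \<zeta>(1)] \<zeta>(2) G.edge_ends[OF e] bd_x verts_T by simp
      \<comment> \<open>Order matters: \<open>\<alpha>\<close> is applied to the left factor. Here
        that is a vertex element and the product term vanishes; in the next equation it is the
        stable letter and the term survives.\<close>
      moreover have "(c ?A + c (G.\<tau> e) - c (?A \<otimes>\<^bsub>G.FG\<^esub> G.\<tau> e)) mod int p = 0"
        using c(2)[OF closed(1,3)] \<alpha>_vertex[OF G.edge_ends(1)[OF e] bd_x(1)] by simp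
      moreover have "(c (G.\<tau> e) + c ?B - c (G.\<tau> e \<otimes>\<^bsub>G.FG\<^esub> ?B)) mod int p = (\<alpha> (G.\<tau> e) * \<psi> x) mod int p"
        using c(2)[OF closed(3,2)] \<beta>(2)[OF G.edge_ends(2)[OF e] bd_x(2)] \<xi>_\<psi> by simp
      \<comment> \<open>The two group products agree by the edge relation and
        \<open>c ?A = c ?B\<close>, so the left-hand sides of the two congruences are equal.\<close>
      ultimately have "(\<alpha> (G.\<tau> e) * \<psi> x) mod int p = 0"
        using G.\<tau>_conj[OF e \<psi>(2)] by (simp add: add.commute)
      then have "int p dvd \<alpha> (G.\<tau> e) * \<psi> x" by (rule mod_0_imp_dvd)
      then have "int p dvd \<alpha> (G.\<tau> e) \<or> int p dvd \<psi> x"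
        using p by (simp add: prime_dvd_mult_iff)
      moreover have "y = 0" if "int p dvd y" "y \<in> {0..int p - 1}" for y
        using that zdvd_imp_le[of "int p" y] by fastforce
      ultimately show ?thesis
        using characterD(2)[OF \<alpha> closed(3)] characterD(2)[OF \<psi>(1,2)] \<psi>(3) by blast
    qed
    show "\<alpha> A = 0"
      by (rule G.fundamental_group_character_zero[OF \<alpha> \<alpha>_vertex \<alpha>_stable A])
  qed
qed

end
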